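(* Let $(w_1,w_2,w_3,w_4)$ satisfy on $x\in[0,L]$, $t\ge0$ the control design model (with $w=(w_1,w_2,w_3)^T$ and input $\bar U(t)$) $$w_t+\Lambda^+w_x=\Sigma^{++}(x)w+\Sigma^{+-}(x)w_4,\qquad w_{4t}-\Lambda^-w_{4x}=\Sigma^{-+}(x)w,$$ $$w(0,t)=\bar Q_0w_4(0,t),\qquad w_4(L,t)=\bar R_1w(L,t)+\bar U(t),$$ and let $(\hat w_1,\hat w_2,\hat w_3,\hat w_4)$ (with $\hat w=(\hat w_1,\hat w_2,\hat w_3)^T$) satisfy the observer $$\hat w_t=-\Lambda^+\hat w_x+\Sigma^{++}(x)\hat w+\Sigma^{+-}(x)\hat w_4-P^+(x)\left(\hat w_4(0,t)-w_4(0,t)\right),$$ $$\hat w_{4t}=\Lambda^-\hat w_{4x}+\Sigma^{-+}(x)\hat w-P_{11}^-(x)\left(\hat w_4(0,t)-w_4(0,t)\right),$$ $$\hat w(0,t)=\bar Q_0w_4(0,t),\qquad \hat w_4(L,t)=\bar R_1\hat w(L,t)+\bar U(t),$$ where all coefficients are those defined in the context. Then the error states $\tilde w_i=\hat w_i-w_i$, $i=1,2,3,4$ (with $\tilde w=(\tilde w_1,\tilde w_2,\tilde w_3)^T$), are described by $$\tilde w_t=-\Lambda^+\tilde w_x+\Sigma^{++}(x)\tilde w+\Sigma^{+-}(x)\tilde w_4-P^+(x)\tilde w_4(0,t),\qquad \tilde w_{4t}=\Lambda^-\tilde w_{4x}+\Sigma^{-+}(x)\tilde w-P_{11}^-(x)\tilde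 w_4(0,t),$$ $$\tilde w(0,t)=0,\qquad \tilde w_4(L,t)=\bar R_1\tilde w(L,t).$$ Suppose the output injection gains are chosen as $$P^+(x)=-\lambda_4M(x,0),\qquad P_{11}^-(x)=-\lambda_4N_{11}(x,0),$$ where $M=(m_{11},m_{21},m_{31})^T$ is the solution on $\mathcal T=\{0\le\xi\le x\le L\}$ of the well-posed equations $$0=-\Lambda^-M_\xi(x,\xi)+\Lambda^+M_x(x,\xi)-\Sigma^{++}(x)M(x,\xi)-\Sigma^{+-}(x)\bar R_1M(L,L-(x-\xi))-\Sigma^{+-}(x)\int_0^{\frac{x-L}{\lambda_4}}\Sigma^{-+}(x-\lambda_4\nu)M(x-\lambda_4\nu,\xi-\lambda_4\nu)\,d\nu,$$ $$0=M(\xi,\xi)\Lambda^-+\Lambda^+M(\xi,\xi)-\Sigma^{+-}(\xi),$$ and $$N_{11}(x,\xi)=\bar R_1M(L,L-(x-\xi))+\int_0^{\frac{x-L}{\lambda_4}}\Sigma^{-+}(x-\lambda_4\nu)M(x-\lambda_4\nu,\xi-\lambda_4\nu)\,d\nu .$$ If the initial errors satisfy $\tilde w_i(\cdot,0)\in\mathcal L^\infty([0,L])$, $i=1,2,3,4$, then the errors converge to the zero equilibrium $\tilde w_{e,i}\equiv0$, $i=1,2,3,4$, in the finite time $$t_F=\frac{L}{v_2^*}+\frac{L}{-\lambda_4},$$ i.e. they vanish on $[0,L]$ for all $t\ge t_F$.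
   Context: **Model parameters.** $L,W>0$ (track length, width); for $i=1,2$: $a_i,V_i,\tau_i>0$, $\gamma_i>1$, $0<\overline{AO}_i\le1$; constant equilibrium densities $\rho_1^*,\rho_2^*>0$. Area occupancy $AO(\rho_1,\rho_2)=\frac{a_1\rho_1+a_2\rho_2}{W}$; pressures $p_i(AO)=V_i(AO/\overline{AO}_i)^{\gamma_i}$; equilibrium speeds $V_{e,i}(AO)=V_i\left(1-(AO/\overline{AO}_i)^{\gamma_i}\right)$. Equilibrium velocities are $v_i^*=V_{e,i}(AO(\rho_1^*,\rho_2^* ))$. Put $\beta_{ij}=\partial p_i(AO(\rho_1,\rho_2))/\partial\rho_j$ evaluated at $(\rho_1^*,\rho_2^* )$ and $\alpha_i=\beta_{ii}$. **Matrices.** $$\tilde J_x=\begin{pmatrix}v_1^*&\rho_1^*&0&0\\0&v_1^*-\beta_{11}\rho_1^*&\beta_{12}(v_1^*-v_2^* )&-\beta_{12}\rho_2^*\\0&0&v_2^*&\rho_2^*\\ \beta_{21}(v_2^*-v_1^* )&-\beta_{21}\rho_1^*&0&v_2^*-\beta_{22}\rho_2^*\end{pmatrix},\quad \tilde J=\begin{pmatrix}0&0&0&0\\ -\frac{\beta_{11}}{\tau_1}&-\frac1{\tau_1}&-\frac{\beta_{12}}{\tau_1}&0\\0&0&0&0\\ -\frac{\beta_{21}}{\tau_2}&0&-\frac{\beta_{22}}{\tau_2}&-\frac1{\tau_2}\end{pmatrix}.$$ The eigenvalues of $\tilde J_x$ (characteristic speeds) are $\lambda_1=v_1^*$, $\lambda_2=v_2^*$,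 $\lambda_{3}=\frac12(v_1^*+v_2^*-\alpha_1\rho_1^*-\alpha_2\rho_2^*+\Delta)$, $\lambda_{4}=\frac12(v_1^*+v_2^*-\alpha_1\rho_1^*-\alpha_2\rho_2^*-\Delta)$, with $\Delta=\sqrt{(\alpha_2\rho_2^*-\alpha_1\rho_1^*+v_1^*-v_2^* )^2+4\alpha_1\alpha_2\rho_1^*\rho_2^*}$. **Standing assumptions.** $v_1^*>v_2^*>0$ (so $\lambda_2<\lambda_3<\lambda_1$), and the congested regime: $\lambda_1,\lambda_2,\lambda_3>0$, $\lambda_4<0$. **Diagonalization.** $V=(v_{ij})_{1\le i,j\le4}$ is a constant invertible matrix with $V^{-1}\tilde J_xV=\mathrm{diag}(\lambda_1,\lambda_2,\lambda_3,\lambda_4)$; $\hat J=(\hat J_{ij})=V^{-1}\tilde JV$; $\kappa_i=v_1^*v_{1i}+\rho_1^*v_{2i}+v_2^*v_{3i}+\rho_2^*v_{4i}$, $i=1,\dots,4$. Set $$\hat Q_0=-\begin{pmatrix}v_{11}&v_{12}&v_{13}\\ v_{31}&v_{32}&v_{33}\\ \kappa_1&\kappa_2&\kappa_3\end{pmatrix}^{-1}\begin{pmatrix}v_{14}\\ v_{34}\\ \kappa_4\end{pmatrix},\qquad \hat R_1=-\frac1{\kappa_4}(\kappa_1,\kappa_2,\kappa_3)$$ (the inverse is assumed to exist and $\kappa_4\ne0$). Write $\theta_i=\hat J_{ii}/\lambda_i$, $i=1,\dots,4$, and $$\bar Q_0=\begin{pmatrix}0&0&1\\1&0&0\\0&1&0\end{pmatrix}^{-1}\hat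 Q_0,\qquad \bar R_1=\hat R_1\begin{pmatrix}0&0&e^{(\theta_1-\theta_4)L}\\ e^{(\theta_2-\theta_4)L}&0&0\\0&e^{(\theta_3-\theta_4)L}&0\end{pmatrix}.$$ **Coefficients.** $\Lambda^+=\mathrm{diag}(v_2^*,\lambda_3,v_1^* )$, $\Lambda^-=-\lambda_4>0$, $$\Sigma^{++}=\begin{pmatrix}0&\bar J_{12}&\bar J_{13}\\ \bar J_{21}&0&\bar J_{23}\\ \bar J_{31}&\bar J_{32}&0\end{pmatrix},\quad \Sigma^{+-}=(\bar J_{14},\bar J_{24},\bar J_{34})^T,\quad \Sigma^{-+}=(\bar J_{41},\bar J_{42},\bar J_{43}),$$ where, as functions of $x$: $\bar J_{12}=\hat J_{23}e^{(\theta_3-\theta_2)x}$, $\bar J_{13}=\hat J_{21}e^{(\theta_1-\theta_2)x}$, $\bar J_{14}=\hat J_{24}e^{(\theta_4-\theta_2)x}$, $\bar J_{21}=\hat J_{32}e^{(\theta_2-\theta_3)x}$, $\bar J_{23}=\hat J_{31}e^{(\theta_1-\theta_3)x}$, $\bar J_{24}=\hat J_{34}e^{(\theta_4-\theta_3)x}$, $\bar J_{31}=\hat J_{12}e^{(\theta_2-\theta_1)x}$, $\bar J_{32}=\hat J_{13}e^{(\theta_3-\theta_1)x}$, $\bar J_{34}=\hat J_{14}e^{(\theta_4-\theta_1)x}$, $\bar J_{41}=\hat J_{42}e^{(\theta_2-\theta_4)x}$, $\bar J_{42}=\hat J_{43}e^{(\theta_3-\theta_4)x}$, $\bar J_{43}=\hat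 J_{41}e^{(\theta_1-\theta_4)x}$. $M$ is a $3\times1$ column-vector-valued and $N_{11}$ a scalar function in $L^\infty(\mathcal T)$; the kernel equations are understood along characteristics. Since initial data are only $L^\infty$, solutions of the PDE systems are understood in the weak sense (along characteristics). *)

theory Defs
  imports "HOL-Analysis.Analysis"
begin

section \<open>Model parameters and equilibrium\<close>

record traffic =
  len :: real             \<comment> \<open>\<open>L\<close>\<close>
  width :: real           \<comment> \<open>\<open>W\<close>\<close>
  area :: "real^2"        \<comment> \<open>\<open>a\<^sub>i\<close>\<close>
  vmax :: "real^2"        \<comment> \<open>\<open>V\<^sub>i\<close>\<close>
  tau :: "real^2"
  gam :: "real^2"
  aomax :: "real^2"       \<comment> \<open>\<open>AO\<^sub>i\<close> with overline\<close>
  rho :: "real^2"         \<comment> \<open>equilibrium densities\<close>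

definition admissible :: "traffic \<Rightarrow> bool" where
  "admissible p \<longleftrightarrow> 0 < len p \<and> 0 < width p \<and>
     (\<forall>i. 0 < area p $ i \<and> 0 < vmax p $ i \<and> 0 < tau p $ i \<and> 1 < gam p $ i \<and>
          0 < aomax p $ i \<and> aomax p $ i \<le> 1 \<and> 0 < rho p $ i)"

definition AO :: "traffic \<Rightarrow> real^2 \<Rightarrow> real" where
  "AO p r = (area p $ 1 * r $ 1 + area p $ 2 * r $ 2) / width p"

definition pressure :: "traffic \<Rightarrow> 2 \<Rightarrow> real \<Rightarrow> real" where
  "pressure p i A = vmax p $ i * (A / aomax p $ i) powr (gam p $ i)"

definition Ve :: "traffic \<Rightarrow> 2 \<Rightarrow> real \<Rightarrow> real" where
  "Ve p i A = vmax p $ i * (1 - (A / aomax p $ i) powr (gam p $ i))"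

definition vstar :: "traffic \<Rightarrow> 2 \<Rightarrow> real" where
  "vstar p i = Ve p i (AO p (rho p))"

text \<open>Partial derivative of the \<open>i\<close>-th pressure in the \<open>j\<close>-th density.\<close>
definition beta :: "traffic \<Rightarrow> 2 \<Rightarrow> 2 \<Rightarrow> real" where
  "beta p i j = deriv (\<lambda>s. pressure p i (AO p (\<chi> k. if k = j then s else rho p $ k))) (rho p $ j)"

definition alpha :: "traffic \<Rightarrow> 2 \<Rightarrow> real" where
  "alpha p i = beta p i i"


section \<open>Linearized system and characteristic speeds\<close>

definition Jx :: "traffic \<Rightarrow> real^4^4" where
  "Jx p = vector
    [vector [vstar p 1, rho p $ 1, 0, 0],
     vector [0, vstar p 1 - beta p 1 1 * rho p $ 1,
             beta p 1 2 * (vstar p 1 - vstar p 2), - (beta p 1 2 * rho p $ 2)],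
     vector [0, 0, vstar p 2, rho p $ 2],
     vector [beta p 2 1 * (vstar p 2 - vstar p 1), - (beta p 2 1 * rho p $ 1),
             0, vstar p 2 - beta p 2 2 * rho p $ 2]]"

definition J :: "traffic \<Rightarrow> real^4^4" where
  "J p = vector
    [vector [0, 0, 0, 0],
     vector [- (beta p 1 1 / tau p $ 1), - (1 / tau p $ 1), - (beta p 1 2 / tau p $ 1), 0],
     vector [0, 0, 0, 0],
     vector [- (beta p 2 1 / tau p $ 2), 0, - (beta p 2 2 / tau p $ 2), - (1 / tau p $ 2)]]"

definition Delta :: "traffic \<Rightarrow> real" where
  "Delta p = sqrt ((alpha p 2 * rho p $ 2 - alpha p 1 * rho p $ 1 + vstar p 1 - vstar p 2)\<^sup>2
                   + 4 * alpha p 1 * alpha p 2 * rho p $ 1 * rho p $ 2)"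

definition lam :: "traffic \<Rightarrow> real^4" where
  "lam p = vector
    [vstar p 1,
     vstar p 2,
     (vstar p 1 + vstar p 2 - alpha p 1 * rho p $ 1 - alpha p 2 * rho p $ 2 + Delta p) / 2,
     (vstar p 1 + vstar p 2 - alpha p 1 * rho p $ 1 - alpha p 2 * rho p $ 2 - Delta p) / 2]"

definition congested :: "traffic \<Rightarrow> bool" where
  "congested p \<longleftrightarrow> vstar p 1 > vstar p 2 \<and> vstar p 2 > 0 \<and>
     lam p $ 1 > 0 \<and> lam p $ 2 > 0 \<and> lam p $ 3 > 0 \<and> lam p $ 4 < 0"

definition diag :: "'a::zero^'n \<Rightarrow> 'a^'n^'n" where
  "diag d = (\<chi> i j. if i = j then d $ i else 0)"

definition diagonalizes :: "traffic \<Rightarrow> real^4^4 \<Rightarrow> bool" where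
  "diagonalizes p V \<longleftrightarrow> invertible V \<and> matrix_inv V ** Jx p ** V = diag (lam p)"

definition Jhat :: "traffic \<Rightarrow> real^4^4 \<Rightarrow> real^4^4" where
  "Jhat p V = matrix_inv V ** J p ** V"

definition kappa :: "traffic \<Rightarrow> real^4^4 \<Rightarrow> real^4" where
  "kappa p V = (\<chi> i. vstar p 1 * V $ 1 $ i + rho p $ 1 * V $ 2 $ i
                    + vstar p 2 * V $ 3 $ i + rho p $ 2 * V $ 4 $ i)"

definition inflow_matrix :: "traffic \<Rightarrow> real^4^4 \<Rightarrow> real^3^3" where
  "inflow_matrix p V = vector
    [vector [V $ 1 $ 1, V $ 1 $ 2, V $ 1 $ 3],
     vector [V $ 3 $ 1, V $ 3 $ 2, V $ 3 $ 3],
     vector [kappa p V $ 1, kappa p V $ 2, kappa p V $ 3]]"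

definition Qhat0 :: "traffic \<Rightarrow> real^4^4 \<Rightarrow> real^3" where
  "Qhat0 p V = - (matrix_inv (inflow_matrix p V) *v vector [V $ 1 $ 4, V $ 3 $ 4, kappa p V $ 4])"

text \<open>Row vectors are elements of \<open>real^3\<close>: they act on matrices by \<open>v*\<close> and on columns by the
  inner product.\<close>
definition Rhat1 :: "traffic \<Rightarrow> real^4^4 \<Rightarrow> real^3" where
  "Rhat1 p V = (- (1 / kappa p V $ 4)) *\<^sub>R vector [kappa p V $ 1, kappa p V $ 2, kappa p V $ 3]"

definition theta :: "traffic \<Rightarrow> real^4^4 \<Rightarrow> 4 \<Rightarrow> real" where
  "theta p V i = Jhat p V $ i $ i / lam p $ i"

definition Q0 :: "traffic \<Rightarrow> real^4^4 \<Rightarrow> real^3" where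
  "Q0 p V = matrix_inv (vector [vector [0, 0, 1], vector [1, 0, 0], vector [0, 1, 0]] :: real^3^3)
            *v Qhat0 p V"

definition R1 :: "traffic \<Rightarrow> real^4^4 \<Rightarrow> real^3" where
  "R1 p V = Rhat1 p V v* (vector
    [vector [0, 0, exp ((theta p V 1 - theta p V 4) * len p)],
     vector [exp ((theta p V 2 - theta p V 4) * len p), 0, 0],
     vector [0, exp ((theta p V 3 - theta p V 4) * len p), 0]] :: real^3^3)"


section \<open>Coefficients of the control design model\<close>

definition Lamp :: "traffic \<Rightarrow> real^3^3" where
  "Lamp p = diag (vector [vstar p 2, lam p $ 3, vstar p 1])"

definition Lamm :: "traffic \<Rightarrow> real" where
  "Lamm p = - (lam p $ 4)"

text \<open>Coupling coefficients after the exponential scaling.  The indices \<open>a\<close>, \<open>b\<close> refer to the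
  ordering of \<open>lam\<close>, whereas the rows and columns of the \<open>Sig\<close> matrices below are ordered
  as \<open>Lamp\<close>, i.e. 2, 3, 1.\<close>
definition Jsc :: "traffic \<Rightarrow> real^4^4 \<Rightarrow> 4 \<Rightarrow> 4 \<Rightarrow> real \<Rightarrow> real" where
  "Jsc p V a b x = Jhat p V $ a $ b * exp ((theta p V b - theta p V a) * x)"

definition Sigpp :: "traffic \<Rightarrow> real^4^4 \<Rightarrow> real \<Rightarrow> real^3^3" where
  "Sigpp p V x = vector
    [vector [0, Jsc p V 2 3 x, Jsc p V 2 1 x],
     vector [Jsc p V 3 2 x, 0, Jsc p V 3 1 x],
     vector [Jsc p V 1 2 x, Jsc p V 1 3 x, 0]]"

definition Sigpm :: "traffic \<Rightarrow> real^4^4 \<Rightarrow> real \<Rightarrow> real^3" where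
  "Sigpm p V x = vector [Jsc p V 2 4 x, Jsc p V 3 4 x, Jsc p V 1 4 x]"

definition Sigmp :: "traffic \<Rightarrow> real^4^4 \<Rightarrow> real \<Rightarrow> real^3" where
  "Sigmp p V x = vector [Jsc p V 4 2 x, Jsc p V 4 3 x, Jsc p V 4 1 x]"


section \<open>Weak solutions along characteristics\<close>

definition Linf_on :: "'a::euclidean_space set \<Rightarrow> ('a \<Rightarrow> 'b::euclidean_space) \<Rightarrow> bool" where
  "Linf_on S f \<longleftrightarrow> f \<in> borel_measurable (lebesgue_on S) \<and>
     (\<exists>C. AE x in lebesgue_on S. norm (f x) \<le> C)"

text \<open>Weak form of \<open>u\<^sub>t + c u\<^sub>x = f\<close> on \<open>[0, l] \<times> [0, \<infinity>)\<close>: for almost every \<open>y\<close>, the equation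
  integrated along the characteristic \<open>x = y + c t\<close> holds between any two of its points in the
  closed domain.  This also gives a meaning to the initial values \<open>u(\<cdot>,0)\<close> and, for \<open>c \<noteq> 0\<close>, to
  the boundary traces \<open>u(0,\<cdot>)\<close> and \<open>u(l,\<cdot>)\<close> almost everywhere.\<close>
definition transport :: "real \<Rightarrow> real \<Rightarrow> (real \<Rightarrow> real \<Rightarrow> real) \<Rightarrow> (real \<Rightarrow> real \<Rightarrow> real) \<Rightarrow> bool" where
  "transport l c u f \<longleftrightarrow>
     (AE y in lebesgue. \<forall>s t. 0 \<le> s \<and> s \<le> t \<and> y + c * s \<in> {0..l} \<and> y + c * t \<in> {0..l} \<longrightarrow>
        (\<lambda>r. f (y + c * r) r) absolutely_integrable_on {s..t} \<and>
        u (y + c * t) t - u (y + c * s) s = integral {s..t} (\<lambda>r. f (y + c * r) r))"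

text \<open>\<open>w\<^sub>t + \<Lambda>\<^sup>+ w\<^sub>x = F\<close>, \<open>z\<^sub>t - \<Lambda>\<^sup>- z\<^sub>x = G\<close>, with \<open>z\<close> in the role of the fourth state.\<close>
definition weak_solution ::
  "traffic \<Rightarrow> (real \<Rightarrow> real \<Rightarrow> real^3) \<Rightarrow> (real \<Rightarrow> real \<Rightarrow> real) \<Rightarrow>
   (real \<Rightarrow> real \<Rightarrow> real^3) \<Rightarrow> (real \<Rightarrow> real \<Rightarrow> real) \<Rightarrow> bool" where
  "weak_solution p F G w z \<longleftrightarrow>
     (\<forall>T>0. Linf_on ({0..len p} \<times> {0..T}) (\<lambda>(x, t). w x t) \<and>
            Linf_on ({0..len p} \<times> {0..T}) (\<lambda>(x, t). z x t)) \<and>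
     (\<forall>i. transport (len p) (Lamp p $ i $ i) (\<lambda>x t. w x t $ i) (\<lambda>x t. F x t $ i)) \<and>
     transport (len p) (- Lamm p) z G"

definition plant_solution ::
  "traffic \<Rightarrow> real^4^4 \<Rightarrow> (real \<Rightarrow> real) \<Rightarrow>
   (real \<Rightarrow> real \<Rightarrow> real^3) \<Rightarrow> (real \<Rightarrow> real \<Rightarrow> real) \<Rightarrow> bool" where
  "plant_solution p V U w z \<longleftrightarrow>
     weak_solution p
       (\<lambda>x t. Sigpp p V x *v w x t + z x t *\<^sub>R Sigpm p V x)
       (\<lambda>x t. Sigmp p V x \<bullet> w x t)
       w z \<and>
     (AE t in lebesgue_on {0..}. w 0 t = z 0 t *\<^sub>R Q0 p V) \<and>
     (AE t in lebesgue_on {0..}. z (len p) t = R1 p V \<bullet> w (len p) t + U t)"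

text \<open>The observer, driven by the input \<open>U\<close> and the measured output \<open>y(t) = w\<^sub>4(0,t)\<close>.\<close>
definition observer_solution ::
  "traffic \<Rightarrow> real^4^4 \<Rightarrow> (real \<Rightarrow> real^3) \<Rightarrow> (real \<Rightarrow> real) \<Rightarrow> (real \<Rightarrow> real) \<Rightarrow> (real \<Rightarrow> real) \<Rightarrow>
   (real \<Rightarrow> real \<Rightarrow> real^3) \<Rightarrow> (real \<Rightarrow> real \<Rightarrow> real) \<Rightarrow> bool" where
  "observer_solution p V Pp Pm U y wh zh \<longleftrightarrow>
     weak_solution p
       (\<lambda>x t. Sigpp p V x *v wh x t + zh x t *\<^sub>R Sigpm p V x - (zh 0 t - y t) *\<^sub>R Pp x)
       (\<lambda>x t. Sigmp p V x \<bullet> wh x t - Pm x * (zh 0 t - y t))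
       wh zh \<and>
     (AE t in lebesgue_on {0..}. wh 0 t = y t *\<^sub>R Q0 p V) \<and>
     (AE t in lebesgue_on {0..}. zh (len p) t = R1 p V \<bullet> wh (len p) t + U t)"

definition error_solution ::
  "traffic \<Rightarrow> real^4^4 \<Rightarrow> (real \<Rightarrow> real^3) \<Rightarrow> (real \<Rightarrow> real) \<Rightarrow>
   (real \<Rightarrow> real \<Rightarrow> real^3) \<Rightarrow> (real \<Rightarrow> real \<Rightarrow> real) \<Rightarrow> bool" where
  "error_solution p V Pp Pm we ze \<longleftrightarrow>
     weak_solution p
       (\<lambda>x t. Sigpp p V x *v we x t + ze x t *\<^sub>R Sigpm p V x - ze 0 t *\<^sub>R Pp x)
       (\<lambda>x t. Sigmp p V x \<bullet> we x t - Pm x * ze 0 t)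
       we ze \<and>
     (AE t in lebesgue_on {0..}. we 0 t = 0) \<and>
     (AE t in lebesgue_on {0..}. ze (len p) t = R1 p V \<bullet> we (len p) t)"


section \<open>Kernel equations\<close>

definition Tri :: "traffic \<Rightarrow> (real \<times> real) set" where
  "Tri p = {(x, \<xi>). 0 \<le> \<xi> \<and> \<xi> \<le> x \<and> x \<le> len p}"

definition kernel_refl ::
  "traffic \<Rightarrow> real^4^4 \<Rightarrow> (real \<Rightarrow> real \<Rightarrow> real^3) \<Rightarrow> real \<Rightarrow> real \<Rightarrow> real" where
  "kernel_refl p V M x \<xi> = R1 p V \<bullet> M (len p) (len p - (x - \<xi>))"

definition kernel_int ::
  "traffic \<Rightarrow> real^4^4 \<Rightarrow> (real \<Rightarrow> real \<Rightarrow> real^3) \<Rightarrow> real \<Rightarrow> real \<Rightarrow> real" where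
  "kernel_int p V M x \<xi> = integral {0..(x - len p) / lam p $ 4}
     (\<lambda>\<nu>. Sigmp p V (x - lam p $ 4 * \<nu>) \<bullet> M (x - lam p $ 4 * \<nu>) (\<xi> - lam p $ 4 * \<nu>))"

definition N11 ::
  "traffic \<Rightarrow> real^4^4 \<Rightarrow> (real \<Rightarrow> real \<Rightarrow> real^3) \<Rightarrow> real \<Rightarrow> real \<Rightarrow> real" where
  "N11 p V M x \<xi> = kernel_refl p V M x \<xi> + kernel_int p V M x \<xi>"

definition kernel_source ::
  "traffic \<Rightarrow> real^4^4 \<Rightarrow> (real \<Rightarrow> real \<Rightarrow> real^3) \<Rightarrow> real \<Rightarrow> real \<Rightarrow> real^3" where
  "kernel_source p V M x \<xi> = Sigpp p V x *v M x \<xi>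
     + kernel_refl p V M x \<xi> *\<^sub>R Sigpm p V x + kernel_int p V M x \<xi> *\<^sub>R Sigpm p V x"

text \<open>\<open>\<Lambda>\<^sup>+ M\<^sub>x - \<Lambda>\<^sup>- M\<^sub>\<xi> = kernel_source\<close> along characteristics: for component \<open>i\<close> these are the lines
  of direction \<open>(\<lambda>\<^sub>i\<^sup>+, - \<Lambda>\<^sup>-)\<close>.  Each of them that meets the triangle enters it at one point
  \<open>(\<eta>, \<eta>)\<close> of the diagonal, so they are parametrized by \<open>\<eta> \<in> [0, L]\<close>.\<close>
definition kernel_solution :: "traffic \<Rightarrow> real^4^4 \<Rightarrow> (real \<Rightarrow> real \<Rightarrow> real^3) \<Rightarrow> bool" where
  "kernel_solution p V M \<longleftrightarrow>
     Linf_on (Tri p) (\<lambda>(x, \<xi>). M x \<xi>) \<and>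
     (\<forall>i. AE \<eta> in lebesgue_on {0..len p}. \<forall>s\<ge>0.
        (\<eta> + Lamp p $ i $ i * s, \<eta> - Lamm p * s) \<in> Tri p \<longrightarrow>
        (\<lambda>r. kernel_source p V M (\<eta> + Lamp p $ i $ i * r) (\<eta> - Lamm p * r) $ i)
          absolutely_integrable_on {0..s} \<and>
        M (\<eta> + Lamp p $ i $ i * s) (\<eta> - Lamm p * s) $ i - M \<eta> \<eta> $ i =
        integral {0..s} (\<lambda>r. kernel_source p V M (\<eta> + Lamp p $ i $ i * r) (\<eta> - Lamm p * r) $ i)) \<and>
     (AE \<xi> in lebesgue_on {0..len p}.
        0 = Lamm p *\<^sub>R M \<xi> \<xi> + Lamp p *v M \<xi> \<xi> - Sigpm p V \<xi>)"

text \<open>Uniqueness is that of elements of \<open>L\<^sup>\<infinity>\<close> of the triangle.\<close>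
definition kernel_well_posed :: "traffic \<Rightarrow> real^4^4 \<Rightarrow> bool" where
  "kernel_well_posed p V \<longleftrightarrow>
     (\<exists>M. kernel_solution p V M) \<and>
     (\<forall>M M'. kernel_solution p V M \<and> kernel_solution p V M' \<longrightarrow>
        (AE (x, \<xi>) in lebesgue_on (Tri p). M x \<xi> = M' x \<xi>))"

definition observer_gains ::
  "traffic \<Rightarrow> real^4^4 \<Rightarrow> (real \<Rightarrow> real \<Rightarrow> real^3) \<Rightarrow> (real \<Rightarrow> real^3) \<Rightarrow> (real \<Rightarrow> real) \<Rightarrow> bool" where
  "observer_gains p V M Pp Pm \<longleftrightarrow>
     (\<forall>x\<in>{0..len p}. Pp x = (- (lam p $ 4)) *\<^sub>R M x 0 \<and> Pm x = - (lam p $ 4) * N11 p V M x 0)"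

definition tF :: "traffic \<Rightarrow> real" where
  "tF p = len p / vstar p 2 + len p / (- (lam p $ 4))"

end

theory Submission
  imports Defs
begin

text \<open>In the coordinates \<open>(x, d)\<close> with \<open>d = x - \<xi>\<close> the source of the kernel equations, including its nonlocal
  terms, couples only points with the same \<open>d\<close>.  The equations are therefore of Volterra type in
  \<open>d\<close>: a contraction argument with weight \<open>exp (k * d)\<close> gives a continuous solution, and the same weight
  gives uniqueness among \<open>L\<^sup>\<infinity>\<close> solutions, so that the gains of any solution are almost everywhere
  those of the continuous one.

  For the convergence no inverse transformation and no target system are needed.  Let \<open>b\<close> be the trace
  at \<open>x = 0\<close> of the fourth error state, \<open>\<Lambda>\<close> its speed, and put
  \<open>e(x,t) = \<integral>\<^sub>0\<^sup>x M(x,\<xi>) b(t + \<xi>/\<Lambda>) d\<xi>\<close> and \<open>z(x,t) = b(t + x/\<Lambda>) + \<integral>\<^sub>0\<^sup>x N(x,\<xi>) b(t + \<xi>/\<Lambda>) d\<xi>\<close>.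
  By the kernel equations and Fubini's theorem this pair solves the error equations along all
  characteristics issuing from \<open>x = 0\<close>, with the traces \<open>0\<close> and \<open>b\<close>.  Evolving in \<open>x\<close> instead of \<open>t\<close>,
  it agrees with the errors on \<open>t \<ge> x / v\<close>, where \<open>v\<close> is the slowest speed.  Since \<open>N(L,\<xi>)\<close> is the
  reflection of \<open>M(L,\<xi>)\<close>, the boundary condition at \<open>x = L\<close> then reads \<open>b(t + L/\<Lambda>) = 0\<close> for
  \<open>t \<ge> L / v\<close>, and the errors are given by the values of \<open>b\<close> at later times.\<close>

section \<open>Null sets along families of lines\<close>

text \<open>The obstacle is low regularity. Kernels and states are controlled only along almost
  every characteristic, each component has its own family of lines, and yet the equations read them
  on null sets of the plane: M on \<open>x = L\<close> and on \<xi> = 0, the fourth state on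
  \<open>x = 0\<close>. Estimates are therefore kept in the form: on almost every characteristic, at
  every point of it. They pass to almost every point of the plane, where all components can be
  compared, and back again. The passage to the plane requires measurability, hence the Borel
  versions. Both uniqueness arguments have the same shape. A bound \<open>C\<close> times an
  exponential weight is integrated along characteristics that start on a line with known data, the
  diagonal for kernels and \<open>x = 0\<close> for errors. The distance from that line grows at a
  positive rate, so the weight yields a factor of order \<open>1 / k\<close>; for large
  \<open>k\<close> the bound improves to \<open>C / 2\<close>, and iteration gives zero.\<close>

lemma AE_lebesgue_iff_negligible:
  "(AE x in lebesgue. P x) \<longleftrightarrow> negligible {x. \<not> P x}"
  by (simp add: completion.AE_iff_null_sets negligible_iff_null_sets)

lemma AE_vimage_linear:
  fixes f :: "'a::euclidean_space \<Rightarrow> 'a"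
  assumes "AE x in lebesgue. P x" "linear f" "inj f"
  shows "AE x in lebesgue. P (f x)"
proof -
  have "negligible {x \<in> UNIV. f x \<in> {x. \<not> P x}}"
    by (rule negligible_differentiable_vimage[where f' = "\<lambda>_. f"])
       (use assms in \<open>auto simp: AE_lebesgue_iff_negligible linear_conv_bounded_linear
         intro: bounded_linear_imp_has_derivative\<close>)
  then show ?thesis by (simp add: AE_lebesgue_iff_negligible)
qed

lemma AE_affine:
  fixes a b :: real
  assumes "AE x in lebesgue. P x" "b \<noteq> 0"
  shows "AE x in lebesgue. P (a + b * x)"
proof -
  have "negligible {x \<in> UNIV. a + b * x \<in> {x. \<not> P x}}"
    by (rule negligible_differentiable_vimage[where f' = "\<lambda>_ x. b * x"])
       (use assms in \<open>auto simp: AE_lebesgue_iff_negligible inj_def intro!: derivative_eq_intros\<close>)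
  then show ?thesis by (simp add: AE_lebesgue_iff_negligible)
qed

text \<open>Lebesgue measure on the plane is only the completion of a product measure. Almost
  everywhere statements are the same for \<open>lborel\<close>, which is a product, so Fubini
  applies there.\<close>

lemma AE_Pair:
  fixes P :: "real \<times> real \<Rightarrow> bool"
  assumes "AE z in lebesgue. P z"
  shows "AE y in lebesgue. AE r in lebesgue. P (y, r)"
proof -
  have "AE z in lborel \<Otimes>\<^sub>M lborel. P z"
    using assms unfolding AE_completion_iff lborel_prod .
  then show ?thesis unfolding AE_completion_iff by (rule lborel_pair.AE_pair)
qed

text \<open>Measurability is essential: a non-measurable set can have null sections without being
  null. This is why bounds are carried over to Borel versions before they are spread from lines to
  the plane.\<close>

lemma AE_Pair_converse:
  fixes P :: "real \<times> real \<Rightarrow> bool"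
  assumes [measurable]: "Measurable.pred borel P"
    and "AE y in lebesgue. AE r in lebesgue. P (y, r)"
  shows "AE z in lebesgue. P z"
proof -
  have "{z \<in> space (lborel \<Otimes>\<^sub>M lborel). P z} \<in> sets (lborel \<Otimes>\<^sub>M lborel)"
    unfolding lborel_prod by simp
  from lborel_pair.AE_pair_measure[OF this] assms(2) show ?thesis
    unfolding AE_completion_iff lborel_prod by simp
qed

text \<open>\<open>y\<close> labels a line of a parallel family and \<open>r\<close> is the position
  on it; the determinant condition says that \<open>(y, r)\<close> are coordinates of the
  plane.\<close>

lemma AE_lines:
  fixes P :: "real \<times> real \<Rightarrow> bool"
  assumes "AE z in lebesgue. P z" "a * d - b * e \<noteq> 0"
  shows "AE y in lebesgue. AE r in lebesgue. P (a * y + b * r, e * y + d * r)"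
proof -
  let ?f = "\<lambda>(y, r). (a * y + b * r, e * y + d * r)"
  have "linear ?f" by (auto intro!: linearI simp: algebra_simps)
  moreover have "inj ?f"
  proof (rule injI, clarsimp)
    fix y r y' r'
    assume h: "a * y + b * r = a * y' + b * r'" "e * y + d * r = e * y' + d * r'"
    have "(a * d - b * e) * (y - y') = 0" "(a * d - b * e) * (r - r') = 0"
      using h by algebra+
    with assms(2) show "y = y' \<and> r = r'" by auto
  qed
  ultimately show ?thesis
    using AE_Pair[OF AE_vimage_linear[OF assms(1), of ?f]] by simp
qed

lemma AE_lines_converse:
  fixes P :: "real \<times> real \<Rightarrow> bool"
  assumes [measurable]: "Measurable.pred borel P"
    and ae: "AE y in lebesgue. AE r in lebesgue. P (a * y + b * r, e * y + d * r)"
    and D: "a * d - b * e \<noteq> 0"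
  shows "AE z in lebesgue. P z"
proof -
  define D where "D = a * d - b * e"
  \<comment> \<open>The inverse of the coordinate change, by Cramer's rule.\<close>
  let ?g = "\<lambda>(x, t). (d / D * x + (- b / D) * t, (- e / D) * x + a / D * t)"
  define Q where "Q z = P (a * fst z + b * snd z, e * fst z + d * snd z)" for z
  have "(\<lambda>z. (a * fst z + b * snd z, e * fst z + d * snd z)) \<in> borel_measurable (borel :: (real \<times> real) measure)"
    by (intro borel_measurable_continuous_onI continuous_intros)
  from measurable_compose[OF this assms(1)] have "Measurable.pred borel Q"
    unfolding Q_def .
  then have Q: "AE z in lebesgue. Q z"
    by (rule AE_Pair_converse) (use ae in \<open>simp add: Q_def\<close>)
  have inv: "a * (d / D * x + (- b / D) * t) + b * ((- e / D) * x + a / D * t) = x"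
    "e * (d / D * x + (- b / D) * t) + d * ((- e / D) * x + a / D * t) = t" for x t
    using D by (simp_all add: D_def divide_simps) (simp_all add: algebra_simps)
  have "linear ?g" by (auto intro!: linearI simp: algebra_simps add_divide_distrib)
  moreover have "inj ?g"
  proof (rule injI)
    fix z z' assume "?g z = ?g z'"
    then show "z = z'"
      using inv[of "fst z" "snd z"] inv[of "fst z'" "snd z'"] by (cases z; cases z') (auto simp only: split fst_conv snd_conv prod.inject)
  qed
  ultimately have "AE z in lebesgue. Q (?g z)" by (rule AE_vimage_linear[OF Q])
  moreover have "Q (?g z) = P z" for z
    by (cases z) (simp only: Q_def split fst_conv snd_conv inv)
  ultimately show ?thesis by simp
qed

section \<open>Integrals and essentially bounded functions up to null sets\<close>

lemma AE_integral_cong: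
  fixes f g :: "real \<Rightarrow> 'b::euclidean_space"
  assumes "AE r in lebesgue. r \<in> S \<longrightarrow> f r = g r"
  shows "integral S f = integral S g" "f absolutely_integrable_on S \<longleftrightarrow> g absolutely_integrable_on S"
proof -
  let ?N = "{r. \<not> (r \<in> S \<longrightarrow> f r = g r)}"
  have "negligible ?N" using assms by (simp add: AE_lebesgue_iff_negligible)
  then show "integral S f = integral S g" "f absolutely_integrable_on S \<longleftrightarrow> g absolutely_integrable_on S"
    by (rule integral_spike, force) (rule absolutely_integrable_spike_eq[OF \<open>negligible ?N\<close>], force)
qed

lemma abs_integral_le_AE:
  fixes f g :: "real \<Rightarrow> real"
  assumes f: "f absolutely_integrable_on S" and g: "g integrable_on S"
    and "AE r in lebesgue. r \<in> S \<longrightarrow> \<bar>f r\<bar> \<le> g r"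
  shows "\<bar>integral S f\<bar> \<le> integral S g"
proof -
  define h where "h r = (if \<bar>f r\<bar> \<le> g r then f r else 0)" for r
  define k where "k r = (if \<bar>f r\<bar> \<le> g r then g r else 0)" for r
  let ?N = "{r. \<not> (r \<in> S \<longrightarrow> \<bar>f r\<bar> \<le> g r)}"
  have N: "negligible ?N" using assms(3) by (simp add: AE_lebesgue_iff_negligible)
  have hi: "h integrable_on S" "integral S f = integral S h"
    using f integrable_spike[OF _ N, of f S h] integral_spike[OF N, of S h f]
    by (auto simp: h_def absolutely_integrable_on_def)
  have ki: "k integrable_on S" "integral S g = integral S k"
    using g integrable_spike[OF _ N, of g S k] integral_spike[OF N, of S k g]
    by (auto simp: k_def)
  have "norm (integral S h) \<le> integral S k"
    by (rule integral_norm_bound_integral) (use hi ki in \<open>auto simp: h_def k_def\<close>)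
  with hi ki show ?thesis by simp
qed

lemma bounded_measurable_absolutely_integrable:
  fixes f :: "real \<Rightarrow> 'b::euclidean_space"
  assumes "f \<in> borel_measurable lebesgue" "\<And>r. r \<in> {a..b} \<Longrightarrow> norm (f r) \<le> C"
  shows "f absolutely_integrable_on {a..b}"
  by (rule measurable_bounded_by_integrable_imp_absolutely_integrable[where g = "\<lambda>_. C"])
     (use assms in \<open>auto intro: measurable_restrict_space1\<close>)

lemma Linf_on_borel_version:
  fixes f :: "'a::euclidean_space \<Rightarrow> real"
  assumes f: "Linf_on S f" and S: "S \<in> sets lebesgue"
  shows "\<exists>g C. g \<in> borel_measurable borel \<and> 0 \<le> C \<and> (\<forall>z. \<bar>g z\<bar> \<le> C) \<and>
    (AE z in lebesgue. z \<in> S \<longrightarrow> f z = g z)"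
proof -
  obtain C where C: "AE x in lebesgue_on S. norm (f x) \<le> C" and m: "f \<in> borel_measurable (lebesgue_on S)"
    using f by (auto simp: Linf_on_def)
  have "(\<lambda>z. if z \<in> S then f z else 0) \<in> borel_measurable lebesgue"
    using m S by (simp add: borel_measurable_if)
  from completion_ex_borel_measurable_real[OF this] obtain g where
    g: "g \<in> borel_measurable lborel" "AE z in lborel. (if z \<in> S then f z else 0) = g z" by auto
  \<comment> \<open>Truncation at the essential bound makes the bound hold at every point and
    changes nothing almost everywhere on \<open>S\<close>.\<close>
  define h where "h z = max (- \<bar>C\<bar>) (min \<bar>C\<bar> (g z))" for z
  show ?thesis
  proof (intro exI conjI allI)
    show "h \<in> borel_measurable borel" using g(1) unfolding h_def by simp
    show "0 \<le> \<bar>C\<bar>" "\<bar>h z\<bar> \<le> \<bar>C\<bar>" for z by (auto simp: h_def)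
    have "AE z in lebesgue. z \<in> S \<longrightarrow> norm (f z) \<le> C"
      using C S by (simp add: AE_restrict_space_iff)
    with AE_completion[OF g(2)] show "AE z in lebesgue. z \<in> S \<longrightarrow> f z = h z"
      by eventually_elim (auto simp: h_def)
  qed
qed

text \<open>A nonempty open set is never null, so a property valid almost everywhere on an open set
  holds on a dense subset of it.\<close>

lemma AE_lebesgue_closure:
  fixes P :: "'a::euclidean_space \<Rightarrow> bool"
  assumes "AE r in lebesgue. r \<in> S \<longrightarrow> P r" "open S" "x \<in> closure S"
  shows "x \<in> closure {r \<in> S. P r}"
proof (rule ccontr)
  assume "x \<notin> closure {r \<in> S. P r}"
  then obtain U where U: "open U" "x \<in> U" "U \<inter> {r \<in> S. P r} = {}"
    by (meson open_Compl closed_closure ComplI ComplD closure_subset disjoint_iff subsetD)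
  have "open (U \<inter> S)" using U assms by auto
  moreover have "U \<inter> S \<noteq> {}"
    using U assms(3) by (metis open_Int_closure_eq_empty disjoint_iff)
  ultimately have "\<not> negligible (U \<inter> S)" by (rule open_not_negligible)
  moreover have "negligible (U \<inter> S)"
    using assms(1) U(3) unfolding AE_lebesgue_iff_negligible by (auto intro: negligible_subset)
  ultimately show False by simp
qed

text \<open>Solutions are continuous along a characteristic, so this recovers an essential bound at
  every point of it, including the end points where traces are taken.\<close>

lemma continuous_bound_AE:
  fixes f :: "real \<Rightarrow> real"
  assumes c: "continuous_on {a..b} f" and "a < b"
    and ae: "AE r in lebesgue. r \<in> {a..b} \<longrightarrow> \<bar>f r\<bar> \<le> C" and x: "x \<in> {a..b}"
  shows "\<bar>f x\<bar> \<le> C"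
proof -
  have cl: "closure {r \<in> {a<..<b}. \<bar>f r\<bar> \<le> C} \<subseteq> {a..b}"
    by (rule closure_minimal) auto
  have "AE r in lebesgue. r \<in> {a<..<b} \<longrightarrow> \<bar>f r\<bar> \<le> C" using ae by eventually_elim auto
  then have xc: "x \<in> closure {r \<in> {a<..<b}. \<bar>f r\<bar> \<le> C}"
    by (rule AE_lebesgue_closure) (use x \<open>a < b\<close> in auto)
  have "norm (f x) \<le> C"
    by (rule continuous_on_closure_norm_le[OF continuous_on_subset[OF c cl] _ xc]) auto
  then show ?thesis by simp
qed

text \<open>The exact value has \<open>exp (k * (m * s)) - 1\<close> as its last factor. The gain
  \<open>1 / (k * m)\<close> makes the weighted estimates contract for large
  \<open>k\<close>.\<close>

lemma exp_integral_bound: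
  fixes B k m s :: real
  assumes "0 \<le> B" "0 < k" "0 < m" "0 \<le> s"
  shows "(\<lambda>r. B * exp (k * (m * r))) integrable_on {0..s}"
    and "integral {0..s} (\<lambda>r. B * exp (k * (m * r))) \<le> B / (k * m) * exp (k * (m * s))"
proof -
  have *: "((\<lambda>r. B * exp (k * (m * r))) has_integral
      (B / (k * m) * exp (k * (m * s)) - B / (k * m) * exp (k * (m * 0)))) {0..s}"
    by (rule fundamental_theorem_of_calculus)
       (use assms in \<open>auto intro!: derivative_eq_intros simp flip: has_real_derivative_iff_has_vector_derivative\<close>)
  show "(\<lambda>r. B * exp (k * (m * r))) integrable_on {0..s}" using * by blast
  show "integral {0..s} (\<lambda>r. B * exp (k * (m * r))) \<le> B / (k * m) * exp (k * (m * s))"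
    using integral_unique[OF *] assms by simp
qed

lemma integral_scale:
  fixes f :: "real \<Rightarrow> 'b::euclidean_space"
  assumes "0 < m"
  shows "integral {0..x / m} (\<lambda>r. f (m * r)) = (1 / m) *\<^sub>R integral {0..x} f"
proof -
  have "(\<lambda>r. r / m) ` {0..x} = {0..x / m}" using assms
    by (cases "0 \<le> x") (auto simp: image_divide_atLeastAtMost divide_less_0_iff not_le)
  then show ?thesis using integral_stretch_real[of m 0 x f] assms by simp
qed

lemma integral_shift_from_0:
  fixes f :: "real \<Rightarrow> 'b::euclidean_space"
  shows "integral {0..x} (\<lambda>r. f (t + r)) = integral {t..t + x} f"
  using integral_shift_real_ivl[of t t "t + x" f] by (simp add: add.commute)

lemma absolutely_integrable_shift_from_0:
  fixes f :: "real \<Rightarrow> real"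
  assumes "f absolutely_integrable_on {t..t + x}"
  shows "(\<lambda>r. f (t + r)) absolutely_integrable_on {0..x}"
  using assms integrable_shift_real_ivl[of f t "t + x" t]
    integrable_shift_real_ivl[of "\<lambda>r. norm (f r)" t "t + x" t]
  by (simp add: absolutely_integrable_on_def add.commute)


section \<open>Existence of a continuous kernel\<close>

lemma norm_matrix_vector_le:
  fixes A :: "real^'n^'m"
  shows "norm (A *v v) \<le> (\<Sum>i\<in>UNIV. \<Sum>j\<in>UNIV. \<bar>A $ i $ j\<bar>) * norm v"
proof -
  have "norm (A *v v) \<le> (\<Sum>i\<in>UNIV. \<bar>(A *v v) $ i\<bar>)" by (rule norm_le_l1_cart)
  also have "\<dots> \<le> (\<Sum>i\<in>UNIV. \<Sum>j\<in>UNIV. \<bar>A $ i $ j\<bar> * norm v)"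
    by (intro sum_mono)
       (auto simp: matrix_vector_mult_def abs_mult intro!: order_trans[OF sum_abs] sum_mono mult_left_mono component_le_norm_cart)
  finally show ?thesis by (simp add: sum_distrib_right)
qed

lemma continuous_on_matrix_vector:
  fixes A :: "'a::topological_space \<Rightarrow> real^'n^'m"
  assumes "continuous_on X A" "continuous_on X f"
  shows "continuous_on X (\<lambda>x. A x *v f x)"
  unfolding matrix_vector_mult_def
  by (intro continuous_intros continuous_on_component assms)

text \<open>\<open>c\<close> stands for \<open>Lamm p\<close>, \<open>a\<close> for the diagonal of
  \<open>Lamp p\<close>, and \<open>S\<close>, \<open>sp\<close>, \<open>sm\<close>,
  \<open>R\<close> for \<open>Sigpp\<close>, \<open>Sigpm\<close>, \<open>Sigmp\<close>,
  \<open>R1\<close>. Continuity is asked on the whole line because the kernel is constructed on a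
  square larger than the triangle, where the feet of characteristics may lie at negative
  abscissae.\<close>

locale kernel_data =
  fixes L c :: real and a :: "'n::finite \<Rightarrow> real" and S :: "real \<Rightarrow> real^'n^'n"
    and sp sm :: "real \<Rightarrow> real^'n" and R :: "real^'n"
  assumes L_pos: "0 < L" and c_pos: "0 < c" and a_pos: "0 < a i"
    and S_cont: "continuous_on UNIV S" and sp_cont: "continuous_on UNIV sp"
    and sm_cont: "continuous_on UNIV sm"
begin

lemma ac_pos: "0 < a i + c" using a_pos[of i] c_pos by simp

text \<open>The range extends to \<open>-L\<close> because for \<open>x\<close> and \<open>d\<close>
  in \<open>[0, L]\<close> the foot \<open>x - a i / (a i + c) * d\<close> can be negative, but not
  below \<open>-L\<close>.\<close>

lemma coeff_bound:
  obtains K where "0 \<le> K" "\<And>x v. x \<in> {-L..L} \<Longrightarrow> norm (S x *v v) \<le> K * norm v"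
    "\<And>x. x \<in> {-L..L} \<Longrightarrow> norm (sp x) \<le> K" "\<And>x. x \<in> {-L..L} \<Longrightarrow> norm (sm x) \<le> K"
proof -
  define g where "g x = (\<Sum>i\<in>UNIV. \<Sum>j\<in>UNIV. \<bar>S x $ i $ j\<bar>) + norm (sp x) + norm (sm x)" for x
  have "continuous_on {-L..L} g"
    unfolding g_def
    by (intro continuous_intros continuous_on_component)
       (rule continuous_on_subset[OF S_cont] continuous_on_subset[OF sp_cont] continuous_on_subset[OF sm_cont]; simp)+
  then have "bounded (g ` {-L..L})"
    by (intro compact_imp_bounded compact_continuous_image) auto
  then obtain K where K: "\<And>x. x \<in> {-L..L} \<Longrightarrow> \<bar>g x\<bar> \<le> K"
    by (metis bounded_iff imageI real_norm_def)
  have ge: "(\<Sum>i\<in>UNIV. \<Sum>j\<in>UNIV. \<bar>S x $ i $ j\<bar>) \<le> K" "norm (sp x) \<le> K" "norm (sm x) \<le> K"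
    if "x \<in> {-L..L}" for x
  proof -
    have "0 \<le> (\<Sum>i\<in>UNIV. \<Sum>j\<in>UNIV. \<bar>S x $ i $ j\<bar>)" by (intro sum_nonneg) auto
    then show "(\<Sum>i\<in>UNIV. \<Sum>j\<in>UNIV. \<bar>S x $ i $ j\<bar>) \<le> K" "norm (sp x) \<le> K" "norm (sm x) \<le> K"
      using K[OF that] norm_ge_zero[of "sp x"] norm_ge_zero[of "sm x"] unfolding g_def abs_le_iff by linarith+
  qed
  show ?thesis
  proof
    have "norm (sp 0) \<le> K" using ge(2)[of 0] L_pos by simp
    then show "0 \<le> K" using norm_ge_zero[of "sp 0"] by linarith
    show "norm (S x *v v) \<le> K * norm v" if "x \<in> {-L..L}" for x v
      by (rule order_trans[OF norm_matrix_vector_le mult_right_mono[OF ge(1)[OF that]]]) simp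
  qed (use ge in auto)
qed

text \<open>Kernels are written in the coordinates \<open>(x, d)\<close> with \<open>d = x - \<xi>\<close>.  The source of the kernel
  equations at distance \<open>d\<close> from the diagonal involves the kernel only at the same \<open>d\<close>, so they are
  of Volterra type in \<open>d\<close>.\<close>

definition Nk :: "(real \<times> real \<Rightarrow> real^'n) \<Rightarrow> real \<Rightarrow> real \<Rightarrow> real" where
  "Nk F x d = R \<bullet> F (L, d) +
     (L - x) / c * integral {0..1} (\<lambda>s. sm (x + s * (L - x)) \<bullet> F (x + s * (L - x), d))"

definition src :: "(real \<times> real \<Rightarrow> real^'n) \<Rightarrow> real \<Rightarrow> real \<Rightarrow> real^'n" where
  "src F x d = S x *v F (x, d) + Nk F x d *\<^sub>R sp x"

lemma continuous_on_compose_UNIV: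
  assumes "continuous_on UNIV f" "continuous_on X g"
  shows "continuous_on X (\<lambda>x. f (g x))"
  using continuous_on_compose2[OF assms] by simp

lemmas coeff_cont = continuous_on_compose_UNIV[OF S_cont] continuous_on_compose_UNIV[OF sp_cont]
  continuous_on_compose_UNIV[OF sm_cont]

lemma Nk_integrand_continuous:
  assumes "continuous_on UNIV F"
  shows "continuous_on X (\<lambda>s. sm (x + s * (L - x)) \<bullet> F (x + s * (L - x), d))"
  by (intro continuous_intros coeff_cont continuous_on_compose_UNIV[OF assms])

text \<open>The integral in \<open>Nk\<close> is rescaled to \<open>[0, 1]\<close>, so the
  dependence on \<open>x\<close> sits in the integrand and the theorem on continuous parameter
  integrals applies.\<close>

lemma Nk_continuous:
  assumes F: "continuous_on UNIV F" and "continuous_on X f" "continuous_on X g"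
  shows "continuous_on X (\<lambda>z. Nk F (f z) (g z))"
proof -
  have "continuous_on (X \<times> cbox 0 1) (\<lambda>(z, s). sm (f z + s * (L - f z)) \<bullet> F (f z + s * (L - f z), g z))"
    unfolding split_beta
    by (intro continuous_intros coeff_cont continuous_on_compose_UNIV[OF F]
        continuous_on_compose2[OF assms(2) continuous_on_fst] continuous_on_compose2[OF assms(3) continuous_on_fst]) auto
  from integral_continuous_on_param[OF this] show ?thesis
    unfolding Nk_def using c_pos
    by (intro continuous_intros continuous_on_compose_UNIV[OF F] assms) auto
qed

lemma src_continuous:
  assumes F: "continuous_on UNIV F" and "continuous_on X f" "continuous_on X g"
  shows "continuous_on X (\<lambda>z. src F (f z) (g z))"
  unfolding src_def
  by (intro continuous_intros Nk_continuous continuous_on_matrix_vector coeff_cont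
      continuous_on_compose_UNIV[OF F] assms)

text \<open>\<open>F\<close> is read only at the one distance \<open>d\<close>, so a factor
  depending on \<open>d\<close> alone passes through. This allows the exponential weight to be
  attached and removed.\<close>

lemma Nk_scale:
  assumes "\<And>y. F (y, d) = e *\<^sub>R G (y, d)"
  shows "Nk F x d = e * Nk G x d"
  by (simp add: Nk_def assms algebra_simps)

lemma src_scale:
  assumes "\<And>y. F (y, d) = e *\<^sub>R G (y, d)"
  shows "src F x d = e *\<^sub>R src G x d"
  by (simp add: src_def Nk_scale[of F d e G] assms scaleR_matrix_vector_assoc[symmetric]
      matrix_vector_mult_scaleR algebra_simps)

text \<open>Only values at the distance \<open>d\<close> enter and the constant does not depend on
  \<open>d\<close>, which is the Volterra property behind the contraction.\<close>

lemma src_lipschitz: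
  obtains B where "0 \<le> B" "\<And>F G x d e. continuous_on UNIV F \<Longrightarrow> continuous_on UNIV G \<Longrightarrow>
     x \<in> {-L..L} \<Longrightarrow> (\<And>y. norm (F (y, d) - G (y, d)) \<le> e) \<Longrightarrow>
     norm (src F x d - src G x d) \<le> B * e"
proof -
  obtain K where K: "0 \<le> K" "\<And>x v. x \<in> {-L..L} \<Longrightarrow> norm (S x *v v) \<le> K * norm v"
    "\<And>x. x \<in> {-L..L} \<Longrightarrow> norm (sp x) \<le> K" "\<And>x. x \<in> {-L..L} \<Longrightarrow> norm (sm x) \<le> K"
    using coeff_bound by blast
  \<comment> \<open>The first summand comes from \<open>S\<close>, the second from \<open>Nk\<close>
    times \<open>sp\<close>: \<open>norm R\<close> for the reflection, and
    \<open>2 * L / c * K\<close> for the nonlocal term, since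
    \<open>L - x \<le> 2 * L\<close>.\<close>
  define B where "B = K + (norm R + 2 * L / c * K) * K"
  show ?thesis
  proof (rule that[of B])
    show "0 \<le> B" using K(1) L_pos c_pos by (auto simp: B_def)
    fix F G :: "real \<times> real \<Rightarrow> real^'n" and x d e :: real
    assume F: "continuous_on UNIV F" and G: "continuous_on UNIV G" and x: "x \<in> {-L..L}"
      and e: "\<And>y. norm (F (y, d) - G (y, d)) \<le> e"
    have e0: "0 \<le> e" using order_trans[OF norm_ge_zero e] .
    let ?I = "\<lambda>F. integral {0..1} (\<lambda>s. sm (x + s * (L - x)) \<bullet> F (x + s * (L - x), d))"
    have int: "(\<lambda>s. sm (x + s * (L - x)) \<bullet> F (x + s * (L - x), d)) integrable_on {0..1}"
      if "continuous_on UNIV F" for F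
      by (intro integrable_continuous_real Nk_integrand_continuous that)
    have "?I F - ?I G = integral {0..1} (\<lambda>s. sm (x + s * (L - x)) \<bullet> (F (x + s * (L - x), d) - G (x + s * (L - x), d)))"
      by (subst integral_diff[symmetric]) (use int F G in \<open>auto simp: inner_diff_right\<close>)
    also have "norm \<dots> \<le> integral {0..1} (\<lambda>s::real. K * e)"
    proof (rule integral_norm_bound_integral)
      show "(\<lambda>s. sm (x + s * (L - x)) \<bullet> (F (x + s * (L - x), d) - G (x + s * (L - x), d))) integrable_on {0..1}"
        using integrable_diff[OF int[OF F] int[OF G]] by (simp add: inner_diff_right)
      fix s :: real assume s: "s \<in> {0..1}"
      have "(1 - s) * x \<ge> (1 - s) * (- L)" "(1 - s) * x \<le> (1 - s) * L"
        using s x by (intro mult_left_mono; auto)+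
      moreover have "s * L \<ge> s * (-L)" using s L_pos by (intro mult_left_mono) auto
      ultimately have "x + s * (L - x) \<in> {-L..L}" by (auto simp: algebra_simps)
      then have "norm (sm (x + s * (L - x))) * norm (F (x + s * (L - x), d) - G (x + s * (L - x), d)) \<le> K * e"
        by (intro mult_mono K e) (use K(1) in auto)
      with Cauchy_Schwarz_ineq2[of "sm (x + s * (L - x))" "F (x + s * (L - x), d) - G (x + s * (L - x), d)"]
      show "norm (sm (x + s * (L - x)) \<bullet> (F (x + s * (L - x), d) - G (x + s * (L - x), d))) \<le> K * e"
        by simp
    qed auto
    finally have I: "\<bar>?I F - ?I G\<bar> \<le> K * e" by simp
    have "Nk F x d - Nk G x d = R \<bullet> (F (L, d) - G (L, d)) + (L - x) / c * (?I F - ?I G)"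
      by (simp add: Nk_def algebra_simps)
    moreover have "\<bar>R \<bullet> (F (L, d) - G (L, d))\<bar> \<le> norm R * e"
      using Cauchy_Schwarz_ineq2[of R "F (L, d) - G (L, d)"] mult_left_mono[OF e[of L] norm_ge_zero[of R]]
      by linarith
    moreover have "\<bar>(L - x) / c * (?I F - ?I G)\<bar> \<le> 2 * L / c * (K * e)"
      unfolding abs_mult by (intro mult_mono I) (use x c_pos L_pos in \<open>auto simp: divide_simps\<close>)
    ultimately have "\<bar>Nk F x d - Nk G x d\<bar> \<le> norm R * e + 2 * L / c * (K * e)"
      by (simp only: order_trans[OF abs_triangle_ineq add_mono])
    then have N: "\<bar>Nk F x d - Nk G x d\<bar> \<le> (norm R + 2 * L / c * K) * e"
      by (simp add: algebra_simps)
    have "src F x d - src G x d = S x *v (F (x, d) - G (x, d)) + (Nk F x d - Nk G x d) *\<^sub>R sp x"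
      by (simp add: src_def algebra_simps matrix_vector_mult_diff_distrib)
    also have "norm \<dots> \<le> K * e + ((norm R + 2 * L / c * K) * e) * K"
    proof (rule norm_triangle_mono)
      show "norm (S x *v (F (x, d) - G (x, d))) \<le> K * e"
        by (rule order_trans[OF K(2)[OF x] mult_left_mono[OF e K(1)]])
      show "norm ((Nk F x d - Nk G x d) *\<^sub>R sp x) \<le> (norm R + 2 * L / c * K) * e * K"
        unfolding norm_scaleR using N K(3)[OF x] K(1) e0 L_pos c_pos by (intro mult_mono) auto
    qed
    finally show "norm (src F x d - src G x d) \<le> B * e" by (simp add: B_def algebra_simps)
  qed
qed


text \<open>Mild form of the kernel equations: integration starts at the diagonal point of abscissa
  \<open>x - a i / (a i + c) * d\<close>, where the diagonal condition prescribes
  \<open>sp / (a i + c)\<close>, and lasts the time \<open>d / (a i + c)\<close>, rescaled to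
  \<open>[0, 1]\<close>. It is imposed on a square instead of \<open>d \<le> x\<close>, so that the
  fixed point argument runs on a product domain.\<close>

definition kernel_fixed :: "(real \<times> real \<Rightarrow> real^'n) \<Rightarrow> bool" where
  "kernel_fixed F \<longleftrightarrow> continuous_on UNIV F \<and>
     (\<forall>x\<in>{0..L}. \<forall>d\<in>{0..L}. \<forall>i. F (x, d) $ i = sp (x - a i / (a i + c) * d) $ i / (a i + c) +
        d / (a i + c) * integral {0..1} (\<lambda>s. src F (x - a i / (a i + c) * (d * (1 - s))) (d * s) $ i))"

text \<open>The right-hand side of \<open>kernel_fixed\<close> conjugated with the weight: if
  \<open>F (x, d) = exp (k * d) *\<^sub>R G (x, d)\<close>, the source at distance
  \<open>d * s\<close> carries \<open>exp (k * (d * s))\<close>, and division by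
  \<open>exp (k * d)\<close> leaves \<open>exp (- (k * (d * (1 - s))))\<close>.\<close>

definition opT :: "real \<Rightarrow> (real \<times> real \<Rightarrow> real^'n) \<Rightarrow> real \<Rightarrow> real \<Rightarrow> real^'n" where
  "opT k G x d = (\<chi> i. exp (- (k * d)) * (sp (x - a i / (a i + c) * d) $ i / (a i + c)) +
     d / (a i + c) * integral {0..1} (\<lambda>s. exp (- (k * (d * (1 - s)))) *
        src G (x - a i / (a i + c) * (d * (1 - s))) (d * s) $ i))"

lemma opT_integrand_continuous:
  assumes G: "continuous_on UNIV G" and "continuous_on X x" "continuous_on X d" "continuous_on X s"
  shows "continuous_on X (\<lambda>z. exp (- (k * (d z * (1 - s z)))) *
        src G (x z - a i / (a i + c) * (d z * (1 - s z))) (d z * s z) $ i)"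
  by (intro continuous_intros continuous_on_component src_continuous assms)

lemma opT_continuous:
  assumes G: "continuous_on UNIV G" and x: "continuous_on X x" and d: "continuous_on X d"
  shows "continuous_on X (\<lambda>z. opT k G (x z) (d z))"
proof -
  have "continuous_on X (\<lambda>z. integral {0..1} (\<lambda>s. exp (- (k * (d z * (1 - s)))) *
        src G (x z - a i / (a i + c) * (d z * (1 - s))) (d z * s) $ i))" for i
  proof -
    have "continuous_on (X \<times> cbox 0 1) (\<lambda>(z, s). exp (- (k * (d z * (1 - s)))) *
        src G (x z - a i / (a i + c) * (d z * (1 - s))) (d z * s) $ i)"
      unfolding split_beta
      by (intro opT_integrand_continuous[OF G] continuous_intros
          continuous_on_compose2[OF x continuous_on_fst] continuous_on_compose2[OF d continuous_on_fst]) auto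
    from integral_continuous_on_param[OF this] show ?thesis by simp
  qed
  then show ?thesis
    unfolding opT_def using ac_pos
    by (intro continuous_intros continuous_on_component coeff_cont x d) (auto simp: less_imp_neq[symmetric])
qed

text \<open>The integral times \<open>d\<close> equals \<open>(1 - exp (- (k * d))) / k\<close>; the
  bound \<open>1 / k\<close>, uniform in \<open>d\<close>, is the source of the contraction.\<close>

lemma exp_weight_integral:
  fixes k d :: real
  assumes "0 < k" "0 \<le> d"
  shows "d * integral {0..1} (\<lambda>s. exp (- (k * (d * (1 - s))))) \<le> 1 / k"
    "(\<lambda>s. exp (- (k * (d * (1 - s))))) integrable_on {0..1}"
proof -
  show int: "(\<lambda>s. exp (- (k * (d * (1 - s))))) integrable_on {0..1}"
    by (intro integrable_continuous_real continuous_intros)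
  have "((\<lambda>s. (k * d) * exp (- (k * (d * (1 - s))))) has_integral
      (exp (- (k * (d * (1 - 1)))) - exp (- (k * (d * (1 - 0)))))) {0..1}"
    by (rule fundamental_theorem_of_calculus)
       (auto intro!: derivative_eq_intros simp flip: has_real_derivative_iff_has_vector_derivative)
  from integral_unique[OF this] have "k * d * integral {0..1} (\<lambda>s. exp (- (k * (d * (1 - s))))) \<le> 1"
    by simp
  with assms show "d * integral {0..1} (\<lambda>s. exp (- (k * (d * (1 - s))))) \<le> 1 / k"
    by (simp add: pos_le_divide_eq mult_ac)
qed

text \<open>Banach's fixed point theorem for the weighted operator on the bounded continuous
  functions of the plane.\<close>

lemma kernel_fixed_exists: "\<exists>F. kernel_fixed F"
proof -
  obtain B where B: "0 \<le> B" "\<And>F G x d e. continuous_on UNIV F \<Longrightarrow> continuous_on UNIV G \<Longrightarrow>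
     x \<in> {-L..L} \<Longrightarrow> (\<And>y. norm (F (y, d) - G (y, d)) \<le> e) \<Longrightarrow>
     norm (src F x d - src G x d) \<le> B * e"
    using src_lipschitz by blast
  define n where "n = real CARD('n)"
  have n: "0 < n" by (simp add: n_def)
  \<comment> \<open>One component of a difference of images is at most \<open>B / (c * k)\<close>
    times the distance, and the sum over \<open>n\<close> components has to stay below
    \<open>1 / 2\<close>. Writing \<open>B + 1\<close> keeps \<open>k\<close> positive when
    \<open>B = 0\<close>.\<close>
  define k where "k = 2 * n * (B + 1) / c"
  have k: "0 < k" using B n c_pos by (simp add: k_def)
  \<comment> \<open>Clamping both coordinates to \<open>[0, L]\<close> makes the image bounded on
    the whole plane and leaves the fixed point equation on the square unchanged.\<close>
  define cl where "cl x = max 0 (min L x)" for x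
  have cl: "cl x \<in> {0..L}" for x using L_pos by (auto simp: cl_def)
  have cl_id: "cl x = x" if "x \<in> {0..L}" for x using that by (auto simp: cl_def)
  have cl_cont: "continuous_on X cl" for X unfolding cl_def by (intro continuous_intros)
  define T where "T G = Bcontfun (\<lambda>z. opT k (apply_bcontfun G) (cl (fst z)) (cl (snd z)))" for G
  have T: "apply_bcontfun (T G) z = opT k (apply_bcontfun G) (cl (fst z)) (cl (snd z))" for G z
  proof -
    let ?g = "\<lambda>z. opT k (apply_bcontfun G) (fst z) (snd z)"
    have "continuous_on UNIV (\<lambda>z. opT k (apply_bcontfun G) (cl (fst z)) (cl (snd z)))"
      by (intro opT_continuous continuous_on_apply_bcontfun continuous_on_compose2[OF cl_cont[of UNIV]]
          continuous_intros) auto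
    moreover have bd: "bounded (?g ` ({0..L} \<times> {0..L}))"
      by (intro compact_imp_bounded compact_continuous_image compact_Times opT_continuous
          continuous_on_apply_bcontfun continuous_intros) auto
    have "bounded (range (\<lambda>z. opT k (apply_bcontfun G) (cl (fst z)) (cl (snd z))))"
    proof (rule bounded_subset[OF bd], rule image_subsetI)
      fix z
      show "opT k (apply_bcontfun G) (cl (fst z)) (cl (snd z)) \<in> ?g ` ({0..L} \<times> {0..L})"
        using cl by (intro image_eqI[where x = "(cl (fst z), cl (snd z))"]) auto
    qed
    ultimately show ?thesis unfolding T_def by (simp add: bcontfun_def Bcontfun_inverse)
  qed
  have "dist (T G) (T H) \<le> 1 / 2 * dist G H" for G H
  proof (rule dist_bound)
    fix z :: "real \<times> real"
    define x where "x = cl (fst z)"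
    define d where "d = cl (snd z)"
    have x: "x \<in> {0..L}" and d: "d \<in> {0..L}" using cl by (auto simp: x_def d_def)
    have comp: "\<bar>(opT k G x d - opT k H x d) $ i\<bar> \<le> 1 / (2 * n) * dist G H" for i
    proof -
      let ?p = "\<lambda>s. x - a i / (a i + c) * (d * (1 - s))"
      let ?h = "\<lambda>G s. exp (- (k * (d * (1 - s)))) * src G (?p s) (d * s) $ i"
      have int: "?h (apply_bcontfun G) integrable_on {0..1}" for G
        by (intro integrable_continuous_real opT_integrand_continuous continuous_intros continuous_on_apply_bcontfun)
      have "\<bar>integral {0..1} (?h G) - integral {0..1} (?h H)\<bar> = norm (integral {0..1} (\<lambda>s. ?h G s - ?h H s))"
        by (subst integral_diff[OF int int]) simp
      also have "\<dots> \<le> integral {0..1} (\<lambda>s. (B * dist G H) * exp (- (k * (d * (1 - s)))))"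
      proof (rule integral_norm_bound_integral)
        show "(\<lambda>s. ?h G s - ?h H s) integrable_on {0..1}" by (intro integrable_diff int)
        show "(\<lambda>s. (B * dist G H) * exp (- (k * (d * (1 - s))))) integrable_on {0..1}"
          by (intro integrable_continuous_real continuous_intros)
        fix s :: real assume s: "s \<in> {0..1}"
        have "0 \<le> a i / (a i + c) * (d * (1 - s))" using s d a_pos[of i] c_pos by (auto intro!: mult_nonneg_nonneg)
        moreover have "a i / (a i + c) * (d * (1 - s)) \<le> 1 * (L * 1)"
          using s d a_pos[of i] c_pos by (intro mult_mono) auto
        ultimately have "?p s \<in> {-L..L}" using x by auto
        then have "norm (src G (?p s) (d * s) - src H (?p s) (d * s)) \<le> B * dist G H"
          by (intro B(2)) (auto simp flip: dist_norm intro: dist_bounded)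
        then have "\<bar>src G (?p s) (d * s) $ i - src H (?p s) (d * s) $ i\<bar> \<le> B * dist G H"
          using component_le_norm_cart[of "src G (?p s) (d * s) - src H (?p s) (d * s)" i] by simp
        then show "norm (?h G s - ?h H s) \<le> (B * dist G H) * exp (- (k * (d * (1 - s))))"
          by (simp add: abs_mult flip: right_diff_distrib)
      qed
      also have "\<dots> = B * dist G H * integral {0..1} (\<lambda>s. exp (- (k * (d * (1 - s)))))" by simp
      finally have "\<bar>d * (integral {0..1} (?h G) - integral {0..1} (?h H))\<bar>
          \<le> d * (B * dist G H * integral {0..1} (\<lambda>s. exp (- (k * (d * (1 - s))))))"
        using d by (auto simp: abs_mult intro: mult_left_mono)
      also have "\<dots> = B * dist G H * (d * integral {0..1} (\<lambda>s. exp (- (k * (d * (1 - s))))))" by simp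
      also have "\<dots> \<le> B * dist G H * (1 / k)"
        using exp_weight_integral(1)[OF k, of d] d B(1) by (intro mult_left_mono) auto
      finally have *: "\<bar>d * (integral {0..1} (?h G) - integral {0..1} (?h H))\<bar> \<le> B * dist G H * (1 / k)" .
      have "(opT k G x d - opT k H x d) $ i = 1 / (a i + c) * (d * (integral {0..1} (?h G) - integral {0..1} (?h H)))"
        by (simp add: opT_def algebra_simps diff_divide_distrib)
      also have "\<bar>\<dots>\<bar> \<le> 1 / c * (B * dist G H * (1 / k))"
        unfolding abs_mult[of "1 / (a i + c)"]
        by (rule mult_mono[OF _ *]) (use a_pos[of i] c_pos in \<open>auto simp: frac_le\<close>)
      also have "\<dots> = (B / (B + 1)) * (1 / (2 * n) * dist G H)"
        using c_pos n B(1) by (simp add: k_def field_simps)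
      also have "\<dots> \<le> 1 * (1 / (2 * n) * dist G H)"
        using B(1) n by (intro mult_right_mono) auto
      finally show ?thesis by simp
    qed
    have "dist (apply_bcontfun (T G) z) (apply_bcontfun (T H) z) = norm (opT k G x d - opT k H x d)"
      by (simp add: T dist_norm x_def d_def)
    also have "\<dots> \<le> (\<Sum>i\<in>UNIV. \<bar>(opT k G x d - opT k H x d) $ i\<bar>)" by (rule norm_le_l1_cart)
    also have "\<dots> \<le> (\<Sum>i\<in>(UNIV::'n set). 1 / (2 * n) * dist G H)" by (intro sum_mono comp)
    also have "\<dots> = 1 / 2 * dist G H" using n by (simp add: n_def)
    finally show "dist (apply_bcontfun (T G) z) (apply_bcontfun (T H) z) \<le> 1 / 2 * dist G H" .
  qed
  then have "\<exists>!G. T G = G" by (intro banach_fix_type[of "1 / 2"]) auto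
  then obtain G where G: "T G = G" by blast
  \<comment> \<open>The weight is removed again; by \<open>src_scale\<close> it passes through the
    source.\<close>
  define F where "F z = exp (k * snd z) *\<^sub>R apply_bcontfun G z" for z
  have Fc: "continuous_on UNIV F"
    unfolding F_def by (intro continuous_intros continuous_on_apply_bcontfun)
  have srcF: "src F x d = exp (k * d) *\<^sub>R src G x d" for x d
    by (rule src_scale) (simp add: F_def)
  have "F (x, d) $ i = sp (x - a i / (a i + c) * d) $ i / (a i + c) +
        d / (a i + c) * integral {0..1} (\<lambda>s. src F (x - a i / (a i + c) * (d * (1 - s))) (d * s) $ i)"
    if x: "x \<in> {0..L}" and d: "d \<in> {0..L}" for x d i
  proof -
    have "apply_bcontfun G (x, d) = opT k G x d"
      using T[of G "(x, d)"] cl_id[OF x] cl_id[OF d] by (simp add: G)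
    then have "F (x, d) $ i = sp (x - a i / (a i + c) * d) $ i / (a i + c) +
        d / (a i + c) * (exp (k * d) * integral {0..1} (\<lambda>s. exp (- (k * (d * (1 - s)))) *
        src G (x - a i / (a i + c) * (d * (1 - s))) (d * s) $ i))"
      by (simp add: F_def opT_def distrib_left mult_exp_exp flip: mult.assoc)
    also have "exp (k * d) * integral {0..1} (\<lambda>s. exp (- (k * (d * (1 - s)))) *
        src G (x - a i / (a i + c) * (d * (1 - s))) (d * s) $ i) =
      integral {0..1} (\<lambda>s. src F (x - a i / (a i + c) * (d * (1 - s))) (d * s) $ i)"
    proof (subst integral_mult_right[symmetric], rule integral_cong)
      fix s
      have "exp (k * d) * exp (- (k * (d * (1 - s)))) = exp (k * (d * s))"
        unfolding mult_exp_exp by (simp add: algebra_simps)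
      then show "exp (k * d) * (exp (- (k * (d * (1 - s)))) *
          src G (x - a i / (a i + c) * (d * (1 - s))) (d * s) $ i) =
          src F (x - a i / (a i + c) * (d * (1 - s))) (d * s) $ i"
        by (simp add: srcF flip: mult.assoc)
    qed
    finally show ?thesis .
  qed
  with Fc show ?thesis unfolding kernel_fixed_def by blast
qed

end


section \<open>The kernel equations along characteristics\<close>

lemma Linf_on_component:
  fixes f :: "'a::euclidean_space \<Rightarrow> real^'n"
  assumes "Linf_on X f"
  shows "Linf_on X (\<lambda>z. f z $ i)"
proof -
  obtain C where C: "AE x in lebesgue_on X. norm (f x) \<le> C" and m: "f \<in> borel_measurable (lebesgue_on X)"
    using assms unfolding Linf_on_def by blast
  have "(\<lambda>z. f z \<bullet> axis i 1) \<in> borel_measurable (lebesgue_on X)"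
    by (intro borel_measurable_inner m borel_measurable_const)
  moreover have "AE x in lebesgue_on X. norm (f x $ i) \<le> C"
    using C
  proof eventually_elim
    case (elim x)
    then show ?case using component_le_norm_cart[of "f x" i] by simp
  qed
  ultimately show ?thesis unfolding Linf_on_def cart_eq_inner_axis[symmetric] by blast
qed

definition borel_version :: "'a::euclidean_space set \<Rightarrow> ('a \<Rightarrow> real^'n) \<Rightarrow> ('a \<Rightarrow> real^'n) \<Rightarrow> real \<Rightarrow> bool" where
  "borel_version X f g C \<longleftrightarrow> (\<forall>i. (\<lambda>z. g z $ i) \<in> borel_measurable borel) \<and> 0 \<le> C \<and>
     (\<forall>z i. \<bar>g z $ i\<bar> \<le> C) \<and> (AE z in lebesgue. z \<in> X \<longrightarrow> f z = g z)"

lemma borel_versionD: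
  assumes "borel_version X f g C"
  shows "(\<lambda>z. g z $ i) \<in> borel_measurable borel" "0 \<le> C" "\<bar>g z $ i\<bar> \<le> C"
    "AE z in lebesgue. z \<in> X \<longrightarrow> f z = g z"
  using assms by (simp_all add: borel_version_def)

lemma borel_version_exists:
  fixes f :: "'a::euclidean_space \<Rightarrow> real^'n"
  assumes "Linf_on X f" "X \<in> sets lebesgue"
  shows "\<exists>g C. borel_version X f g C"
proof -
  have "\<exists>p. fst p \<in> borel_measurable borel \<and> 0 \<le> snd p \<and> (\<forall>z. \<bar>fst p z\<bar> \<le> snd p) \<and>
      (AE z in lebesgue. z \<in> X \<longrightarrow> f z $ i = fst p z)" for i
  proof -
    obtain g C where "g \<in> borel_measurable borel \<and> 0 \<le> C \<and> (\<forall>z. \<bar>g z\<bar> \<le> C) \<and>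
      (AE z in lebesgue. z \<in> X \<longrightarrow> f z $ i = g z)"
      using Linf_on_borel_version[OF Linf_on_component[OF assms(1), of i] assms(2)] by blast
    then show ?thesis by (intro exI[of _ "(g, C)"]) simp
  qed
  then obtain p where p: "\<And>i. fst (p i) \<in> borel_measurable borel \<and> 0 \<le> snd (p i) \<and>
      (\<forall>z. \<bar>fst (p i) z\<bar> \<le> snd (p i)) \<and> (AE z in lebesgue. z \<in> X \<longrightarrow> f z $ i = fst (p i) z)"
    by (atomize_elim) (intro choice allI)
  define g where "g i = fst (p i)" for i
  define C where "C i = snd (p i)" for i
  have g: "\<And>i. g i \<in> borel_measurable borel" "\<And>i. 0 \<le> C i" "\<And>i z. \<bar>g i z\<bar> \<le> C i"
      and ae: "\<And>i. AE z in lebesgue. z \<in> X \<longrightarrow> f z $ i = g i z"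
    using p by (auto simp: g_def C_def)
  have "borel_version X f (\<lambda>z. \<chi> i. g i z) (\<Sum>i\<in>UNIV. C i)"
    unfolding borel_version_def
  proof (intro conjI allI)
    show "0 \<le> (\<Sum>i\<in>UNIV. C i)" using g(2) by (auto intro: sum_nonneg)
    show "\<bar>(\<chi> i. g i z) $ i\<bar> \<le> (\<Sum>i\<in>UNIV. C i)" for z i
      using g(3)[of i z] member_le_sum[of i UNIV C] g(2) by (auto intro: order_trans)
    have "AE z in lebesgue. \<forall>i. z \<in> X \<longrightarrow> f z $ i = g i z"
      using ae unfolding AE_all_countable by blast
    then show "AE z in lebesgue. z \<in> X \<longrightarrow> f z = (\<chi> i. g i z)"
      by eventually_elim (auto simp: vec_eq_iff)
  qed (use g in auto)
  then show ?thesis by blast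
qed

context kernel_data
begin

definition Tr :: "(real \<times> real) set" where
  "Tr = {(x, \<xi>). 0 \<le> \<xi> \<and> \<xi> \<le> x \<and> x \<le> L}"

text \<open>\<open>N11\<close> in terms of \<open>c\<close>, that is \<open>- (lam p $ 4)\<close>.
  In the same way \<open>ks\<close> and \<open>ksol\<close> correspond to
  \<open>kernel_source\<close> and \<open>kernel_solution\<close>.\<close>

definition NM :: "(real \<Rightarrow> real \<Rightarrow> real^'n) \<Rightarrow> real \<Rightarrow> real \<Rightarrow> real" where
  "NM M x \<xi> = R \<bullet> M L (L - (x - \<xi>)) +
     integral {0..(L - x) / c} (\<lambda>\<nu>. sm (x + c * \<nu>) \<bullet> M (x + c * \<nu>) (\<xi> + c * \<nu>))"

definition ks :: "(real \<Rightarrow> real \<Rightarrow> real^'n) \<Rightarrow> real \<Rightarrow> real \<Rightarrow> real^'n" where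
  "ks M x \<xi> = S x *v M x \<xi> + NM M x \<xi> *\<^sub>R sp x"

definition ksol :: "(real \<Rightarrow> real \<Rightarrow> real^'n) \<Rightarrow> bool" where
  "ksol M \<longleftrightarrow> Linf_on Tr (\<lambda>(x, \<xi>). M x \<xi>) \<and>
     (\<forall>i. AE \<eta> in lebesgue. \<eta> \<in> {0..L} \<longrightarrow> (\<forall>s\<ge>0. (\<eta> + a i * s, \<eta> - c * s) \<in> Tr \<longrightarrow>
        (\<lambda>r. ks M (\<eta> + a i * r) (\<eta> - c * r) $ i) absolutely_integrable_on {0..s} \<and>
        M (\<eta> + a i * s) (\<eta> - c * s) $ i - M \<eta> \<eta> $ i =
          integral {0..s} (\<lambda>r. ks M (\<eta> + a i * r) (\<eta> - c * r) $ i))) \<and>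
     (AE \<xi> in lebesgue. \<xi> \<in> {0..L} \<longrightarrow> (\<forall>i. (a i + c) * M \<xi> \<xi> $ i = sp \<xi> $ i))"

lemma Tr_compact: "compact Tr"
proof -
  have "Tr = ({0..L} \<times> {0..L}) \<inter> {z. snd z \<le> fst z}" by (auto simp: Tr_def)
  moreover have "closed {z. snd z \<le> (fst z :: real)}" by (intro closed_Collect_le continuous_intros)
  ultimately show ?thesis by (auto intro: compact_Int_closed compact_Times)
qed

lemma Tr_borel: "Tr \<in> sets borel" "Tr \<in> sets lebesgue"
  using compact_imp_closed[OF Tr_compact] by auto

lemma Tr_pred: "Measurable.pred borel (\<lambda>z. z \<in> Tr)"
  using Tr_borel by simp

lemma char_in_Tr:
  assumes "0 \<le> s"
  shows "(\<eta> + a i * s, \<eta> - c * s) \<in> Tr \<longleftrightarrow> c * s \<le> \<eta> \<and> \<eta> + a i * s \<le> L"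
proof -
  have "0 \<le> c * s" "0 \<le> a i * s" using assms a_pos[of i] c_pos by auto
  then show ?thesis by (auto simp: Tr_def)
qed

text \<open>The reflection term reads the kernel on \<open>x = L\<close>, a null set of the plane.
  The characteristic through \<open>(L, \<xi>)\<close> leaves the diagonal at an affine function of
  \<xi> with nonzero slope, so the exceptional set of feet pulls back to a null set of
  \<xi>.\<close>

lemma AE_char_trace_end:
  assumes "AE \<eta> in lebesgue. \<eta> \<in> {0..L} \<longrightarrow> (\<forall>s\<ge>0. (\<eta> + a i * s, \<eta> - c * s) \<in> Tr \<longrightarrow> Q (\<eta> + a i * s) (\<eta> - c * s))"
  shows "AE \<xi> in lebesgue. \<xi> \<in> {0..L} \<longrightarrow> Q L \<xi>"
proof -
  from ac_pos[of i] have p: "0 < a i + c" .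
  have "a i / (a i + c) \<noteq> 0" using a_pos[of i] p by auto
  from AE_affine[OF assms this, of "c * L / (a i + c)"] show ?thesis
  proof eventually_elim
    case (elim \<xi>)
    show ?case
    proof
      assume x: "\<xi> \<in> {0..L}"
      let ?\<eta> = "c * L / (a i + c) + a i / (a i + c) * \<xi>"
      let ?s = "(L - \<xi>) / (a i + c)"
      have e: "?\<eta> + a i * ?s = L" "?\<eta> - c * ?s = \<xi>"
        using p by (simp_all add: divide_simps) (simp_all add: algebra_simps)
      have s: "0 \<le> ?s" using x p by simp
      have "?\<eta> = \<xi> + c * ?s" using e by simp
      moreover have "0 \<le> c * ?s" "0 \<le> a i * ?s" using s a_pos[of i] c_pos by (auto intro!: mult_nonneg_nonneg simp del: times_divide_eq_right)
      ultimately have "?\<eta> \<in> {0..L}" using e(1) x by auto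
      with elim s have "(?\<eta> + a i * ?s, ?\<eta> - c * ?s) \<in> Tr \<longrightarrow> Q (?\<eta> + a i * ?s) (?\<eta> - c * ?s)" by blast
      then show "Q L \<xi>" unfolding e using x by (auto simp: Tr_def)
    qed
  qed
qed

text \<open>The gains read the kernel on \<xi> = 0. Here the foot of the characteristic through
  \<open>(x, 0)\<close> is \<open>c / (a i + c) * x\<close>.\<close>

lemma AE_char_trace_bottom:
  assumes "AE \<eta> in lebesgue. \<eta> \<in> {0..L} \<longrightarrow> (\<forall>s\<ge>0. (\<eta> + a i * s, \<eta> - c * s) \<in> Tr \<longrightarrow> Q (\<eta> + a i * s) (\<eta> - c * s))"
  shows "AE x in lebesgue. x \<in> {0..L} \<longrightarrow> Q x 0"
proof -
  from ac_pos[of i] have p: "0 < a i + c" .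
  have "c / (a i + c) \<noteq> 0" using c_pos p by auto
  from AE_affine[OF assms this, of 0] show ?thesis
  proof eventually_elim
    case (elim x)
    show ?case
    proof
      assume x: "x \<in> {0..L}"
      let ?\<eta> = "0 + c / (a i + c) * x"
      let ?s = "x / (a i + c)"
      have e: "?\<eta> + a i * ?s = x" "?\<eta> - c * ?s = 0"
        using p by (simp_all add: divide_simps) (simp_all add: algebra_simps)
      have s: "0 \<le> ?s" using x p by simp
      moreover have "0 \<le> c * ?s" "0 \<le> a i * ?s" using s a_pos[of i] c_pos by (auto intro!: mult_nonneg_nonneg simp del: times_divide_eq_right)
      ultimately have "?\<eta> \<in> {0..L}" using e x by auto
      with elim s have "(?\<eta> + a i * ?s, ?\<eta> - c * ?s) \<in> Tr \<longrightarrow> Q (?\<eta> + a i * ?s) (?\<eta> - c * ?s)" by blast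
      then show "Q x 0" unfolding e using x by (auto simp: Tr_def)
    qed
  qed
qed

text \<open>\<open>Q\<close> itself may fail to be measurable, so Fubini is applied to a Borel
  predicate \<open>Q'\<close> that agrees with it almost everywhere on the triangle.\<close>

lemma AE_char_imp_AE_Tr:
  assumes ae: "AE \<eta> in lebesgue. \<eta> \<in> {0..L} \<longrightarrow> (\<forall>s\<ge>0. (\<eta> + a i * s, \<eta> - c * s) \<in> Tr \<longrightarrow> Q (\<eta> + a i * s, \<eta> - c * s))"
    and Q: "AE z in lebesgue. z \<in> Tr \<longrightarrow> Q z \<longleftrightarrow> Q' z"
    and m: "Measurable.pred borel Q'"
  shows "AE z in lebesgue. z \<in> Tr \<longrightarrow> Q z"
proof -
  have p: "1 * (- c) - a i * 1 \<noteq> 0" using ac_pos[of i] by simp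
  have *: "AE \<eta> in lebesgue. AE s in lebesgue. (1 * \<eta> + a i * s, 1 * \<eta> + (- c) * s) \<in> Tr \<longrightarrow> Q' (1 * \<eta> + a i * s, 1 * \<eta> + (- c) * s)"
    using ae AE_lines[OF Q p]
  proof eventually_elim
    case (elim \<eta>)
    show ?case using elim(2)
    proof eventually_elim
      case (elim s)
      note el = elim
      show ?case
      proof
        assume T: "(1 * \<eta> + a i * s, 1 * \<eta> + (- c) * s) \<in> Tr"
        then have t: "0 \<le> \<eta> - c * s" "\<eta> - c * s \<le> \<eta> + a i * s" "\<eta> + a i * s \<le> L" by (auto simp: Tr_def)
        from t(2) have "0 \<le> (a i + c) * s" by (simp add: algebra_simps)
        then have s: "0 \<le> s" using ac_pos[of i] by (simp add: zero_le_mult_iff)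
        then have "0 \<le> c * s" "0 \<le> a i * s" using a_pos[of i] c_pos by auto
        then have "\<eta> \<in> {0..L}" using t by auto
        then show "Q' (1 * \<eta> + a i * s, 1 * \<eta> + (- c) * s)"
          using \<open>\<eta> \<in> {0..L} \<longrightarrow> _\<close> s el T by auto
      qed
    qed
  qed
  have "Measurable.pred borel (\<lambda>z. z \<in> Tr \<longrightarrow> Q' z)"
    using Tr_pred m by (rule pred_intros_logic)
  from AE_lines_converse[OF this _ p] * have "AE z in lebesgue. z \<in> Tr \<longrightarrow> Q' z"
    by blast
  with Q show ?thesis by eventually_elim auto
qed

lemma AE_Tr_imp_AE_char:
  assumes "AE z in lebesgue. z \<in> Tr \<longrightarrow> Q z"
  shows "AE \<eta> in lebesgue. AE s in lebesgue. (\<eta> + a i * s, \<eta> - c * s) \<in> Tr \<longrightarrow> Q (\<eta> + a i * s, \<eta> - c * s)"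
proof -
  have p: "1 * (- c) - a i * 1 \<noteq> 0" using ac_pos[of i] by simp
  from AE_lines[OF assms p] show ?thesis by simp
qed

text \<open>The family of lines at constant distance from the diagonal, along which the nonlocal
  term integrates.\<close>

lemma AE_Tr_imp_AE_diagonal:
  assumes "AE z in lebesgue. z \<in> Tr \<longrightarrow> Q z"
  shows "AE d in lebesgue. AE x in lebesgue. (x, x - d) \<in> Tr \<longrightarrow> Q (x, x - d)"
  using AE_lines[OF assms, of 0 1 1 "- 1"] by simp

lemma unit_interval_scale:
  fixes f :: "real \<Rightarrow> 'b::euclidean_space"
  assumes "0 \<le> X"
  shows "integral {0..X} f = X *\<^sub>R integral {0..1} (\<lambda>s. f (X * s))"
proof (cases "X = 0")
  case False
  then have "0 < X" using assms by simp
  from integral_scale[OF this, of X f] False show ?thesis by simp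
qed simp

lemma NM_eq_Nk:
  assumes "x \<le> L"
  shows "NM (\<lambda>x \<xi>. F (x, x - \<xi>)) x \<xi> = Nk F x (x - \<xi>)"
proof -
  have "0 \<le> (L - x) / c" using assms c_pos by simp
  from unit_interval_scale[OF this, of "\<lambda>\<nu>. sm (x + c * \<nu>) \<bullet> F (x + c * \<nu>, x - \<xi>)"]
  show ?thesis using c_pos unfolding NM_def Nk_def by (simp add: mult_ac)
qed

text \<open>For \<open>x = \<eta> + a i * s\<close> and \<open>d = (a i + c) * s\<close> the foot of
  the characteristic in \<open>kernel_fixed\<close> is exactly \<eta>, and the travel time is
  \<open>s\<close>.\<close>

lemma kernel_fixed_along:
  assumes F: "kernel_fixed F" and "0 \<le> s" "0 \<le> \<eta> - c * s" "\<eta> + a i * s \<le> L"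
  shows "F (\<eta> + a i * s, (a i + c) * s) $ i = sp \<eta> $ i / (a i + c) +
    integral {0..s} (\<lambda>r. src F (\<eta> + a i * r) ((a i + c) * r) $ i)"
proof -
  note p = ac_pos[of i]
  have nn: "0 \<le> c * s" "0 \<le> a i * s" using assms a_pos[of i] c_pos by auto
  have x: "\<eta> + a i * s \<in> {0..L}" and d: "(a i + c) * s \<in> {0..L}"
    using assms nn by (auto simp: algebra_simps)
  have e: "a i / (a i + c) * ((a i + c) * s * (1 - r)) = a i * s * (1 - r)" for r
    using p by simp
  have "F (\<eta> + a i * s, (a i + c) * s) $ i = sp \<eta> $ i / (a i + c) +
    s * integral {0..1} (\<lambda>r. src F (\<eta> + a i * (s * r)) ((a i + c) * (s * r)) $ i)"
    using F x d p unfolding kernel_fixed_def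
    by (simp add: e) (simp add: algebra_simps)
  then show ?thesis by (simp add: unit_interval_scale[OF \<open>0 \<le> s\<close>])
qed

lemma ksol_of_kernel_fixed:
  assumes F: "kernel_fixed F"
  shows "ksol (\<lambda>x \<xi>. F (x, x - \<xi>))"
proof -
  let ?M = "\<lambda>x \<xi>. F (x, x - \<xi>)"
  have Fc: "continuous_on UNIV F" using F by (simp add: kernel_fixed_def)
  have c: "continuous_on X (\<lambda>(x, \<xi>). ?M x \<xi>)" for X
    unfolding split_beta by (intro continuous_on_compose_UNIV[OF Fc] continuous_intros)
  have ks: "ks ?M x \<xi> = src F x (x - \<xi>)" if "x \<le> L" for x \<xi>
    using NM_eq_Nk[OF that] by (simp add: ks_def src_def)
  have "Linf_on Tr (\<lambda>(x, \<xi>). ?M x \<xi>)"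
    unfolding Linf_on_def
  proof
    show "(\<lambda>(x, \<xi>). ?M x \<xi>) \<in> borel_measurable (lebesgue_on Tr)"
      by (intro continuous_imp_measurable_on_sets_lebesgue c Tr_borel)
    have "bounded ((\<lambda>(x, \<xi>). ?M x \<xi>) ` Tr)"
      by (intro compact_imp_bounded compact_continuous_image c Tr_compact)
    then obtain B where "\<forall>z\<in>Tr. norm (case z of (x, \<xi>) \<Rightarrow> ?M x \<xi>) \<le> B"
      unfolding bounded_iff by blast
    then show "\<exists>C. AE z in lebesgue_on Tr. norm (case z of (x, \<xi>) \<Rightarrow> ?M x \<xi>) \<le> C"
      by (intro exI[of _ B] AE_I2) (simp add: space_restrict_space)
  qed
  moreover have "(\<lambda>r. ks ?M (\<eta> + a i * r) (\<eta> - c * r) $ i) absolutely_integrable_on {0..s} \<and>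
        ?M (\<eta> + a i * s) (\<eta> - c * s) $ i - ?M \<eta> \<eta> $ i =
          integral {0..s} (\<lambda>r. ks ?M (\<eta> + a i * r) (\<eta> - c * r) $ i)"
    if s: "0 \<le> s" and "(\<eta> + a i * s, \<eta> - c * s) \<in> Tr" for \<eta> s i
  proof -
    have T: "0 \<le> \<eta> - c * s" "\<eta> + a i * s \<le> L" using that by (auto simp: Tr_def)
    let ?g = "\<lambda>r. src F (\<eta> + a i * r) ((a i + c) * r) $ i"
    have eq: "ks ?M (\<eta> + a i * r) (\<eta> - c * r) $ i = ?g r" if "r \<in> {0..s}" for r
    proof -
      have "a i * r \<le> a i * s" using that a_pos[of i] by (intro mult_left_mono) auto
      then show ?thesis using T(2) ks[of "\<eta> + a i * r" "\<eta> - c * r"] by (simp add: algebra_simps)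
    qed
    have ae: "AE r in lebesgue. r \<in> {0..s} \<longrightarrow> ks ?M (\<eta> + a i * r) (\<eta> - c * r) $ i = ?g r"
      using eq by (intro AE_I2) blast
    have "?g absolutely_integrable_on {0..s}"
      by (intro absolutely_integrable_continuous_real continuous_on_component src_continuous[OF Fc] continuous_intros)
    moreover have "F (\<eta>, 0) $ i = sp \<eta> $ i / (a i + c)"
    proof -
      have "0 \<le> c * s" "0 \<le> a i * s" using s a_pos[of i] c_pos by auto
      then have "0 \<le> \<eta>" "\<eta> \<le> L" using T by auto
      then show ?thesis using kernel_fixed_along[OF F, of 0 \<eta> i] by simp
    qed
    moreover have "?M (\<eta> + a i * s) (\<eta> - c * s) = F (\<eta> + a i * s, (a i + c) * s)" by (simp add: algebra_simps)
    ultimately show ?thesis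
      using kernel_fixed_along[OF F s T] by (simp add: AE_integral_cong[OF ae])
  qed
  moreover have "(a i + c) * ?M \<xi> \<xi> $ i = sp \<xi> $ i" if "\<xi> \<in> {0..L}" for \<xi> i
    using kernel_fixed_along[OF F, of 0 \<xi> i] that ac_pos[of i] by simp
  ultimately show ?thesis unfolding ksol_def by auto
qed

end


section \<open>Uniqueness of the kernel\<close>

lemma norm_le_card_bound:
  fixes v :: "real^'n"
  assumes "\<And>i. \<bar>v $ i\<bar> \<le> b"
  shows "norm v \<le> real CARD('n) * b"
proof -
  have "norm v \<le> (\<Sum>i\<in>UNIV. \<bar>v $ i\<bar>)" by (rule norm_le_l1_cart)
  also have "\<dots> \<le> (\<Sum>i\<in>(UNIV::'n set). b)" by (intro sum_mono assms)
  finally show ?thesis by simp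
qed

lemma AE_lebesgue_neq: "AE x in lebesgue. x \<noteq> (y::real)"
  by (simp add: AE_lebesgue_iff_negligible)

lemma AE_all_finite_index:
  fixes P :: "'i::finite \<Rightarrow> 'a \<Rightarrow> bool"
  assumes "\<And>i. AE x in M. P i x"
  shows "AE x in M. \<forall>i. P i x"
  using assms unfolding AE_all_countable by blast

lemma borel_measurable_inner_components:
  fixes f g :: "'a \<Rightarrow> real^'n"
  assumes "\<And>i. (\<lambda>x. f x $ i) \<in> borel_measurable M" "\<And>i. (\<lambda>x. g x $ i) \<in> borel_measurable M"
  shows "(\<lambda>x. f x \<bullet> g x) \<in> borel_measurable M"
  unfolding inner_vec_def inner_real_def using assms by (intro borel_measurable_sum borel_measurable_times)

context kernel_data
begin

text \<open>A fixed choice of the constant from \<open>coeff_bound\<close>, so that later constants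
  such as \<open>Bc\<close> can be defined from it.\<close>

definition Kc :: real where
  "Kc = (SOME K. 0 \<le> K \<and> (\<forall>x\<in>{-L..L}. \<forall>v. norm (S x *v v) \<le> K * norm v) \<and>
     (\<forall>x\<in>{-L..L}. norm (sp x) \<le> K) \<and> (\<forall>x\<in>{-L..L}. norm (sm x) \<le> K))"

lemma Kc: "0 \<le> Kc" "x \<in> {0..L} \<Longrightarrow> norm (S x *v v) \<le> Kc * norm v"
  "x \<in> {0..L} \<Longrightarrow> norm (sp x) \<le> Kc" "x \<in> {0..L} \<Longrightarrow> norm (sm x) \<le> Kc"
proof -
  have "\<exists>K. 0 \<le> K \<and> (\<forall>x\<in>{-L..L}. \<forall>v. norm (S x *v v) \<le> K * norm v) \<and>
     (\<forall>x\<in>{-L..L}. norm (sp x) \<le> K) \<and> (\<forall>x\<in>{-L..L}. norm (sm x) \<le> K)"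
    by (rule coeff_bound) blast
  from someI_ex[OF this, folded Kc_def] L_pos
  show "0 \<le> Kc" "x \<in> {0..L} \<Longrightarrow> norm (S x *v v) \<le> Kc * norm v"
    "x \<in> {0..L} \<Longrightarrow> norm (sp x) \<le> Kc" "x \<in> {0..L} \<Longrightarrow> norm (sm x) \<le> Kc" by auto
qed

text \<open>On almost every characteristic the kernel is a constant plus an indefinite integral,
  hence continuous, and there a bound at almost every point is a bound at every point.\<close>

lemma ksol_char_bounded:
  assumes M: "ksol M" and C: "AE z in lebesgue. z \<in> Tr \<longrightarrow> (case z of (x, \<xi>) \<Rightarrow> \<bar>M x \<xi> $ i\<bar> \<le> C)"
  shows "AE \<eta> in lebesgue. \<eta> \<in> {0..L} \<longrightarrow> (\<forall>s\<ge>0. (\<eta> + a i * s, \<eta> - c * s) \<in> Tr \<longrightarrow>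
    \<bar>M (\<eta> + a i * s) (\<eta> - c * s) $ i\<bar> \<le> C)"
proof -
  have "AE \<eta> in lebesgue. \<eta> \<in> {0..L} \<longrightarrow> (\<forall>s\<ge>0. (\<eta> + a i * s, \<eta> - c * s) \<in> Tr \<longrightarrow>
        (\<lambda>r. ks M (\<eta> + a i * r) (\<eta> - c * r) $ i) absolutely_integrable_on {0..s} \<and>
        M (\<eta> + a i * s) (\<eta> - c * s) $ i - M \<eta> \<eta> $ i =
          integral {0..s} (\<lambda>r. ks M (\<eta> + a i * r) (\<eta> - c * r) $ i))"
    using M by (simp add: ksol_def)
  then show ?thesis
    using AE_Tr_imp_AE_char[OF C, of i] AE_lebesgue_neq[of 0] AE_lebesgue_neq[of L]
  proof eventually_elim
    case (elim \<eta>)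
    show ?case
    proof (intro impI allI)
      fix s assume \<eta>: "\<eta> \<in> {0..L}" and s: "0 \<le> s" "(\<eta> + a i * s, \<eta> - c * s) \<in> Tr"
      \<comment> \<open>The time at which the characteristic leaves the triangle through the bottom
        or the right side. It is positive because \<eta> = 0 and \<eta> = L are excluded.\<close>
      define S where "S = min (\<eta> / c) ((L - \<eta>) / a i)"
      have S0: "0 < S" using \<eta> elim(3,4) c_pos a_pos[of i] by (simp add: S_def)
      have inT: "(\<eta> + a i * r, \<eta> - c * r) \<in> Tr \<longleftrightarrow> r \<le> S" if "0 \<le> r" for r
        unfolding char_in_Tr[OF that] S_def using c_pos a_pos[of i]
        by (simp add: pos_le_divide_eq algebra_simps)
      define g where "g r = ks M (\<eta> + a i * r) (\<eta> - c * r) $ i" for r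
      define h where "h r = M \<eta> \<eta> $ i + integral {0..r} g" for r
      have "g integrable_on {0..S}"
        using elim(1) \<eta> inT[of S] S0 unfolding g_def absolutely_integrable_on_def by auto
      then have hc: "continuous_on {0..S} h"
        unfolding h_def by (intro continuous_intros indefinite_integral_continuous_1)
      have h: "M (\<eta> + a i * r) (\<eta> - c * r) $ i = h r" if "r \<in> {0..S}" for r
      proof -
        have "0 \<le> r" "(\<eta> + a i * r, \<eta> - c * r) \<in> Tr" using that inT by auto
        then have "M (\<eta> + a i * r) (\<eta> - c * r) $ i - M \<eta> \<eta> $ i = integral {0..r} g"
          using elim(1) \<eta> unfolding g_def by blast
        then show ?thesis by (simp add: h_def)
      qed
      have "AE r in lebesgue. r \<in> {0..S} \<longrightarrow> \<bar>h r\<bar> \<le> C"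
        using elim(2) by eventually_elim (use inT h in auto)
      from continuous_bound_AE[OF hc S0 this, of s] h[of s] inT[of s] s
      show "\<bar>M (\<eta> + a i * s) (\<eta> - c * s) $ i\<bar> \<le> C" by auto
    qed
  qed
qed

text \<open>A weighted supremum distance, with weight \<open>exp (k * d)\<close> at distance
  \<open>d\<close> from the diagonal. It is taken along characteristics because the equations also
  use traces on the sides of the triangle.\<close>

definition close_kernels :: "real \<Rightarrow> real \<Rightarrow> (real \<Rightarrow> real \<Rightarrow> real^'n) \<Rightarrow> (real \<Rightarrow> real \<Rightarrow> real^'n) \<Rightarrow> bool" where
  "close_kernels k C M M' \<longleftrightarrow> (\<forall>i. AE \<eta> in lebesgue. \<eta> \<in> {0..L} \<longrightarrow>
     (\<forall>s\<ge>0. (\<eta> + a i * s, \<eta> - c * s) \<in> Tr \<longrightarrow>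
        \<bar>M (\<eta> + a i * s) (\<eta> - c * s) $ i - M' (\<eta> + a i * s) (\<eta> - c * s) $ i\<bar>
          \<le> C * exp (k * ((\<eta> + a i * s) - (\<eta> - c * s)))))"

lemma close_kernelsD:
  assumes "close_kernels k C M M'"
  shows "AE \<eta> in lebesgue. \<eta> \<in> {0..L} \<longrightarrow>
     (\<forall>s\<ge>0. (\<eta> + a i * s, \<eta> - c * s) \<in> Tr \<longrightarrow>
        \<bar>M (\<eta> + a i * s) (\<eta> - c * s) $ i - M' (\<eta> + a i * s) (\<eta> - c * s) $ i\<bar>
          \<le> C * exp (k * ((\<eta> + a i * s) - (\<eta> - c * s))))"
  using assms by (simp add: close_kernels_def)

lemma close_kernels_initial:
  assumes "ksol M" "ksol M'"
  shows "\<exists>C\<ge>0. \<forall>k\<ge>0. close_kernels k C M M'"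
proof -
  have Linf: "Linf_on Tr (\<lambda>(x, \<xi>). M x \<xi>)" "Linf_on Tr (\<lambda>(x, \<xi>). M' x \<xi>)"
    using assms by (auto simp: ksol_def)
  obtain g C where "borel_version Tr (\<lambda>(x, \<xi>). M x \<xi>) g C"
    using borel_version_exists[OF Linf(1) Tr_borel(2)] by blast
  note g = borel_versionD(2-4)[OF this]
  obtain g' C' where "borel_version Tr (\<lambda>(x, \<xi>). M' x \<xi>) g' C'"
    using borel_version_exists[OF Linf(2) Tr_borel(2)] by blast
  note g' = borel_versionD(2-4)[OF this]
  have "close_kernels k (C + C') M M'" if k: "0 \<le> k" for k
    unfolding close_kernels_def
  proof
    fix i
    have "AE z in lebesgue. z \<in> Tr \<longrightarrow> (case z of (x, \<xi>) \<Rightarrow> \<bar>M x \<xi> $ i\<bar> \<le> C)"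
      using g(3) by eventually_elim (use g(2) in \<open>auto simp: split_beta\<close>)
    note 1 = ksol_char_bounded[OF assms(1) this]
    have "AE z in lebesgue. z \<in> Tr \<longrightarrow> (case z of (x, \<xi>) \<Rightarrow> \<bar>M' x \<xi> $ i\<bar> \<le> C')"
      using g'(3) by eventually_elim (use g'(2) in \<open>auto simp: split_beta\<close>)
    note 2 = ksol_char_bounded[OF assms(2) this]
    show "AE \<eta> in lebesgue. \<eta> \<in> {0..L} \<longrightarrow>
     (\<forall>s\<ge>0. (\<eta> + a i * s, \<eta> - c * s) \<in> Tr \<longrightarrow>
        \<bar>M (\<eta> + a i * s) (\<eta> - c * s) $ i - M' (\<eta> + a i * s) (\<eta> - c * s) $ i\<bar>
          \<le> (C + C') * exp (k * ((\<eta> + a i * s) - (\<eta> - c * s))))"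
      using 1 2
    proof eventually_elim
      case (elim \<eta>)
      show ?case
      proof (intro impI allI)
        fix s assume *: "\<eta> \<in> {0..L}" "0 \<le> s" "(\<eta> + a i * s, \<eta> - c * s) \<in> Tr"
        have "0 \<le> (\<eta> + a i * s) - (\<eta> - c * s)" using *(3) by (simp add: Tr_def)
        then have "(C + C') * 1 \<le> (C + C') * exp (k * ((\<eta> + a i * s) - (\<eta> - c * s)))"
          using k g(1) g'(1) by (intro mult_left_mono) auto
        moreover
        have "\<bar>M (\<eta> + a i * s) (\<eta> - c * s) $ i\<bar> \<le> C" "\<bar>M' (\<eta> + a i * s) (\<eta> - c * s) $ i\<bar> \<le> C'"
          using elim * by blast+
        then have "\<bar>M (\<eta> + a i * s) (\<eta> - c * s) $ i - M' (\<eta> + a i * s) (\<eta> - c * s) $ i\<bar> \<le> (C + C') * 1"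
          using order_trans[OF abs_triangle_ineq4 add_mono] by simp
        ultimately show "\<bar>M (\<eta> + a i * s) (\<eta> - c * s) $ i - M' (\<eta> + a i * s) (\<eta> - c * s) $ i\<bar>
          \<le> (C + C') * exp (k * ((\<eta> + a i * s) - (\<eta> - c * s)))" by (rule order_trans[rotated])
      qed
    qed
  qed
  with g(1) g'(1) show ?thesis by (intro exI[of _ "C + C'"]) auto
qed

lemma close_kernels_AE_Tr:
  assumes "close_kernels k C M M'" and Linf: "Linf_on Tr (\<lambda>(x, \<xi>). M x \<xi>)" "Linf_on Tr (\<lambda>(x, \<xi>). M' x \<xi>)"
  shows "AE z in lebesgue. z \<in> Tr \<longrightarrow>
    (\<forall>i. \<bar>M (fst z) (snd z) $ i - M' (fst z) (snd z) $ i\<bar> \<le> C * exp (k * (fst z - snd z)))"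
proof -
  obtain g C1 where "borel_version Tr (\<lambda>(x, \<xi>). M x \<xi>) g C1"
    using borel_version_exists[OF Linf(1) Tr_borel(2)] by blast
  note g = borel_versionD(1,4)[OF this]
  obtain g' C1' where "borel_version Tr (\<lambda>(x, \<xi>). M' x \<xi>) g' C1'"
    using borel_version_exists[OF Linf(2) Tr_borel(2)] by blast
  note g' = borel_versionD(1,4)[OF this]
  have "AE z in lebesgue. z \<in> Tr \<longrightarrow>
    \<bar>M (fst z) (snd z) $ i - M' (fst z) (snd z) $ i\<bar> \<le> C * exp (k * (fst z - snd z))" for i
  proof (rule AE_char_imp_AE_Tr)
    let ?Q = "\<lambda>z. \<bar>M (fst z) (snd z) $ i - M' (fst z) (snd z) $ i\<bar> \<le> C * exp (k * (fst z - snd z))"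
    let ?Q' = "\<lambda>z. \<bar>g z $ i - g' z $ i\<bar> \<le> C * exp (k * (fst z - snd z))"
    show "AE \<eta> in lebesgue. \<eta> \<in> {0..L} \<longrightarrow>
       (\<forall>s\<ge>0. (\<eta> + a i * s, \<eta> - c * s) \<in> Tr \<longrightarrow> ?Q (\<eta> + a i * s, \<eta> - c * s))"
      using assms(1) by (simp add: close_kernels_def)
    show "AE z in lebesgue. z \<in> Tr \<longrightarrow> ?Q z \<longleftrightarrow> ?Q' z"
      using g(2) g'(2) by eventually_elim (auto simp: split_beta)
    have "(\<lambda>z. fst z - snd z) \<in> borel_measurable (borel :: (real \<times> real) measure)"
      by (intro borel_measurable_continuous_onI continuous_intros)
    note [measurable] = this g(1) g'(1)
    show "Measurable.pred borel ?Q'" by measurable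
  qed
  then have "AE z in lebesgue. \<forall>i. z \<in> Tr \<longrightarrow>
    \<bar>M (fst z) (snd z) $ i - M' (fst z) (snd z) $ i\<bar> \<le> C * exp (k * (fst z - snd z))"
    by (rule AE_all_finite_index)
  then show ?thesis by eventually_elim blast
qed

text \<open>A single null set of \<open>d\<close> serves all \<open>x\<close>: for fixed
  \<open>d\<close> the integrals from different starting points run along the same line.\<close>

lemma NM_integrand_integrable:
  assumes "Linf_on Tr (\<lambda>(x, \<xi>). M x \<xi>)"
  shows "AE d in lebesgue. d \<in> {0..L} \<longrightarrow> (\<forall>x\<in>{d..L}.
    (\<lambda>\<nu>. sm (x + c * \<nu>) \<bullet> M (x + c * \<nu>) (x - d + c * \<nu>)) absolutely_integrable_on {0..(L - x) / c})"
proof -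
  obtain g C where "borel_version Tr (\<lambda>(x, \<xi>). M x \<xi>) g C"
    using borel_version_exists[OF assms Tr_borel(2)] by blast
  note g = borel_versionD[OF this]
  from AE_Tr_imp_AE_diagonal[OF g(4)] show ?thesis
  proof eventually_elim
    case (elim d)
    show ?case
    proof (intro impI ballI)
      fix x assume d: "d \<in> {0..L}" and x: "x \<in> {d..L}"
      let ?f = "\<lambda>\<nu>. sm (x + c * \<nu>) \<bullet> g (x + c * \<nu>, x + c * \<nu> - d)"
      have "AE \<nu> in lebesgue. (x + c * \<nu>, x + c * \<nu> - d) \<in> Tr \<longrightarrow>
          M (x + c * \<nu>) (x + c * \<nu> - d) = g (x + c * \<nu>, x + c * \<nu> - d)"
        using AE_affine[OF elim, of c x] c_pos by simp
      then have ae: "AE \<nu> in lebesgue. \<nu> \<in> {0..(L - x) / c} \<longrightarrow>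
          sm (x + c * \<nu>) \<bullet> M (x + c * \<nu>) (x - d + c * \<nu>) = ?f \<nu>"
      proof eventually_elim
        case (elim \<nu>)
        show ?case
        proof
          assume n: "\<nu> \<in> {0..(L - x) / c}"
          then have "0 \<le> c * \<nu>" "x + c * \<nu> \<le> L" using c_pos by (auto simp: pos_le_divide_eq algebra_simps)
          then have "(x + c * \<nu>, x + c * \<nu> - d) \<in> Tr" using d x by (auto simp: Tr_def)
          with elim have "M (x + c * \<nu>) (x + c * \<nu> - d) = g (x + c * \<nu>, x + c * \<nu> - d)" by simp
          then show "sm (x + c * \<nu>) \<bullet> M (x + c * \<nu>) (x - d + c * \<nu>) = ?f \<nu>" by (simp add: algebra_simps)
        qed
      qed
      have "?f absolutely_integrable_on {0..(L - x) / c}"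
      proof (rule bounded_measurable_absolutely_integrable)
        have "?f \<in> borel_measurable borel"
        proof (rule borel_measurable_inner_components)
          show "(\<lambda>\<nu>. sm (x + c * \<nu>) $ i) \<in> borel_measurable borel" for i
            by (intro borel_measurable_continuous_onI continuous_on_component coeff_cont continuous_intros)
          have "(\<lambda>\<nu>. (x + c * \<nu>, x + c * \<nu> - d)) \<in> borel_measurable borel"
            by (intro borel_measurable_continuous_onI continuous_intros)
          from measurable_compose[OF this g(1)]
          show "(\<lambda>\<nu>. g (x + c * \<nu>, x + c * \<nu> - d) $ i) \<in> borel_measurable borel" for i .
        qed
        then show "?f \<in> borel_measurable lebesgue" by (simp add: measurable_completion)
        fix r assume n: "r \<in> {0..(L - x) / c}"
        then have "0 \<le> c * r" "x + c * r \<le> L" using c_pos by (auto simp: pos_le_divide_eq algebra_simps)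
        then have "norm (sm (x + c * r)) \<le> Kc" using d x by (intro Kc) auto
        then show "norm (?f r) \<le> Kc * (real CARD('n) * C)"
          using norm_le_card_bound[of "g (x + c * r, x + c * r - d)" C] g(3) Kc(1)
          using order_trans[OF Cauchy_Schwarz_ineq2 mult_mono[of "norm (sm (x + c * r))" Kc _ "real CARD('n) * C"]]
          by simp
      qed
      then show "(\<lambda>\<nu>. sm (x + c * \<nu>) \<bullet> M (x + c * \<nu>) (x - d + c * \<nu>)) absolutely_integrable_on {0..(L - x) / c}"
        by (simp add: AE_integral_cong[OF ae])
    qed
  qed
qed

text \<open>The reflection reads the point of the side \<open>x = L\<close> at distance
  \<open>d\<close>, the integral reads the line at distance \<open>d\<close>. The weight has the
  constant value \<open>exp (k * d)\<close> on both, so it factors out of the nonlocal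
  terms.\<close>

lemma NM_diff_bound:
  assumes close: "close_kernels k C M M'" and C: "0 \<le> C"
    and Linf: "Linf_on Tr (\<lambda>(x, \<xi>). M x \<xi>)" "Linf_on Tr (\<lambda>(x, \<xi>). M' x \<xi>)"
  shows "AE d in lebesgue. d \<in> {0..L} \<longrightarrow> (\<forall>x\<in>{d..L}. \<bar>NM M x (x - d) - NM M' x (x - d)\<bar> \<le>
    (norm R + L / c * Kc) * (real CARD('n) * (C * exp (k * d))))"
proof -
  have "AE \<xi> in lebesgue. \<xi> \<in> {0..L} \<longrightarrow> \<bar>M L \<xi> $ i - M' L \<xi> $ i\<bar> \<le> C * exp (k * (L - \<xi>))" for i
    by (rule AE_char_trace_end[where Q = "\<lambda>x \<xi>. \<bar>M x \<xi> $ i - M' x \<xi> $ i\<bar> \<le> C * exp (k * (x - \<xi>))",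
          OF close_kernelsD[OF close]])
  then have "AE \<xi> in lebesgue. \<forall>i. \<xi> \<in> {0..L} \<longrightarrow> \<bar>M L \<xi> $ i - M' L \<xi> $ i\<bar> \<le> C * exp (k * (L - \<xi>))"
    by (rule AE_all_finite_index)
  then have "AE d in lebesgue. \<forall>i. L + - 1 * d \<in> {0..L} \<longrightarrow>
      \<bar>M L (L + - 1 * d) $ i - M' L (L + - 1 * d) $ i\<bar> \<le> C * exp (k * (L - (L + - 1 * d)))"
    by (rule AE_affine) simp
  then have tr: "AE d in lebesgue. \<forall>i. d \<in> {0..L} \<longrightarrow> \<bar>M L (L - d) $ i - M' L (L - d) $ i\<bar> \<le> C * exp (k * d)"
    by eventually_elim auto
  show ?thesis
    using tr AE_Tr_imp_AE_diagonal[OF close_kernels_AE_Tr[OF close Linf]]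
      NM_integrand_integrable[OF Linf(1)] NM_integrand_integrable[OF Linf(2)]
  proof eventually_elim
    case (elim d)
    show ?case
    proof (intro impI ballI)
      fix x assume d: "d \<in> {0..L}" and x: "x \<in> {d..L}"
      define E where "E = real CARD('n) * (C * exp (k * d))"
      have E0: "0 \<le> E" using C by (simp add: E_def)
      let ?f = "\<lambda>M \<nu>. sm (x + c * \<nu>) \<bullet> M (x + c * \<nu>) (x - d + c * \<nu>)"
      let ?I = "{0..(L - x) / c}"
      have f: "?f M absolutely_integrable_on ?I" "?f M' absolutely_integrable_on ?I"
        using elim(3,4) d x by blast+
      have len: "0 \<le> (L - x) / c" "(L - x) / c \<le> L / c" using x d c_pos by (auto simp: divide_right_mono)
      have "AE \<nu> in lebesgue. \<nu> \<in> ?I \<longrightarrow> \<bar>?f M \<nu> - ?f M' \<nu>\<bar> \<le> Kc * E"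
        using AE_affine[OF elim(2) c_pos[THEN less_imp_neq, symmetric], of x]
      proof eventually_elim
        case (elim \<nu>)
        show ?case
        proof
          assume n: "\<nu> \<in> ?I"
          then have nu: "0 \<le> c * \<nu>" "x + c * \<nu> \<le> L" using c_pos by (auto simp: pos_le_divide_eq algebra_simps)
          then have "(x + c * \<nu>, x + c * \<nu> - d) \<in> Tr" using d x by (auto simp: Tr_def)
          with elim have "\<bar>(M (x + c * \<nu>) (x - d + c * \<nu>) - M' (x + c * \<nu>) (x - d + c * \<nu>)) $ i\<bar> \<le> C * exp (k * d)" for i
            by (simp add: algebra_simps)
          then have "norm (M (x + c * \<nu>) (x - d + c * \<nu>) - M' (x + c * \<nu>) (x - d + c * \<nu>)) \<le> E"
            unfolding E_def by (rule norm_le_card_bound)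
          moreover have "norm (sm (x + c * \<nu>)) \<le> Kc" using nu d x by (intro Kc) auto
          ultimately have "norm (sm (x + c * \<nu>)) * norm (M (x + c * \<nu>) (x - d + c * \<nu>) - M' (x + c * \<nu>) (x - d + c * \<nu>)) \<le> Kc * E"
            using Kc(1) by (intro mult_mono) auto
          from order_trans[OF Cauchy_Schwarz_ineq2 this]
          show "\<bar>?f M \<nu> - ?f M' \<nu>\<bar> \<le> Kc * E" by (simp add: inner_diff_right)
        qed
      qed
      then have "\<bar>integral ?I (\<lambda>\<nu>. ?f M \<nu> - ?f M' \<nu>)\<bar> \<le> integral ?I (\<lambda>_. Kc * E)"
        by (intro abs_integral_le_AE set_integral_diff f) auto
      also have "integral ?I (\<lambda>\<nu>. ?f M \<nu> - ?f M' \<nu>) = integral ?I (?f M) - integral ?I (?f M')"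
        using f by (intro integral_diff) (auto simp: absolutely_integrable_on_def)
      also have "integral ?I (\<lambda>_. Kc * E) = (L - x) / c * (Kc * E)" using len by simp
      also have "\<dots> \<le> L / c * (Kc * E)" using len Kc(1) E0 by (intro mult_right_mono) auto
      finally have 1: "\<bar>integral ?I (?f M) - integral ?I (?f M')\<bar> \<le> L / c * (Kc * E)" .
      have "norm (M L (L - d) - M' L (L - d)) \<le> E"
        unfolding E_def using elim(1) d by (intro norm_le_card_bound) simp
      from order_trans[OF Cauchy_Schwarz_ineq2 mult_left_mono[OF this norm_ge_zero]]
      have 2: "\<bar>R \<bullet> M L (L - d) - R \<bullet> M' L (L - d)\<bar> \<le> norm R * E" by (simp add: inner_diff_right)
      have "\<bar>NM M x (x - d) - NM M' x (x - d)\<bar> \<le> norm R * E + L / c * (Kc * E)"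
        using 1 2 unfolding NM_def by simp
      then show "\<bar>NM M x (x - d) - NM M' x (x - d)\<bar> \<le> (norm R + L / c * Kc) * (real CARD('n) * (C * exp (k * d)))"
        by (simp add: E_def algebra_simps)
    qed
  qed
qed


text \<open>Lipschitz constant of the kernel source: the first summand belongs to \<open>S\<close>,
  the second to the nonlocal terms multiplied by \<open>sp\<close>. The factor
  \<open>CARD('n)\<close> passes from bounds on components to the Euclidean norm.\<close>

definition Bc :: real where
  "Bc = real CARD('n) * Kc + (norm R + L / c * Kc) * real CARD('n) * Kc"

lemma Bc_nonneg: "0 \<le> Bc"
  unfolding Bc_def using Kc(1) L_pos c_pos by (intro add_nonneg_nonneg mult_nonneg_nonneg) auto

lemma ks_diff_bound:
  assumes close: "close_kernels k C M M'" and C: "0 \<le> C"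
    and Linf: "Linf_on Tr (\<lambda>(x, \<xi>). M x \<xi>)" "Linf_on Tr (\<lambda>(x, \<xi>). M' x \<xi>)"
  shows "AE \<eta> in lebesgue. AE s in lebesgue. 0 \<le> s \<longrightarrow> (\<eta> + a i * s, \<eta> - c * s) \<in> Tr \<longrightarrow>
    \<bar>ks M (\<eta> + a i * s) (\<eta> - c * s) $ i - ks M' (\<eta> + a i * s) (\<eta> - c * s) $ i\<bar>
      \<le> Bc * C * exp (k * ((a i + c) * s))"
proof -
  \<comment> \<open>On any characteristic the distance from the diagonal is
    \<open>(a i + c) * s\<close>, so a null set of distances is a null set of \<open>s\<close>, the
    same for every \<eta>.\<close>
  have "AE s in lebesgue. 0 + (a i + c) * s \<in> {0..L} \<longrightarrow> (\<forall>x\<in>{0 + (a i + c) * s..L}.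
    \<bar>NM M x (x - (0 + (a i + c) * s)) - NM M' x (x - (0 + (a i + c) * s))\<bar> \<le>
    (norm R + L / c * Kc) * (real CARD('n) * (C * exp (k * (0 + (a i + c) * s)))))"
    by (rule AE_affine[OF NM_diff_bound[OF assms]]) (use ac_pos[of i] in simp)
  then have N: "AE s in lebesgue. (a i + c) * s \<in> {0..L} \<longrightarrow> (\<forall>x\<in>{(a i + c) * s..L}.
    \<bar>NM M x (x - (a i + c) * s) - NM M' x (x - (a i + c) * s)\<bar> \<le>
    (norm R + L / c * Kc) * (real CARD('n) * (C * exp (k * ((a i + c) * s)))))"
    by simp
  show ?thesis
    using AE_Tr_imp_AE_char[OF close_kernels_AE_Tr[OF close Linf], of i]
  proof eventually_elim
    case (elim \<eta>)
    show ?case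
      using elim N
    proof eventually_elim
      case (elim s)
      show ?case
      proof (intro impI)
        assume s: "0 \<le> s" and T: "(\<eta> + a i * s, \<eta> - c * s) \<in> Tr"
        define x where "x = \<eta> + a i * s"
        define \<xi> where "\<xi> = \<eta> - c * s"
        define d where "d = (a i + c) * s"
        define E where "E = real CARD('n) * (C * exp (k * d))"
        have \<xi>: "\<xi> = x - d" by (simp add: x_def \<xi>_def d_def algebra_simps)
        have d: "d \<in> {0..L}" "x \<in> {d..L}"
          using T s ac_pos[of i] \<xi> by (auto simp: Tr_def d_def simp flip: x_def \<xi>_def)
        have E0: "0 \<le> E" using C by (simp add: E_def)
        have N: "\<bar>NM M x \<xi> - NM M' x \<xi>\<bar> \<le> (norm R + L / c * Kc) * E"
          using elim(2) d unfolding \<xi> E_def d_def by blast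
        have "\<bar>(M x \<xi> - M' x \<xi>) $ i\<bar> \<le> C * exp (k * d)" for i
          using elim(1) T \<xi> by (simp flip: x_def \<xi>_def)
        then have D: "norm (M x \<xi> - M' x \<xi>) \<le> E" unfolding E_def by (rule norm_le_card_bound)
        have "ks M x \<xi> - ks M' x \<xi> = S x *v (M x \<xi> - M' x \<xi>) + (NM M x \<xi> - NM M' x \<xi>) *\<^sub>R sp x"
          by (simp add: ks_def matrix_vector_mult_diff_distrib algebra_simps)
        also have "norm \<dots> \<le> Kc * E + ((norm R + L / c * Kc) * E) * Kc"
        proof (rule norm_triangle_mono)
          have x: "x \<in> {0..L}" using d by auto
          show "norm (S x *v (M x \<xi> - M' x \<xi>)) \<le> Kc * E"
            by (rule order_trans[OF Kc(2)[OF x] mult_left_mono[OF D Kc(1)]])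
          show "norm ((NM M x \<xi> - NM M' x \<xi>) *\<^sub>R sp x) \<le> (norm R + L / c * Kc) * E * Kc"
            unfolding norm_scaleR using N Kc(1) Kc(3)[OF x] E0 L_pos c_pos by (intro mult_mono) auto
        qed
        also have "\<dots> = Bc * C * exp (k * d)" by (simp add: Bc_def E_def algebra_simps)
        finally have "norm (ks M x \<xi> - ks M' x \<xi>) \<le> Bc * C * exp (k * d)" .
        from order_trans[OF component_le_norm_cart this, of i]
        show "\<bar>ks M (\<eta> + a i * s) (\<eta> - c * s) $ i - ks M' (\<eta> + a i * s) (\<eta> - c * s) $ i\<bar>
            \<le> Bc * C * exp (k * ((a i + c) * s))"
          by (simp flip: x_def \<xi>_def d_def)
      qed
    qed
  qed
qed

text \<open>The diagonal values agree, so only the integrated source contributes. The weight turns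
  its bound into \<open>Bc * C / (k * (a i + c))\<close>, and \<open>k * c \<ge> 2 * Bc\<close> by
  the choice of \<open>k\<close>; the summand 1 keeps \<open>k\<close> positive.\<close>

lemma close_kernels_half:
  assumes M: "ksol M" "ksol M'" and k: "k = 2 * Bc / c + 1" and C: "0 \<le> C"
    and close: "close_kernels k C M M'"
  shows "close_kernels k (C / 2) M M'"
  unfolding close_kernels_def
proof
  fix i
  have Linf: "Linf_on Tr (\<lambda>(x, \<xi>). M x \<xi>)" "Linf_on Tr (\<lambda>(x, \<xi>). M' x \<xi>)"
    using M by (auto simp: ksol_def)
  have k0: "0 < k" using Bc_nonneg c_pos unfolding k by (simp add: add_nonneg_pos)
  have ch: "AE \<eta> in lebesgue. \<eta> \<in> {0..L} \<longrightarrow> (\<forall>s\<ge>0. (\<eta> + a i * s, \<eta> - c * s) \<in> Tr \<longrightarrow>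
        (\<lambda>r. ks M (\<eta> + a i * r) (\<eta> - c * r) $ i) absolutely_integrable_on {0..s} \<and>
        M (\<eta> + a i * s) (\<eta> - c * s) $ i - M \<eta> \<eta> $ i =
          integral {0..s} (\<lambda>r. ks M (\<eta> + a i * r) (\<eta> - c * r) $ i))"
    "AE \<xi> in lebesgue. \<xi> \<in> {0..L} \<longrightarrow> (\<forall>i. (a i + c) * M \<xi> \<xi> $ i = sp \<xi> $ i)"
    if "ksol M" for M
    using that by (simp_all add: ksol_def)
  show "AE \<eta> in lebesgue. \<eta> \<in> {0..L} \<longrightarrow>
     (\<forall>s\<ge>0. (\<eta> + a i * s, \<eta> - c * s) \<in> Tr \<longrightarrow>
        \<bar>M (\<eta> + a i * s) (\<eta> - c * s) $ i - M' (\<eta> + a i * s) (\<eta> - c * s) $ i\<bar>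
          \<le> C / 2 * exp (k * ((\<eta> + a i * s) - (\<eta> - c * s))))"
    using ch[OF M(1)] ch[OF M(2)] ks_diff_bound[OF close C Linf, of i]
  proof eventually_elim
    case (elim \<eta>)
    show ?case
    proof (intro impI allI)
      fix s assume \<eta>: "\<eta> \<in> {0..L}" and s: "0 \<le> s" "(\<eta> + a i * s, \<eta> - c * s) \<in> Tr"
      let ?g = "\<lambda>M r. ks M (\<eta> + a i * r) (\<eta> - c * r) $ i"
      have g: "?g M absolutely_integrable_on {0..s}" "?g M' absolutely_integrable_on {0..s}"
        and eq: "M (\<eta> + a i * s) (\<eta> - c * s) $ i - M \<eta> \<eta> $ i = integral {0..s} (?g M)"
          "M' (\<eta> + a i * s) (\<eta> - c * s) $ i - M' \<eta> \<eta> $ i = integral {0..s} (?g M')"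
        using elim(1,3) \<eta> s by blast+
      have "(a i + c) * M \<eta> \<eta> $ i = (a i + c) * M' \<eta> \<eta> $ i" using elim(2,4) \<eta> by simp
      then have diag: "M \<eta> \<eta> $ i = M' \<eta> \<eta> $ i" using ac_pos[of i] by simp
      have "AE r in lebesgue. r \<in> {0..s} \<longrightarrow> \<bar>?g M r - ?g M' r\<bar> \<le> Bc * C * exp (k * ((a i + c) * r))"
        using elim(5)
      proof eventually_elim
        case (elim r)
        show ?case
        proof
          assume r: "r \<in> {0..s}"
          then have "c * r \<le> c * s" "a i * r \<le> a i * s" using c_pos a_pos[of i] by (auto intro: mult_left_mono)
          then have "(\<eta> + a i * r, \<eta> - c * r) \<in> Tr" using s r by (simp add: char_in_Tr)
          with elim r show "\<bar>?g M r - ?g M' r\<bar> \<le> Bc * C * exp (k * ((a i + c) * r))" by simp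
        qed
      qed
      then have "\<bar>integral {0..s} (\<lambda>r. ?g M r - ?g M' r)\<bar> \<le> integral {0..s} (\<lambda>r. Bc * C * exp (k * ((a i + c) * r)))"
        by (intro abs_integral_le_AE set_integral_diff g exp_integral_bound)
          (use Bc_nonneg C k0 ac_pos s in auto)
      also have "\<dots> \<le> Bc * C / (k * (a i + c)) * exp (k * ((a i + c) * s))"
        by (rule exp_integral_bound) (use Bc_nonneg C k0 ac_pos s in auto)
      also have "\<dots> \<le> C / 2 * exp (k * ((a i + c) * s))"
      proof (rule mult_right_mono)
        have "2 * Bc \<le> k * c" using c_pos by (simp add: k distrib_right)
        also have "\<dots> \<le> k * (a i + c)" using k0 a_pos[of i] by simp
        finally have "2 * Bc * C \<le> k * (a i + c) * C" using C by (rule mult_right_mono)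
        then show "Bc * C / (k * (a i + c)) \<le> C / 2"
          using k0 ac_pos[of i] by (simp add: pos_divide_le_eq mult_ac)
      qed simp
      also have "integral {0..s} (\<lambda>r. ?g M r - ?g M' r) = integral {0..s} (?g M) - integral {0..s} (?g M')"
        using g by (intro integral_diff) (auto simp: absolutely_integrable_on_def)
      also have "\<dots> = M (\<eta> + a i * s) (\<eta> - c * s) $ i - M' (\<eta> + a i * s) (\<eta> - c * s) $ i"
        unfolding eq[symmetric] diag by simp
      also have "(a i + c) * s = (\<eta> + a i * s) - (\<eta> - c * s)" by (simp add: algebra_simps)
      finally show "\<bar>M (\<eta> + a i * s) (\<eta> - c * s) $ i - M' (\<eta> + a i * s) (\<eta> - c * s) $ i\<bar>
          \<le> C / 2 * exp (k * ((\<eta> + a i * s) - (\<eta> - c * s)))" .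
    qed
  qed
qed

text \<open>The bound is halved infinitely often. The exceptional sets are countably many, and once
  the constant is 0 the weight is irrelevant, so \<open>k\<close> is arbitrary.\<close>

lemma ksol_close_zero:
  assumes M: "ksol M" "ksol M'"
  shows "close_kernels k 0 M M'"
  unfolding close_kernels_def
proof
  fix i
  define k' where "k' = 2 * Bc / c + 1"
  have "0 \<le> k'" using Bc_nonneg c_pos unfolding k'_def by simp
  with close_kernels_initial[OF M] obtain C where C: "0 \<le> C" "close_kernels k' C M M'" by blast
  have "close_kernels k' (C / 2 ^ m) M M'" for m
  proof (induction m)
    case (Suc m)
    from close_kernels_half[OF M k'_def _ Suc] C(1) show ?case by (simp add: mult.commute)
  qed (use C in simp)
  then have "AE \<eta> in lebesgue. \<forall>m. \<eta> \<in> {0..L} \<longrightarrow>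
     (\<forall>s\<ge>0. (\<eta> + a i * s, \<eta> - c * s) \<in> Tr \<longrightarrow>
        \<bar>M (\<eta> + a i * s) (\<eta> - c * s) $ i - M' (\<eta> + a i * s) (\<eta> - c * s) $ i\<bar>
          \<le> C / 2 ^ m * exp (k' * ((\<eta> + a i * s) - (\<eta> - c * s))))"
    unfolding AE_all_countable by (intro allI close_kernelsD)
  then show "AE \<eta> in lebesgue. \<eta> \<in> {0..L} \<longrightarrow>
     (\<forall>s\<ge>0. (\<eta> + a i * s, \<eta> - c * s) \<in> Tr \<longrightarrow>
        \<bar>M (\<eta> + a i * s) (\<eta> - c * s) $ i - M' (\<eta> + a i * s) (\<eta> - c * s) $ i\<bar>
          \<le> 0 * exp (k * ((\<eta> + a i * s) - (\<eta> - c * s))))"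
  proof eventually_elim
    case (elim \<eta>)
    show ?case
    proof (intro impI allI)
      fix s assume *: "\<eta> \<in> {0..L}" "0 \<le> s" "(\<eta> + a i * s, \<eta> - c * s) \<in> Tr"
      let ?D = "\<bar>M (\<eta> + a i * s) (\<eta> - c * s) $ i - M' (\<eta> + a i * s) (\<eta> - c * s) $ i\<bar>"
      let ?e = "C * exp (k' * ((\<eta> + a i * s) - (\<eta> - c * s)))"
      have "?D \<le> ?e * (1 / 2) ^ m" for m
        using elim * by (simp add: power_divide)
      moreover have "(\<lambda>m. ?e * (1 / 2) ^ m) \<longlonglongrightarrow> ?e * 0"
        by (intro tendsto_mult tendsto_const LIMSEQ_power_zero) simp
      ultimately have "?D \<le> ?e * 0" by (intro LIMSEQ_le_const) auto
      then show "?D \<le> 0 * exp (k * ((\<eta> + a i * s) - (\<eta> - c * s)))" by simp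
    qed
  qed
qed

text \<open>The second claim does not follow from the first, because \<xi> = 0 is a null set of the
  triangle; it uses the estimate along characteristics.\<close>

lemma ksol_unique:
  assumes M: "ksol M" "ksol M'"
  shows "AE z in lebesgue. z \<in> Tr \<longrightarrow> M (fst z) (snd z) = M' (fst z) (snd z)"
    and "AE x in lebesgue. x \<in> {0..L} \<longrightarrow> M x 0 = M' x 0 \<and> NM M x 0 = NM M' x 0"
proof -
  have Linf: "Linf_on Tr (\<lambda>(x, \<xi>). M x \<xi>)" "Linf_on Tr (\<lambda>(x, \<xi>). M' x \<xi>)"
    using M by (auto simp: ksol_def)
  note close = ksol_close_zero[OF M, of 0]
  show "AE z in lebesgue. z \<in> Tr \<longrightarrow> M (fst z) (snd z) = M' (fst z) (snd z)"
    using close_kernels_AE_Tr[OF close Linf] by eventually_elim (auto simp: vec_eq_iff)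
  have "AE x in lebesgue. x \<in> {0..L} \<longrightarrow> \<bar>M x 0 $ i - M' x 0 $ i\<bar> \<le> 0 * exp (0 * (x - 0))" for i
    by (rule AE_char_trace_bottom[where Q = "\<lambda>x \<xi>. \<bar>M x \<xi> $ i - M' x \<xi> $ i\<bar> \<le> 0 * exp (0 * (x - \<xi>))",
          OF close_kernelsD[OF close]])
  then have "AE x in lebesgue. \<forall>i. x \<in> {0..L} \<longrightarrow> \<bar>M x 0 $ i - M' x 0 $ i\<bar> \<le> 0 * exp (0 * (x - 0))"
    by (rule AE_all_finite_index)
  then show "AE x in lebesgue. x \<in> {0..L} \<longrightarrow> M x 0 = M' x 0 \<and> NM M x 0 = NM M' x 0"
    using NM_diff_bound[OF close order_refl Linf]
  proof eventually_elim
    case (elim x)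
    show ?case
    proof (intro impI conjI)
      assume x: "x \<in> {0..L}"
      show "M x 0 = M' x 0" using elim(1) x by (auto simp: vec_eq_iff)
      have "x \<in> {x..L}" using x by simp
      with elim(2) x have "\<bar>NM M x (x - x) - NM M' x (x - x)\<bar> \<le>
          (norm R + L / c * Kc) * (real CARD('n) * (0 * exp (0 * x)))" by blast
      then show "NM M x 0 = NM M' x 0" by simp
    qed
  qed
qed

end


section \<open>Error states generated by the boundary trace\<close>

lemma continuous_bounded_on_compact:
  fixes f :: "'a::topological_space \<Rightarrow> 'b::real_normed_vector"
  assumes "continuous_on UNIV f" "compact X"
  shows "\<exists>K. \<forall>x\<in>X. norm (f x) \<le> K"
proof -
  have "bounded (f ` X)"
    by (intro compact_imp_bounded compact_continuous_image continuous_on_subset[OF assms(1)] assms(2)) simp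
  then show ?thesis by (simp add: bounded_iff)
qed

lemma integrable_indicator_continuous_bounded:
  fixes g b :: "real \<Rightarrow> real"
  assumes g: "continuous_on UNIV g" and b: "b \<in> borel_measurable borel" "\<And>x. \<bar>b x\<bar> \<le> B"
  shows "integrable lborel (\<lambda>x. indicator {u..v} x * (g x * b x))"
proof -
  obtain K where K: "\<forall>x\<in>{u..v}. norm (g x) \<le> K"
    using continuous_bounded_on_compact[OF g compact_Icc] by blast
  show ?thesis
  proof (rule integrableI_bounded_set[where A = "{u..v}" and B = "K * B"])
  have [measurable]: "g \<in> borel_measurable borel" by (rule borel_measurable_continuous_onI[OF g])
  note [measurable] = b(1)
  show "(\<lambda>x. indicator {u..v} x * (g x * b x)) \<in> borel_measurable lborel" by measurable
  show "AE x in lborel. x \<in> {u..v} \<longrightarrow> norm (indicator {u..v} x * (g x * b x)) \<le> K * B"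
  proof (rule AE_I2, rule impI)
    fix x assume "x \<in> {u..v}"
    with K have "\<bar>g x\<bar> \<le> K" by auto
    moreover have "0 \<le> B" using b(2)[of x] by linarith
    ultimately have "\<bar>g x\<bar> * \<bar>b x\<bar> \<le> K * B" using b(2)[of x] by (intro mult_mono) auto
    then show "norm (indicator {u..v} x * (g x * b x)) \<le> K * B"
      by (simp add: abs_mult split: split_indicator) (meson abs_ge_zero mult_nonneg_nonneg order_trans)
  qed
  show "emeasure lborel {u..v} < \<infinity>" by (cases "u \<le> v") auto
  qed auto
qed

lemma integral_indicator_continuous:
  fixes g :: "real \<Rightarrow> real"
  assumes "continuous_on UNIV g"
  shows "(LINT x|lborel. indicator {u..v} x * g x) = integral {u..v} g"
  using set_borel_integral_eq_integral(2)[OF borel_integrable_atLeastAtMost'[OF continuous_on_subset[OF assms]], of u v]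
  by (simp add: set_lebesgue_integral_def)

lemma integrable_pair_indicator:
  fixes h :: "real \<times> real \<Rightarrow> real"
  assumes h: "continuous_on UNIV h" and b: "b \<in> borel_measurable borel" "\<And>x. \<bar>b x\<bar> \<le> B"
    and D: "D \<in> sets borel" "D \<subseteq> {l..u} \<times> {l'..u'}"
  shows "integrable (lborel \<Otimes>\<^sub>M lborel) (\<lambda>z. indicator D z * (h z * b (snd z)))"
proof -
  obtain K where K: "\<forall>z\<in>{l..u} \<times> {l'..u'}. norm (h z) \<le> K"
    using continuous_bounded_on_compact[OF h compact_Times[OF compact_Icc compact_Icc]] by blast
  show ?thesis
  proof (rule integrableI_bounded_set[where A = "{l..u} \<times> {l'..u'}" and B = "K * B"])
  have [measurable]: "h \<in> borel_measurable borel" by (rule borel_measurable_continuous_onI[OF h])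
  have "snd \<in> borel_measurable (borel :: (real \<times> real) measure)"
    by (intro borel_measurable_continuous_onI continuous_intros)
  from measurable_compose[OF this b(1)]
  have [measurable]: "(\<lambda>z. b (snd z)) \<in> borel_measurable (borel :: (real \<times> real) measure)" .
  note [measurable] = D(1)
  have "(\<lambda>z. indicator D z * (h z * b (snd z))) \<in> borel_measurable borel" by measurable
  then show "(\<lambda>z. indicator D z * (h z * b (snd z))) \<in> borel_measurable (lborel \<Otimes>\<^sub>M lborel)"
    unfolding lborel_prod by simp
  show "AE z in lborel \<Otimes>\<^sub>M lborel. z \<in> {l..u} \<times> {l'..u'} \<longrightarrow> norm (indicator D z * (h z * b (snd z))) \<le> K * B"
  proof (rule AE_I2, rule impI)
    fix z assume "z \<in> {l..u} \<times> {l'..u'}"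
    with K have "\<bar>h z\<bar> \<le> K" by auto
    moreover have "0 \<le> B" using b(2)[of 0] by linarith
    ultimately have "\<bar>h z\<bar> * \<bar>b (snd z)\<bar> \<le> K * B" using b(2)[of "snd z"] by (intro mult_mono) auto
    then show "norm (indicator D z * (h z * b (snd z))) \<le> K * B"
      by (simp add: abs_mult split: split_indicator) (meson abs_ge_zero mult_nonneg_nonneg order_trans)
  qed
  show "AE z in lborel \<Otimes>\<^sub>M lborel. z \<notin> {l..u} \<times> {l'..u'} \<longrightarrow> indicator D z * (h z * b (snd z)) = 0"
    using D(2) by (intro AE_I2) (auto split: split_indicator)
  have "{l..u} \<times> {l'..u'} \<in> sets (borel :: (real \<times> real) measure)"
    by (intro borel_closed closed_Times) auto
  then show "{l..u} \<times> {l'..u'} \<in> sets (lborel \<Otimes>\<^sub>M lborel)"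
    unfolding lborel_prod by simp
  have "bounded ({l..u} \<times> {l'..u'})" by (intro bounded_Times) auto
  then show "emeasure (lborel \<Otimes>\<^sub>M lborel) ({l..u} \<times> {l'..u'}) < \<infinity>"
    unfolding lborel_prod by (rule emeasure_bounded_finite)
  qed
qed

section \<open>Integrals of the kernels along lines\<close>

context kernel_data
begin

text \<open>With the position as variable of integration the upper limit no longer depends on
  \<open>x\<close>, so at fixed \<open>d\<close> the function \<open>Nk\<close> is an indefinite
  integral.\<close>

lemma Nk_eq_integral:
  assumes F: "continuous_on UNIV F" and "x \<le> L"
  shows "Nk F x d = R \<bullet> F (L, d) + integral {x / c..L / c} (\<lambda>r. sm (c * r) \<bullet> F (c * r, d))"
proof -
  have X: "0 \<le> (L - x) / c" using assms c_pos by simp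
  have "(L - x) / c * integral {0..1} (\<lambda>s. sm (x + s * (L - x)) \<bullet> F (x + s * (L - x), d)) =
      integral {0..(L - x) / c} (\<lambda>\<nu>. sm (c * (x / c + \<nu>)) \<bullet> F (c * (x / c + \<nu>), d))"
  proof -
    have "c * (x / c + (L - x) / c * s) = x + s * (L - x)" for s using c_pos by (simp add: field_simps)
    then show ?thesis
      using unit_interval_scale[OF X, of "\<lambda>\<nu>. sm (c * (x / c + \<nu>)) \<bullet> F (c * (x / c + \<nu>), d)"]
      by (simp only: real_scaleR_def)
  qed
  also have "\<dots> = integral {x / c..x / c + (L - x) / c} (\<lambda>r. sm (c * r) \<bullet> F (c * r, d))"
    by (rule integral_shift_from_0)
  also have "x / c + (L - x) / c = L / c" using c_pos by (simp add: field_simps)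
  finally show ?thesis by (simp add: Nk_def)
qed

lemma Nk_diff:
  assumes F: "continuous_on UNIV F" and "y \<le> x" "x \<le> L"
  shows "Nk F y d - Nk F x d = integral {y / c..x / c} (\<lambda>r. sm (c * r) \<bullet> F (c * r, d))"
proof -
  have "integral {y / c..x / c} (\<lambda>r. sm (c * r) \<bullet> F (c * r, d)) + integral {x / c..L / c} (\<lambda>r. sm (c * r) \<bullet> F (c * r, d))
    = integral {y / c..L / c} (\<lambda>r. sm (c * r) \<bullet> F (c * r, d))"
    by (rule Henstock_Kurzweil_Integration.integral_combine)
      (use assms c_pos in \<open>auto simp: divide_right_mono intro!: integrable_continuous_real continuous_intros
        coeff_cont continuous_on_compose_UNIV[OF F]\<close>)
  then show ?thesis using Nk_eq_integral[OF F] assms by simp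
qed

text \<open>The inner integral after Fubini, with \<tau> the arrival time minus the departure time.
  The points \<open>(a i * q, (a i + c) * q - c * \<tau>)\<close>, in \<open>(x, d)\<close>, form a
  kernel characteristic that leaves the diagonal at \<open>q = c * \<tau> / (a i + c)\<close>;
  integrating the source gives the kernel at \<open>r\<close> minus its diagonal value.\<close>

lemma kernel_char_integral:
  assumes F: "kernel_fixed F" and "c * \<tau> / (a i + c) \<le> r" "r \<le> \<tau>" "a i * r \<le> L"
  shows "(LINT q|lborel. indicator {c * \<tau> / (a i + c)..r} q * src F (a i * q) ((a i + c) * q - c * \<tau>) $ i) =
    F (a i * r, (a i + c) * r - c * \<tau>) $ i - sp (a i * (c * \<tau> / (a i + c))) $ i / (a i + c)"
proof -
  note p = ac_pos[of i]
  have Fc: "continuous_on UNIV F" using F by (simp add: kernel_fixed_def)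
  define \<rho> where "\<rho> = c * \<tau> / (a i + c)"
  have \<rho>: "(a i + c) * \<rho> = c * \<tau>" using p by (simp add: \<rho>_def)
  have e: "a i * \<rho> + a i * (r - \<rho>) = a i * r" "(a i + c) * (r - \<rho>) = (a i + c) * r - c * \<tau>"
    "a i * \<rho> + a i * q = a i * (\<rho> + q)" "(a i + c) * q = (a i + c) * (\<rho> + q) - c * \<tau>" for q
    using \<rho> by (simp_all add: algebra_simps)
  have "a i * \<rho> - c * (r - \<rho>) = c * (\<tau> - r)" using \<rho> by (simp add: algebra_simps)
  also have "\<dots> \<ge> 0" using assms c_pos by simp
  finally have "F (a i * r, (a i + c) * r - c * \<tau>) $ i = sp (a i * \<rho>) $ i / (a i + c) +
    integral {0..r - \<rho>} (\<lambda>q. src F (a i * (\<rho> + q)) ((a i + c) * (\<rho> + q) - c * \<tau>) $ i)"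
    using kernel_fixed_along[OF F, of "r - \<rho>" "a i * \<rho>" i] assms(2,4) unfolding \<rho>_def[symmetric] e(1-3) e(4)[symmetric]
    by simp
  also have "integral {0..r - \<rho>} (\<lambda>q. src F (a i * (\<rho> + q)) ((a i + c) * (\<rho> + q) - c * \<tau>) $ i) =
      integral {\<rho>..r} (\<lambda>q. src F (a i * q) ((a i + c) * q - c * \<tau>) $ i)"
    using integral_shift_from_0[of "r - \<rho>" "\<lambda>q. src F (a i * q) ((a i + c) * q - c * \<tau>) $ i" \<rho>] by simp
  also have "\<dots> = (LINT q|lborel. indicator {\<rho>..r} q * src F (a i * q) ((a i + c) * q - c * \<tau>) $ i)"
    by (rule integral_indicator_continuous[symmetric])
      (intro continuous_on_component src_continuous[OF Fc] continuous_intros)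
  finally show ?thesis by (simp add: \<rho>_def)
qed

end

locale boundary_driven = kernel_data L c a S sp sm R
  for L c :: real and a :: "'n::finite \<Rightarrow> real" and S :: "real \<Rightarrow> real^'n^'n"
    and sp sm :: "real \<Rightarrow> real^'n" and R :: "real^'n" +
  fixes F :: "real \<times> real \<Rightarrow> real^'n" and b :: "real \<Rightarrow> real" and B :: real
  assumes F: "kernel_fixed F" and b_meas: "b \<in> borel_measurable borel" and b_bound: "\<bar>b t\<bar> \<le> B"
begin

text \<open>The error states generated by the boundary trace \<open>b\<close> alone: they are the backstepping
  transforms of the solution \<open>b (t + x / c)\<close> of the transport equation.  The variable of integration
  is the absolute time at which the characteristic reaches \<open>x = 0\<close>.\<close>

definition eb :: "real \<Rightarrow> real \<Rightarrow> real^'n" where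
  "eb x t = (\<chi> i. c * (LINT \<sigma>|lborel. indicator {t..t + x / c} \<sigma> * (F (x, x - c * (\<sigma> - t)) $ i * b \<sigma>)))"

definition zb :: "real \<Rightarrow> real \<Rightarrow> real" where
  "zb x t = b (t + x / c) + c * (LINT \<sigma>|lborel. indicator {t..t + x / c} \<sigma> * (Nk F x (x - c * (\<sigma> - t)) * b \<sigma>))"

lemma Fc: "continuous_on UNIV F" using F by (simp add: kernel_fixed_def)

lemmas cont_intros = continuous_intros continuous_on_component src_continuous[OF Fc] Nk_continuous[OF Fc]
  continuous_on_compose_UNIV[OF Fc] coeff_cont

lemma B_nonneg: "0 \<le> B" using b_bound[of 0] by linarith

lemma integrable_cb:
  assumes "continuous_on UNIV g"
  shows "integrable lborel (\<lambda>x. indicator {u..v} x * (g x * b x))"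
  by (rule integrable_indicator_continuous_bounded[OF assms b_meas b_bound])

lemma integrable_cb_affine:
  assumes "continuous_on UNIV g"
  shows "integrable lborel (\<lambda>x. indicator {u..v} x * (g x * b (y + m * x)))"
proof (rule integrable_indicator_continuous_bounded[OF assms _ b_bound])
  note [measurable] = b_meas
  show "(\<lambda>x. b (y + m * x)) \<in> borel_measurable borel" by measurable
qed

lemma eb_inner:
  "v \<bullet> eb x t = c * (LINT \<sigma>|lborel. indicator {t..t + x / c} \<sigma> * ((v \<bullet> F (x, x - c * (\<sigma> - t))) * b \<sigma>))"
proof -
  have "v \<bullet> eb x t = (\<Sum>i\<in>UNIV. v $ i * (c * (LINT \<sigma>|lborel. indicator {t..t + x / c} \<sigma> * (F (x, x - c * (\<sigma> - t)) $ i * b \<sigma>))))"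
    by (simp add: inner_vec_def eb_def)
  also have "\<dots> = c * (\<Sum>i\<in>UNIV. (LINT \<sigma>|lborel. v $ i * (indicator {t..t + x / c} \<sigma> * (F (x, x - c * (\<sigma> - t)) $ i * b \<sigma>))))"
    by (simp only: integral_mult_right_zero) (simp add: sum_distrib_left mult.left_commute)
  also have "\<dots> = c * (LINT \<sigma>|lborel. (\<Sum>i\<in>UNIV. v $ i * (indicator {t..t + x / c} \<sigma> * (F (x, x - c * (\<sigma> - t)) $ i * b \<sigma>))))"
    by (subst Bochner_Integration.integral_sum)
      (auto intro!: integrable_mult_right integrable_cb cont_intros)
  finally show ?thesis by (simp add: inner_vec_def sum_distrib_left sum_distrib_right mult_ac)
qed

text \<open>\<open>src\<close> is linear in the kernel at fixed \<open>d\<close>, so the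
  coefficients act under the integral over arrival times; the free term of \<open>zb\<close>
  contributes the summand with \<open>sp\<close>.\<close>

lemma source_eq:
  "(S x *v eb x t + zb x t *\<^sub>R sp x) $ i = sp x $ i * b (t + x / c) +
    c * (LINT \<sigma>|lborel. indicator {t..t + x / c} \<sigma> * (src F x (x - c * (\<sigma> - t)) $ i * b \<sigma>))"
proof -
  have src: "src F x d $ i = S x $ i \<bullet> F (x, d) + sp x $ i * Nk F x d" for d
    by (simp add: src_def matrix_vector_mult_def inner_vec_def mult.commute)
  define I1 where "I1 = (LINT \<sigma>|lborel. indicator {t..t + x / c} \<sigma> * ((S x $ i \<bullet> F (x, x - c * (\<sigma> - t))) * b \<sigma>))"
  define I2 where "I2 = (LINT \<sigma>|lborel. indicator {t..t + x / c} \<sigma> * (Nk F x (x - c * (\<sigma> - t)) * b \<sigma>))"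
  have "(LINT \<sigma>|lborel. indicator {t..t + x / c} \<sigma> * (src F x (x - c * (\<sigma> - t)) $ i * b \<sigma>)) =
     (LINT \<sigma>|lborel. indicator {t..t + x / c} \<sigma> * ((S x $ i \<bullet> F (x, x - c * (\<sigma> - t))) * b \<sigma>)
       + sp x $ i * (indicator {t..t + x / c} \<sigma> * (Nk F x (x - c * (\<sigma> - t)) * b \<sigma>)))"
    unfolding src by (rule Bochner_Integration.integral_cong[OF refl]) (simp only: ring_distribs mult_ac)
  also have "\<dots> = I1 + sp x $ i * I2"
    unfolding I1_def I2_def
    by (subst Bochner_Integration.integral_add)
      (auto intro!: integrable_mult_right integrable_cb cont_intros)
  finally have I: "(LINT \<sigma>|lborel. indicator {t..t + x / c} \<sigma> * (src F x (x - c * (\<sigma> - t)) $ i * b \<sigma>)) =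
    I1 + sp x $ i * I2" .
  have "(S x *v eb x t) $ i = S x $ i \<bullet> eb x t"
    by (simp add: matrix_vector_mult_def inner_vec_def)
  also have "\<dots> = c * I1" by (simp only: eb_inner I1_def)
  finally have "(S x *v eb x t) $ i = c * I1" .
  moreover have "zb x t = b (t + x / c) + c * I2" by (simp only: zb_def I2_def)
  ultimately show ?thesis
    unfolding I by (simp add: algebra_simps)
qed

lemma parametric_integral_measurable:
  assumes h: "continuous_on UNIV h"
  shows "(\<lambda>z. LINT \<sigma>|lborel. indicator {snd z..snd z + fst z / c} \<sigma> * (h (z, \<sigma>) * b \<sigma>))
    \<in> borel_measurable (borel :: (real \<times> real) measure)"
proof (rule lborel.borel_measurable_lebesgue_integral)
  have h': "h \<in> borel_measurable borel" by (rule borel_measurable_continuous_onI[OF h])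
  have "snd \<in> borel_measurable (borel :: ((real \<times> real) \<times> real) measure)"
    by (intro borel_measurable_continuous_onI continuous_intros)
  from measurable_compose[OF this b_meas]
  have b': "(\<lambda>z. b (snd z)) \<in> borel_measurable (borel :: ((real \<times> real) \<times> real) measure)" .
  let ?D = "{w :: (real \<times> real) \<times> real. snd (fst w) \<le> snd w \<and> snd w \<le> snd (fst w) + fst (fst w) / c}"
  have "closed ?D" unfolding Collect_conj_eq
    by (intro closed_Int closed_Collect_le continuous_intros) (use c_pos in auto)
  then have D: "?D \<in> sets borel" by (rule borel_closed)
  have "(\<lambda>w. indicator ?D w * (h w * b (snd w))) \<in> borel_measurable borel"
    using D h' b' by measurable
  also have "(\<lambda>w. indicator ?D w * (h w * b (snd w))) =
    (\<lambda>(z, \<sigma>). indicator {snd z..snd z + fst z / c} \<sigma> * (h (z, \<sigma>) * b \<sigma>))"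
    by (auto simp: fun_eq_iff split: split_indicator)
  finally show "(\<lambda>(z, \<sigma>). indicator {snd z..snd z + fst z / c} \<sigma> * (h (z, \<sigma>) * b \<sigma>))
      \<in> borel_measurable (borel \<Otimes>\<^sub>M lborel)"
    by (simp add: borel_prod[symmetric] cong: measurable_cong_sets)
qed

lemma eb_measurable: "(\<lambda>z. eb (fst z) (snd z) $ i) \<in> borel_measurable borel"
proof -
  have "(\<lambda>z. LINT \<sigma>|lborel. indicator {snd z..snd z + fst z / c} \<sigma> *
      ((\<lambda>w. F (fst (fst w), fst (fst w) - c * (snd w - snd (fst w))) $ i) (z, \<sigma>) * b \<sigma>))
    \<in> borel_measurable (borel :: (real \<times> real) measure)"
    by (rule parametric_integral_measurable) (intro cont_intros)
  then show ?thesis by (simp add: eb_def)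
qed

lemma zb_measurable: "(\<lambda>z. zb (fst z) (snd z)) \<in> borel_measurable borel"
proof -
  have "(\<lambda>z. LINT \<sigma>|lborel. indicator {snd z..snd z + fst z / c} \<sigma> *
      ((\<lambda>w. Nk F (fst (fst w)) (fst (fst w) - c * (snd w - snd (fst w)))) (z, \<sigma>) * b \<sigma>))
    \<in> borel_measurable (borel :: (real \<times> real) measure)"
    by (rule parametric_integral_measurable) (intro cont_intros)
  moreover have "(\<lambda>z. snd z + fst z / c) \<in> borel_measurable (borel :: (real \<times> real) measure)"
    by (intro borel_measurable_continuous_onI continuous_intros) (use c_pos in auto)
  from measurable_compose[OF this b_meas]
  have "(\<lambda>z. b (snd z + fst z / c)) \<in> borel_measurable (borel :: (real \<times> real) measure)" .
  ultimately show ?thesis by (simp add: zb_def)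
qed

text \<open>Along \<open>(a i * r, t0 + r)\<close> the source is a double integral over
  \<open>r\<close> and the arrival time \<sigma>. For fixed \<sigma> the integral over
  \<open>r\<close> follows a kernel characteristic. Its start on the diagonal gives a term that
  cancels \<open>b (t + x / c)\<close> times \<open>sp\<close>. It ends either at \<xi> = 0, giving
  a term that cancels the output injection, or at \<open>r = s\<close>, giving the final value of
  \<open>eb\<close>.\<close>

lemma eb_char:
  assumes s: "0 \<le> s" "a i * s \<le> L"
  shows "integrable lborel (\<lambda>r. indicator {0..s} r *
    ((S (a i * r) *v eb (a i * r) (t0 + r) + zb (a i * r) (t0 + r) *\<^sub>R sp (a i * r)
      - b (t0 + r) *\<^sub>R (c *\<^sub>R F (a i * r, a i * r))) $ i))" (is ?int)
    and "eb (a i * s) (t0 + s) $ i = (LINT r|lborel. indicator {0..s} r *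
    ((S (a i * r) *v eb (a i * r) (t0 + r) + zb (a i * r) (t0 + r) *\<^sub>R sp (a i * r)
      - b (t0 + r) *\<^sub>R (c *\<^sub>R F (a i * r, a i * r))) $ i))" (is ?eq)
proof -
  note p = ac_pos[of i]
  define e where "e = t0 + s + a i * s / c"
  have e: "e = t0 + (a i + c) / c * s" using c_pos by (simp add: e_def field_simps)
  define n where "n = (\<lambda>(r, \<sigma>). src F (a i * r) ((a i + c) * r - c * (\<sigma> - t0)) $ i)"
  have nc: "continuous_on UNIV n" unfolding n_def split_beta by (intro cont_intros)
  \<comment> \<open>For fixed \<open>r\<close>, the arrival times from the present time
    \<open>t0 + r\<close> to \<open>t0 + r + a i * r / c\<close>.\<close>
  define D where "D = {z. 0 \<le> fst z \<and> fst z \<le> s \<and> t0 + fst z \<le> snd z \<and> snd z \<le> t0 + (a i + c) / c * fst z}"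
  have "closed D" unfolding D_def Collect_conj_eq
    by (intro closed_Int closed_Collect_le continuous_intros)
  then have Db: "D \<in> sets borel" by (rule borel_closed)
  have D_sub: "D \<subseteq> {0..s} \<times> {t0..e}"
  proof
    fix z assume z: "z \<in> D"
    then have "(a i + c) / c * fst z \<le> (a i + c) / c * s" using p c_pos by (intro mult_left_mono) (auto simp: D_def)
    with z show "z \<in> {0..s} \<times> {t0..e}" by (cases z) (auto simp: D_def e)
  qed
  define f where "f z = indicator D z * (n z * b (snd z))" for z
  have f_int: "integrable (lborel \<Otimes>\<^sub>M lborel) f"
    unfolding f_def by (rule integrable_pair_indicator[OF nc b_meas b_bound Db D_sub])
  then have f_int': "integrable (lborel \<Otimes>\<^sub>M lborel) (case_prod (\<lambda>r \<sigma>. f (r, \<sigma>)))" by simp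
  define G where "G r = (LINT \<sigma>|lborel. f (r, \<sigma>))" for r
  have G_int: "integrable lborel G"
    unfolding G_def using lborel_pair.integrable_fst'[OF f_int] .
  let ?T1 = "\<lambda>r. indicator {0..s} r * (sp (a i * r) $ i * b (t0 + (a i + c) / c * r))"
  let ?T3 = "\<lambda>r. indicator {0..s} r * (F (a i * r, a i * r) $ i * b (t0 + 1 * r))"
  have T_int: "integrable lborel ?T1" "integrable lborel ?T3"
    by (intro integrable_cb_affine cont_intros)+
  have rhs: "indicator {0..s} r *
    ((S (a i * r) *v eb (a i * r) (t0 + r) + zb (a i * r) (t0 + r) *\<^sub>R sp (a i * r)
      - b (t0 + r) *\<^sub>R (c *\<^sub>R F (a i * r, a i * r))) $ i) = ?T1 r + c * G r - c * ?T3 r" for r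
  proof (cases "r \<in> {0..s}")
    case True
    have t: "t0 + r + a i * r / c = t0 + (a i + c) / c * r" using c_pos by (simp add: field_simps)
    have "f (r, \<sigma>) = indicator {t0 + r..t0 + r + a i * r / c} \<sigma> *
        (src F (a i * r) (a i * r - c * (\<sigma> - (t0 + r))) $ i * b \<sigma>)" for \<sigma>
      unfolding t f_def n_def using True by (auto simp: D_def algebra_simps split: split_indicator)
    then show ?thesis
      using True source_eq[of "a i * r" "t0 + r" i] unfolding G_def t by (simp add: algebra_simps)
  next
    case False
    then have "f (r, \<sigma>) = 0" for \<sigma> by (auto simp: f_def D_def)
    with False show ?thesis by (simp add: G_def)
  qed
  have "(LINT r|lborel. indicator {0..s} r *
    ((S (a i * r) *v eb (a i * r) (t0 + r) + zb (a i * r) (t0 + r) *\<^sub>R sp (a i * r)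
      - b (t0 + r) *\<^sub>R (c *\<^sub>R F (a i * r, a i * r))) $ i)) = (LINT r|lborel. ?T1 r + c * G r - c * ?T3 r)"
    using rhs by simp
  also have "\<dots> = (LINT r|lborel. ?T1 r) + c * (LINT r|lborel. G r) - c * (LINT r|lborel. ?T3 r)"
    using T_int G_int by simp
  also have "(LINT r|lborel. G r) = (LINT \<sigma>|lborel. LINT r|lborel. f (r, \<sigma>))"
    unfolding G_def by (rule lborel_pair.Fubini_integral[OF f_int', symmetric])
  \<comment> \<open>The terms belong, in this order, to kernel characteristics that end at \<xi> =
    0, to those that end at \<open>r = s\<close>, and to the starting points of all of them on the
    diagonal.\<close>
  also have "\<dots> = (LINT \<sigma>|lborel. indicator {t0..t0 + s} \<sigma> * (F (a i * (\<sigma> - t0), a i * (\<sigma> - t0)) $ i * b \<sigma>)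
      + indicator {t0 + s..e} \<sigma> * (F (a i * s, a i * s - c * (\<sigma> - (t0 + s))) $ i * b \<sigma>)
      - indicator {t0..e} \<sigma> * (sp (a i * (c * (\<sigma> - t0) / (a i + c))) $ i / (a i + c) * b \<sigma>))"
    (is "_ = (LINT \<sigma>|lborel. ?A1 \<sigma> + ?A2 \<sigma> - ?A3 \<sigma>)")
  proof (rule integral_cong_AE)
    have A_int: "integrable lborel ?A1" "integrable lborel ?A2" "integrable lborel ?A3"
      by (rule integrable_cb, intro cont_intros; use p in simp)+
    then show "(\<lambda>\<sigma>. ?A1 \<sigma> + ?A2 \<sigma> - ?A3 \<sigma>) \<in> borel_measurable lborel" by simp
    show "(\<lambda>\<sigma>. LINT r|lborel. f (r, \<sigma>)) \<in> borel_measurable lborel"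
      using lborel_pair.integrable_snd[OF f_int'] by simp
    \<comment> \<open>At this single value the closed intervals of the first two terms overlap, so
      it would be counted twice.\<close>
    have "AE \<sigma> in lborel. \<sigma> \<noteq> t0 + s" by (rule AE_lborel_singleton)
    then show "AE \<sigma> in lborel. (LINT r|lborel. f (r, \<sigma>)) = ?A1 \<sigma> + ?A2 \<sigma> - ?A3 \<sigma>"
    proof eventually_elim
      case (elim \<sigma>)
      \<comment> \<open>The parameter at which the kernel characteristic with arrival time \<sigma>
        leaves the diagonal.\<close>
      define \<rho> where "\<rho> = c * (\<sigma> - t0) / (a i + c)"
      have inD: "(r, \<sigma>) \<in> D \<longleftrightarrow> 0 \<le> r \<and> r \<le> s \<and> r \<le> \<sigma> - t0 \<and> \<rho> \<le> r" for r
      proof -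
        have "\<sigma> \<le> t0 + (a i + c) / c * r \<longleftrightarrow> \<rho> \<le> r"
          using p c_pos by (auto simp: \<rho>_def field_simps)
        then show ?thesis by (auto simp: D_def)
      qed
      have core: "(LINT r|lborel. f (r, \<sigma>)) = b \<sigma> * (F (a i * q, (a i + c) * q - c * (\<sigma> - t0)) $ i - sp (a i * \<rho>) $ i / (a i + c))"
        if q: "\<rho> \<le> q" "q \<le> \<sigma> - t0" "a i * q \<le> L" "\<And>r. (r, \<sigma>) \<in> D \<longleftrightarrow> \<rho> \<le> r \<and> r \<le> q" for q
      proof -
        have "(LINT r|lborel. f (r, \<sigma>)) = (LINT r|lborel. b \<sigma> * (indicator {\<rho>..q} r * src F (a i * r) ((a i + c) * r - c * (\<sigma> - t0)) $ i))"
          by (rule Bochner_Integration.integral_cong) (auto simp: f_def q(4) n_def split: split_indicator)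
        then show ?thesis using kernel_char_integral[OF F q(1)[unfolded \<rho>_def] q(2,3)] by (simp add: \<rho>_def)
      qed
      consider "\<sigma> < t0" | "t0 \<le> \<sigma>" "\<sigma> < t0 + s" | "t0 + s < \<sigma>" "\<sigma> \<le> e" | "e < \<sigma>"
        using elim by linarith
      then show ?case
      proof cases
        case 1
        have "(r, \<sigma>) \<notin> D" for r using 1 inD[of r] by auto
        moreover have "0 \<le> a i * s / c" using s a_pos[of i] c_pos by simp
        ultimately show ?thesis using 1 s by (simp add: f_def e_def)
      next
        case 2
        have r0: "0 \<le> \<rho>" using 2 p c_pos by (simp add: \<rho>_def)
        have "c * (\<sigma> - t0) \<le> (a i + c) * (\<sigma> - t0)" using 2 a_pos[of i] by (intro mult_right_mono) auto
        then have "\<rho> \<le> \<sigma> - t0" using p by (simp add: \<rho>_def pos_divide_le_eq mult.commute)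
        moreover have "a i * (\<sigma> - t0) \<le> L"
          using 2 s a_pos[of i] by (intro order_trans[OF mult_left_mono[of "\<sigma> - t0" s] s(2)]) auto
        moreover have "0 \<le> a i * s / c" using s a_pos[of i] c_pos by simp
        ultimately have *: "\<rho> \<le> \<sigma> - t0" "a i * (\<sigma> - t0) \<le> L" "0 \<le> a i * s / c" by auto
        have D': "(r, \<sigma>) \<in> D \<longleftrightarrow> \<rho> \<le> r \<and> r \<le> \<sigma> - t0" for r using inD[of r] r0 2 by auto
        have arg: "(a i + c) * (\<sigma> - t0) - c * (\<sigma> - t0) = a i * (\<sigma> - t0)" by (simp add: algebra_simps)
        have "(LINT r|lborel. f (r, \<sigma>)) = b \<sigma> * (F (a i * (\<sigma> - t0), a i * (\<sigma> - t0)) $ i - sp (a i * \<rho>) $ i / (a i + c))"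
          using core[OF *(1) order_refl *(2) D'] unfolding arg .
        moreover have "\<sigma> \<in> {t0..t0 + s}" "\<sigma> \<notin> {t0 + s..e}" "\<sigma> \<in> {t0..e}"
          using 2 *(3) by (auto simp: e_def)
        ultimately show ?thesis
          unfolding \<rho>_def[symmetric] by (simp add: right_diff_distrib mult.commute)
      next
        case 3
        have "0 \<le> \<rho>" "\<rho> \<le> s" using 3 s p c_pos by (auto simp: \<rho>_def e field_simps)
        then have D': "(r, \<sigma>) \<in> D \<longleftrightarrow> \<rho> \<le> r \<and> r \<le> s" for r using inD[of r] 3 by auto
        have arg: "(a i + c) * s - c * (\<sigma> - t0) = a i * s - c * (\<sigma> - (t0 + s))" by (simp add: algebra_simps)
        have "s \<le> \<sigma> - t0" using 3 by simp
        then have "(LINT r|lborel. f (r, \<sigma>)) = b \<sigma> * (F (a i * s, a i * s - c * (\<sigma> - (t0 + s))) $ i - sp (a i * \<rho>) $ i / (a i + c))"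
          using core[OF \<open>\<rho> \<le> s\<close> _ s(2) D'] unfolding arg by simp
        moreover have "\<sigma> \<notin> {t0..t0 + s}" "\<sigma> \<in> {t0 + s..e}" "\<sigma> \<in> {t0..e}"
          using 3 s by auto
        ultimately show ?thesis
          unfolding \<rho>_def[symmetric] by (simp add: right_diff_distrib mult.commute)
      next
        case 4
        then have "s < \<rho>" using s p c_pos by (auto simp: \<rho>_def e field_simps)
        then have "(r, \<sigma>) \<notin> D" for r using inD[of r] by auto
        moreover have "0 \<le> a i * s / c" using s a_pos[of i] c_pos by simp
        ultimately show ?thesis using 4 s by (simp add: f_def e_def)
      qed
    qed
  qed
  also have "\<dots> = (LINT \<sigma>|lborel. ?A1 \<sigma>) + (LINT \<sigma>|lborel. ?A2 \<sigma>) - (LINT \<sigma>|lborel. ?A3 \<sigma>)"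
  proof -
    have A_int: "integrable lborel ?A1" "integrable lborel ?A2" "integrable lborel ?A3"
      by (rule integrable_cb, intro cont_intros; use p in simp)+
    then show ?thesis by simp
  qed
  also have "(LINT \<sigma>|lborel. ?A1 \<sigma>) = (LINT r|lborel. ?T3 r)"
    by (subst lborel_integral_real_affine[of 1 _ t0])
      (auto intro!: Bochner_Integration.integral_cong split: split_indicator)
  \<comment> \<open>The substitution \<open>\<sigma> = t0 + (a i + c) / c * r\<close> expresses the
    arrival time of the fourth state's characteristic through \<open>(a i * r, t0 + r)\<close> and
    turns the diagonal term into the one with \<open>sp\<close>.\<close>
  also have "(LINT \<sigma>|lborel. ?A3 \<sigma>) = (LINT r|lborel. ?T1 r) / c"
  proof -
    let ?m = "(a i + c) / c"
    have m: "0 < ?m" using p c_pos by simp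
    have eq: "(LINT \<sigma>|lborel. ?A3 \<sigma>) = ?m * (LINT r|lborel. ?A3 (t0 + ?m * r))"
      using lborel_integral_real_affine[OF less_imp_neq[OF m, THEN not_sym], of ?A3 t0]
      by (simp only: real_scaleR_def abs_of_pos[OF m])
    have A3: "?A3 (t0 + ?m * r) = ?T1 r / (a i + c)" for r
    proof -
      have "t0 + ?m * r \<in> {t0..e} \<longleftrightarrow> r \<in> {0..s}"
        using m by (auto simp: e zero_le_mult_iff simp del: times_divide_eq_left)
      moreover have "c * (t0 + ?m * r - t0) / (a i + c) = r" using p c_pos by simp
      ultimately show ?thesis by (simp add: indicator_def)
    qed
    note eq
    also have "(LINT r|lborel. ?A3 (t0 + ?m * r)) = (LINT r|lborel. ?T1 r) / (a i + c)"
      by (simp only: A3 integral_divide_zero)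
    also have "?m * ((LINT r|lborel. ?T1 r) / (a i + c)) = (LINT r|lborel. ?T1 r) / c"
      using p by simp
    finally show ?thesis .
  qed
  finally show ?eq using c_pos by (simp add: eb_def e_def algebra_simps)
  show ?int unfolding rhs using T_int G_int by simp
qed

text \<open>The line \<open>(c * r, t1 - r)\<close> is followed into the past, whence the minus
  sign; on it \<open>b (t + x / c)\<close> is the constant \<open>b t1\<close>. After Fubini the
  inner integral is a difference of values of \<open>Nk\<close> at one \<open>d\<close>: the lower
  limit lies at \<xi> = 0 and cancels the injection, the upper one gives \<open>zb\<close> at the
  end point.\<close>

lemma zb_char:
  assumes X: "0 \<le> X" "c * X \<le> L"
  shows "integrable lborel (\<lambda>r. indicator {0..X} r *
    (sm (c * r) \<bullet> eb (c * r) (t1 - r) - c * Nk F (c * r) (c * r) * b (t1 - r)))" (is ?int)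
    and "zb (c * X) (t1 - X) = b t1 - (LINT r|lborel. indicator {0..X} r *
    (sm (c * r) \<bullet> eb (c * r) (t1 - r) - c * Nk F (c * r) (c * r) * b (t1 - r)))" (is ?eq)
proof -
  define h where "h = (\<lambda>(r, \<sigma>). sm (c * r) \<bullet> F (c * r, c * (t1 - \<sigma>)))"
  have hc: "continuous_on UNIV h" unfolding h_def split_beta by (intro cont_intros)
  define D where "D = {z. 0 \<le> fst z \<and> fst z \<le> X \<and> t1 - fst z \<le> snd z \<and> snd z \<le> t1}"
  have "closed D" unfolding D_def Collect_conj_eq
    by (intro closed_Int closed_Collect_le continuous_intros)
  then have Db: "D \<in> sets borel" by (rule borel_closed)
  have D_sub: "D \<subseteq> {0..X} \<times> {t1 - X..t1}" by (auto simp: D_def)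
  define f where "f z = indicator D z * (h z * b (snd z))" for z
  have f_int: "integrable (lborel \<Otimes>\<^sub>M lborel) f"
    unfolding f_def by (rule integrable_pair_indicator[OF hc b_meas b_bound Db D_sub])
  then have f_int': "integrable (lborel \<Otimes>\<^sub>M lborel) (case_prod (\<lambda>r \<sigma>. f (r, \<sigma>)))" by simp
  define G where "G r = (LINT \<sigma>|lborel. f (r, \<sigma>))" for r
  have G_int: "integrable lborel G"
    unfolding G_def using lborel_pair.integrable_fst'[OF f_int] .
  let ?T = "\<lambda>r. indicator {0..X} r * (Nk F (c * r) (c * r) * b (t1 + (- 1) * r))"
  have T_int: "integrable lborel ?T" by (intro integrable_cb_affine cont_intros)
  let ?N1 = "\<lambda>\<sigma>. indicator {t1 - X..t1} \<sigma> * (Nk F (c * (t1 - \<sigma>)) (c * (t1 - \<sigma>)) * b \<sigma>)"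
  let ?N2 = "\<lambda>\<sigma>. indicator {t1 - X..t1} \<sigma> * (Nk F (c * X) (c * (t1 - \<sigma>)) * b \<sigma>)"
  have N_int: "integrable lborel ?N1" "integrable lborel ?N2" by (intro integrable_cb cont_intros)+
  have rhs: "indicator {0..X} r * (sm (c * r) \<bullet> eb (c * r) (t1 - r) - c * Nk F (c * r) (c * r) * b (t1 - r)) =
    c * G r - c * ?T r" for r
  proof (cases "r \<in> {0..X}")
    case True
    have t: "t1 - r + c * r / c = t1" "c * r - c * (\<sigma> - (t1 - r)) = c * (t1 - \<sigma>)" for \<sigma>
      using c_pos by (simp_all add: algebra_simps)
    have "f (r, \<sigma>) = indicator {t1 - r..t1} \<sigma> * ((sm (c * r) \<bullet> F (c * r, c * (t1 - \<sigma>))) * b \<sigma>)" for \<sigma>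
      unfolding f_def h_def using True by (auto simp: D_def split: split_indicator)
    then show ?thesis
      using True unfolding eb_inner t G_def by simp
  next
    case False
    then have "f (r, \<sigma>) = 0" for \<sigma> by (auto simp: f_def D_def)
    with False show ?thesis by (simp add: G_def)
  qed
  have "(LINT r|lborel. indicator {0..X} r *
    (sm (c * r) \<bullet> eb (c * r) (t1 - r) - c * Nk F (c * r) (c * r) * b (t1 - r))) =
    c * (LINT r|lborel. G r) - c * (LINT r|lborel. ?T r)"
    unfolding rhs using G_int T_int by simp
  also have "(LINT r|lborel. G r) = (LINT \<sigma>|lborel. LINT r|lborel. f (r, \<sigma>))"
    unfolding G_def by (rule lborel_pair.Fubini_integral[OF f_int', symmetric])
  also have "\<dots> = (LINT \<sigma>|lborel. ?N1 \<sigma> - ?N2 \<sigma>)"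
  proof (rule Bochner_Integration.integral_cong[OF refl])
    fix \<sigma> :: real
    show "(LINT r|lborel. f (r, \<sigma>)) = ?N1 \<sigma> - ?N2 \<sigma>"
    proof (cases "\<sigma> \<in> {t1 - X..t1}")
      case True
      have "(LINT r|lborel. f (r, \<sigma>)) = (LINT r|lborel. b \<sigma> * (indicator {t1 - \<sigma>..X} r * (sm (c * r) \<bullet> F (c * r, c * (t1 - \<sigma>)))))"
        by (rule Bochner_Integration.integral_cong) (use True in \<open>auto simp: f_def h_def D_def split: split_indicator\<close>)
      also have "\<dots> = b \<sigma> * integral {t1 - \<sigma>..X} (\<lambda>r. sm (c * r) \<bullet> F (c * r, c * (t1 - \<sigma>)))"
        by (subst integral_mult_right_zero, subst integral_indicator_continuous) (intro cont_intros, simp)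
      also have "integral {t1 - \<sigma>..X} (\<lambda>r. sm (c * r) \<bullet> F (c * r, c * (t1 - \<sigma>))) =
          Nk F (c * (t1 - \<sigma>)) (c * (t1 - \<sigma>)) - Nk F (c * X) (c * (t1 - \<sigma>))"
        using Nk_diff[OF Fc, of "c * (t1 - \<sigma>)" "c * X" "c * (t1 - \<sigma>)"] X True c_pos by simp
      finally show ?thesis using True by (simp add: right_diff_distrib mult.commute)
    next
      case False
      then have "f (r, \<sigma>) = 0" for r by (auto simp: f_def D_def)
      with False show ?thesis by simp
    qed
  qed
  also have "\<dots> = (LINT \<sigma>|lborel. ?N1 \<sigma>) - (LINT \<sigma>|lborel. ?N2 \<sigma>)" using N_int by simp
  also have "(LINT \<sigma>|lborel. ?N1 \<sigma>) = (LINT r|lborel. ?T r)"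
    by (subst lborel_integral_real_affine[of "- 1" _ t1])
      (auto intro!: Bochner_Integration.integral_cong split: split_indicator)
  finally have "(LINT r|lborel. indicator {0..X} r *
    (sm (c * r) \<bullet> eb (c * r) (t1 - r) - c * Nk F (c * r) (c * r) * b (t1 - r))) = - (c * (LINT \<sigma>|lborel. ?N2 \<sigma>))"
    by (simp add: right_diff_distrib)
  moreover have "zb (c * X) (t1 - X) = b t1 + c * (LINT \<sigma>|lborel. ?N2 \<sigma>)"
  proof -
    have t: "t1 - X + c * X / c = t1" "c * X - c * (\<sigma> - (t1 - X)) = c * (t1 - \<sigma>)" for \<sigma>
      using c_pos by (simp_all add: algebra_simps)
    show ?thesis unfolding zb_def t ..
  qed
  ultimately show ?eq by simp
  show ?int unfolding rhs using G_int T_int by simp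
qed

lemma explicit_integral_bound:
  assumes g: "continuous_on UNIV g" and x: "x \<in> {0..L}" and K: "\<And>d. d \<in> {0..L} \<Longrightarrow> \<bar>g d\<bar> \<le> K"
  shows "\<bar>LINT \<sigma>|lborel. indicator {t..t + x / c} \<sigma> * (g (x - c * (\<sigma> - t)) * b \<sigma>)\<bar> \<le> L / c * (K * B)"
proof -
  have K0: "0 \<le> K" using K[of 0] L_pos by fastforce
  have "continuous_on UNIV (\<lambda>\<sigma>. g (x - c * (\<sigma> - t)))"
    by (intro continuous_on_compose_UNIV[OF g] continuous_intros)
  note int = integrable_cb[OF this]
  have int': "integrable lborel (\<lambda>\<sigma>. indicator {t..t + x / c} \<sigma> * (K * B))"
    by (intro integrable_mult_left integrable_real_indicator) (auto simp: emeasure_lborel_Icc_eq)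
  have "\<bar>LINT \<sigma>|lborel. indicator {t..t + x / c} \<sigma> * (g (x - c * (\<sigma> - t)) * b \<sigma>)\<bar> \<le>
    (LINT \<sigma>|lborel. \<bar>indicator {t..t + x / c} \<sigma> * (g (x - c * (\<sigma> - t)) * b \<sigma>)\<bar>)"
    by (rule integral_abs_bound)
  also have "\<dots> \<le> (LINT \<sigma>|lborel. indicator {t..t + x / c} \<sigma> * (K * B))"
  proof (rule integral_mono[OF integrable_abs[OF int] int'])
    fix \<sigma> :: real
    show "\<bar>indicator {t..t + x / c} \<sigma> * (g (x - c * (\<sigma> - t)) * b \<sigma>)\<bar> \<le> indicator {t..t + x / c} \<sigma> * (K * B)"
    proof (cases "\<sigma> \<in> {t..t + x / c}")
      case True
      then have "0 \<le> c * (\<sigma> - t)" "c * (\<sigma> - t) \<le> x" using c_pos by (auto simp: field_simps)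
      then have "\<bar>g (x - c * (\<sigma> - t))\<bar> \<le> K" using x by (intro K) auto
      with True show ?thesis using b_bound[of \<sigma>] K0 by (auto simp: abs_mult intro: mult_mono)
    qed simp
  qed
  also have "\<dots> = x / c * (K * B)" using x c_pos by simp
  also have "\<dots> \<le> L / c * (K * B)"
    using x c_pos K0 B_nonneg by (intro mult_right_mono divide_right_mono) auto
  finally show ?thesis .
qed

lemma explicit_bounded:
  "\<exists>K. \<forall>x\<in>{0..L}. \<forall>t. (\<forall>i. \<bar>eb x t $ i\<bar> \<le> K) \<and> \<bar>zb x t\<bar> \<le> K"
proof -
  have sq: "compact ({0..L} \<times> {0..L})" by (intro compact_Times compact_Icc)
  obtain K1 where K1: "\<forall>z\<in>{0..L} \<times> {0..L}. norm (F z) \<le> K1"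
    using continuous_bounded_on_compact[OF Fc sq] by blast
  have "continuous_on UNIV (\<lambda>z. Nk F (fst z) (snd z))" by (intro cont_intros)
  from continuous_bounded_on_compact[OF this sq]
  obtain K2 where K2: "\<forall>z\<in>{0..L} \<times> {0..L}. norm (Nk F (fst z) (snd z)) \<le> K2" by blast
  define K where "K = B + c * (L / c * (K1 * B)) + c * (L / c * (K2 * B))"
  have "(0, 0) \<in> {0..L} \<times> {0..L}" using L_pos by auto
  then have "0 \<le> K1" "0 \<le> K2" using K1 K2 by (meson norm_ge_zero order_trans)+
  then have nn: "0 \<le> c * (L / c * (K1 * B))" "0 \<le> c * (L / c * (K2 * B))"
    using B_nonneg L_pos c_pos by auto
  have "\<bar>eb x t $ i\<bar> \<le> K" if x: "x \<in> {0..L}" for x t i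
  proof -
    have "\<bar>F (x, d) $ i\<bar> \<le> K1" if "d \<in> {0..L}" for d
      by (rule order_trans[OF component_le_norm_cart]) (use bspec[OF K1, of "(x, d)"] x that in simp)
    moreover have "continuous_on UNIV (\<lambda>d. F (x, d) $ i)" by (intro cont_intros)
    ultimately have "\<bar>LINT \<sigma>|lborel. indicator {t..t + x / c} \<sigma> * (F (x, x - c * (\<sigma> - t)) $ i * b \<sigma>)\<bar> \<le> L / c * (K1 * B)"
      using explicit_integral_bound[of "\<lambda>d. F (x, d) $ i" x K1 t] x by simp
    from mult_left_mono[OF this, of c] c_pos nn B_nonneg show ?thesis
      by (simp add: eb_def K_def abs_mult)
  qed
  moreover have "\<bar>zb x t\<bar> \<le> K" if x: "x \<in> {0..L}" for x t
  proof -
    have "\<bar>Nk F x d\<bar> \<le> K2" if "d \<in> {0..L}" for d using bspec[OF K2, of "(x, d)"] x that by simp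
    moreover have "continuous_on UNIV (Nk F x)" by (intro cont_intros)
    ultimately have "\<bar>LINT \<sigma>|lborel. indicator {t..t + x / c} \<sigma> * (Nk F x (x - c * (\<sigma> - t)) * b \<sigma>)\<bar> \<le> L / c * (K2 * B)"
      using explicit_integral_bound[of "Nk F x" x K2 t] x by simp
    from mult_left_mono[OF this, of c] c_pos nn b_bound[of "t + x / c"] show ?thesis
      unfolding zb_def K_def by (intro order_trans[OF abs_triangle_ineq]) (simp add: abs_mult)
  qed
  ultimately show ?thesis by blast
qed

end


section \<open>Uniqueness along characteristics leaving a line\<close>

text \<open>\<open>m j\<close> and \<open>e j\<close> are the speeds in \<open>x\<close> and in time
  of the characteristics of component \<open>j\<close>. All of them issue from \<open>x = 0\<close>,
  where \<open>U j\<close> vanishes by the last hypothesis with \<open>s = 0\<close>. Each round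
  halves a bound with weight \<open>exp (k * x)\<close>. It goes from almost every point of
  \<open>D\<close> to almost every characteristic (\<open>QP\<close>) and back through Borel
  versions (\<open>PQ\<close>), since bounding \<open>f j\<close> takes all components at one
  point.\<close>

lemma characteristic_uniqueness:
  fixes U f :: "'m::finite \<Rightarrow> real \<times> real \<Rightarrow> real" and m e :: "'m \<Rightarrow> real" and D :: "(real \<times> real) set"
  assumes m: "\<And>j. 0 < m j" and D: "D \<in> sets borel" and D_pos: "\<And>z. z \<in> D \<Longrightarrow> 0 \<le> fst z"
    and seg: "\<And>j y s r. (m j * s, y + e j * s) \<in> D \<Longrightarrow> 0 \<le> r \<Longrightarrow> r \<le> s \<Longrightarrow> (m j * r, y + e j * r) \<in> D"
    and ver: "\<And>j. \<exists>g C. g \<in> borel_measurable borel \<and> (\<forall>z. \<bar>g z\<bar> \<le> C) \<and> (AE z in lebesgue. z \<in> D \<longrightarrow> U j z = g z)"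
    and lip: "\<And>j z C. z \<in> D \<Longrightarrow> (\<And>j'. \<bar>U j' z\<bar> \<le> C) \<Longrightarrow> \<bar>f j z\<bar> \<le> K * C"
    and char: "\<And>j. AE y in lebesgue. \<forall>s\<ge>0. (m j * s, y + e j * s) \<in> D \<longrightarrow>
      (\<lambda>r. f j (m j * r, y + e j * r)) absolutely_integrable_on {0..s} \<and>
      U j (m j * s, y + e j * s) = integral {0..s} (\<lambda>r. f j (m j * r, y + e j * r))"
  shows "AE y in lebesgue. \<forall>s\<ge>0. (m j * s, y + e j * s) \<in> D \<longrightarrow> U j (m j * s, y + e j * s) = 0"
proof -
  obtain p where p: "\<And>j. fst (p j) \<in> borel_measurable borel \<and> (\<forall>z. \<bar>fst (p j) z\<bar> \<le> snd (p j)) \<and>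
      (AE z in lebesgue. z \<in> D \<longrightarrow> U j z = fst (p j) z)"
  proof (atomize_elim, intro choice allI)
    fix j
    obtain g C where "g \<in> borel_measurable borel \<and> (\<forall>z. \<bar>g z\<bar> \<le> C) \<and> (AE z in lebesgue. z \<in> D \<longrightarrow> U j z = g z)"
      using ver[of j] by blast
    then show "\<exists>p. fst p \<in> borel_measurable borel \<and> (\<forall>z. \<bar>fst p z\<bar> \<le> snd p) \<and>
      (AE z in lebesgue. z \<in> D \<longrightarrow> U j z = fst p z)" by (intro exI[of _ "(g, C)"]) simp
  qed
  define g where "g j = fst (p j)" for j
  have g: "\<And>j. g j \<in> borel_measurable borel" "\<And>j. AE z in lebesgue. z \<in> D \<longrightarrow> U j z = g j z"
    and gC: "\<And>j z. \<bar>g j z\<bar> \<le> snd (p j)"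
    using p by (auto simp: g_def)
  define C0 where "C0 = (\<Sum>j\<in>UNIV. \<bar>snd (p j)\<bar>)"
  have C0: "0 \<le> C0" "\<bar>g j z\<bar> \<le> C0" for j z
  proof -
    show "0 \<le> C0" by (auto simp: C0_def intro: sum_nonneg)
    have "\<bar>snd (p j)\<bar> \<le> C0" unfolding C0_def by (rule member_le_sum) auto
    then show "\<bar>g j z\<bar> \<le> C0" using gC[of j z] by linarith
  qed
  \<comment> \<open>The sum dominates every \<open>1 / m j\<close>, so
    \<open>k * m j \<ge> 2 * \<bar>K\<bar>\<close> for all components at once.\<close>
  define k where "k = 2 * \<bar>K\<bar> * (\<Sum>j\<in>UNIV. 1 / m j) + 1"
  have inv_sum: "0 \<le> (\<Sum>j\<in>UNIV. 1 / m j)" using m by (intro sum_nonneg) (simp add: less_imp_le)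
  then have k: "0 < k" by (simp add: k_def add_nonneg_pos)
  have km: "2 * \<bar>K\<bar> \<le> k * m j" for j
  proof -
    have "1 / m j \<le> (\<Sum>j\<in>UNIV. 1 / m j)" using m by (intro member_le_sum) (auto simp: less_imp_le)
    then have "1 \<le> (\<Sum>j\<in>UNIV. 1 / m j) * m j" using m[of j] by (simp add: pos_divide_le_eq)
    then have "2 * \<bar>K\<bar> * 1 \<le> 2 * \<bar>K\<bar> * ((\<Sum>j\<in>UNIV. 1 / m j) * m j)" by (intro mult_left_mono) auto
    then show ?thesis using m[of j] by (simp add: k_def algebra_simps)
  qed
  let ?P = "\<lambda>j C. AE y in lebesgue. \<forall>s\<ge>0. (m j * s, y + e j * s) \<in> D \<longrightarrow>
      \<bar>U j (m j * s, y + e j * s)\<bar> \<le> C * exp (k * (m j * s))"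
  let ?Q = "\<lambda>j C. AE z in lebesgue. z \<in> D \<longrightarrow> \<bar>U j z\<bar> \<le> C * exp (k * fst z)"
  have det: "0 * e j - m j * 1 \<noteq> 0" for j using m[of j] by simp
  have QP: "?P j (C / 2)" if Q: "\<And>j. ?Q j C" and C: "0 \<le> C" for j C
  proof -
    have "AE z in lebesgue. \<forall>j. z \<in> D \<longrightarrow> \<bar>U j z\<bar> \<le> C * exp (k * fst z)"
      by (rule AE_all_finite_index[OF Q])
    from AE_lines[OF this det[of j]] char[of j]
    show ?thesis
    proof eventually_elim
      case (elim y)
      show ?case
      proof (intro allI impI)
        fix s assume s: "0 \<le> s" "(m j * s, y + e j * s) \<in> D"
        let ?f = "\<lambda>r. f j (m j * r, y + e j * r)"
        have fi: "?f absolutely_integrable_on {0..s}" "U j (m j * s, y + e j * s) = integral {0..s} ?f"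
          using elim(2) s by blast+
        have "AE r in lebesgue. r \<in> {0..s} \<longrightarrow> \<bar>?f r\<bar> \<le> \<bar>K\<bar> * C * exp (k * (m j * r))"
          using elim(1)
        proof eventually_elim
          case (elim r)
          show ?case
          proof
            assume r: "r \<in> {0..s}"
            then have z: "(m j * r, y + e j * r) \<in> D" using seg s by auto
            then have "\<bar>?f r\<bar> \<le> K * (C * exp (k * (m j * r)))"
              using elim by (intro lip) auto
            also have "\<dots> \<le> \<bar>K\<bar> * (C * exp (k * (m j * r)))"
              using C by (intro mult_right_mono) auto
            finally show "\<bar>?f r\<bar> \<le> \<bar>K\<bar> * C * exp (k * (m j * r))" by (simp add: mult.assoc)
          qed
        qed
        then have "\<bar>integral {0..s} ?f\<bar> \<le> integral {0..s} (\<lambda>r. \<bar>K\<bar> * C * exp (k * (m j * r)))"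
          by (intro abs_integral_le_AE fi(1) exp_integral_bound) (use C k m s in auto)
        also have "\<dots> \<le> \<bar>K\<bar> * C / (k * m j) * exp (k * (m j * s))"
          by (rule exp_integral_bound) (use C k m s in auto)
        also have "\<dots> \<le> C / 2 * exp (k * (m j * s))"
        proof (rule mult_right_mono)
          have "2 * \<bar>K\<bar> * C \<le> k * m j * C" using km C by (rule mult_right_mono)
          then show "\<bar>K\<bar> * C / (k * m j) \<le> C / 2"
            using k m[of j] by (simp add: pos_divide_le_eq mult_ac)
        qed simp
        finally show "\<bar>U j (m j * s, y + e j * s)\<bar> \<le> C / 2 * exp (k * (m j * s))"
          using fi(2) by simp
      qed
    qed
  qed
  have PQ: "?Q j C" if P: "?P j C" for j C
  proof -
    have "AE y in lebesgue. AE r in lebesgue. (0 * y + m j * r, 1 * y + e j * r) \<in> D \<longrightarrow>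
      \<bar>g j (0 * y + m j * r, 1 * y + e j * r)\<bar> \<le> C * exp (k * fst (0 * y + m j * r, 1 * y + e j * r))"
      using AE_lines[OF g(2)[of j] det[of j]] P
    proof eventually_elim
      case (elim y)
      show ?case using elim(1)
      proof eventually_elim
        case (elim r)
        note el = elim
        show ?case
        proof
          assume z: "(0 * y + m j * r, 1 * y + e j * r) \<in> D"
          then have "0 \<le> r" using D_pos[OF z] m[of j] by (simp add: zero_le_mult_iff)
          with \<open>\<forall>s\<ge>0. _\<close> z have "\<bar>U j (m j * r, y + e j * r)\<bar> \<le> C * exp (k * (m j * r))" by simp
          with el z show "\<bar>g j (0 * y + m j * r, 1 * y + e j * r)\<bar> \<le> C * exp (k * fst (0 * y + m j * r, 1 * y + e j * r))"
            by simp
        qed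
      qed
    qed
    moreover have "Measurable.pred borel (\<lambda>z. z \<in> D \<longrightarrow> \<bar>g j z\<bar> \<le> C * exp (k * fst z))"
    proof -
      have "(\<lambda>z. fst z) \<in> borel_measurable (borel :: (real \<times> real) measure)"
        by (intro borel_measurable_continuous_onI continuous_intros)
      note [measurable] = this g(1)[of j] D
      show ?thesis by measurable
    qed
    ultimately have "AE z in lebesgue. z \<in> D \<longrightarrow> \<bar>g j z\<bar> \<le> C * exp (k * fst z)"
      by (intro AE_lines_converse[OF _ _ det[of j]])
    with g(2)[of j] show ?thesis by eventually_elim auto
  qed
  have Q: "?Q j (C0 / 2 ^ n)" for j n
  proof (induction n arbitrary: j)
    case 0
    show ?case using g(2)[of j]
    proof eventually_elim
      case (elim z)
      show ?case
      proof
        assume z: "z \<in> D"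
        have "C0 * 1 \<le> C0 * exp (k * fst z)" using C0(1) k D_pos[OF z] by (intro mult_left_mono) auto
        with elim z C0(2)[of j z] show "\<bar>U j z\<bar> \<le> C0 / 2 ^ 0 * exp (k * fst z)" by simp
      qed
    qed
  next
    case (Suc n)
    from PQ[OF QP[OF Suc]] C0(1) show ?case by (simp add: mult.commute)
  qed
  have "AE y in lebesgue. \<forall>n. \<forall>s\<ge>0. (m j * s, y + e j * s) \<in> D \<longrightarrow>
      \<bar>U j (m j * s, y + e j * s)\<bar> \<le> C0 / 2 ^ n / 2 * exp (k * (m j * s))"
    unfolding AE_all_countable by (intro allI QP[OF Q]) (use C0(1) in simp)
  then show ?thesis
  proof eventually_elim
    case (elim y)
    show ?case
    proof (intro allI impI)
      fix s assume s: "0 \<le> s" "(m j * s, y + e j * s) \<in> D"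
      let ?u = "\<bar>U j (m j * s, y + e j * s)\<bar>"
      let ?e = "C0 / 2 * exp (k * (m j * s))"
      have le: "?u \<le> ?e * (1 / 2) ^ n" for n
        using elim s by (simp add: power_divide mult.commute)
      have "(\<lambda>n. ?e * (1 / 2) ^ n) \<longlonglongrightarrow> ?e * 0"
        by (intro tendsto_mult tendsto_const LIMSEQ_power_zero) simp
      from LIMSEQ_le_const[OF this, of ?u] le have "?u \<le> ?e * 0" by blast
      then show "U j (m j * s, y + e j * s) = 0" by simp
    qed
  qed
qed


section \<open>The error system\<close>

lemma integral_reversed:
  fixes f :: "real \<Rightarrow> real"
  assumes "f absolutely_integrable_on {t - s..t}"
  shows "(\<lambda>r. f (t - r)) absolutely_integrable_on {0..s}"
    and "integral {0..s} (\<lambda>r. f (t - r)) = integral {t - s..t} f"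
proof -
  have hi: "((\<lambda>r. g (t - r)) has_integral I) {0..s}" if "(g has_integral I) {t - s..t}" for g :: "real \<Rightarrow> real" and I
  proof -
    have "((\<lambda>x. g (x + t)) has_integral I) {t - s - t..t - t}"
      by (rule has_integral_shift_real_ivl[OF that])
    then have "((\<lambda>x. g (x + t)) has_integral I) {- s..0}" by simp
    from iffD2[OF has_integral_reflect_real[of "\<lambda>x. g (x + t)" I 0 "- s"] this]
    show ?thesis by (simp only: minus_minus minus_zero uminus_add_conv_diff)
  qed
  have "f integrable_on {t - s..t}" "(\<lambda>r. norm (f r)) integrable_on {t - s..t}"
    using assms by (auto simp: absolutely_integrable_on_def)
  from hi[OF integrable_integral[OF this(1)]] hi[OF integrable_integral[OF this(2)]]
  show "(\<lambda>r. f (t - r)) absolutely_integrable_on {0..s}"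
    "integral {0..s} (\<lambda>r. f (t - r)) = integral {t - s..t} f"
    by (auto simp: absolutely_integrable_on_def integral_unique)
qed

text \<open>Characteristics are relabelled by the time \<open>t\<close> at which they leave
  \<open>x = 0\<close>; in the notation of \<open>transport\<close> this is
  \<open>y = - v * t\<close>.\<close>

lemma transport_from_0:
  assumes tr: "transport l v u f" and v: "0 < v"
  shows "AE t in lebesgue. 0 \<le> t \<longrightarrow> (\<forall>s\<ge>0. v * s \<le> l \<longrightarrow>
    (\<lambda>r. f (v * r) (t + r)) absolutely_integrable_on {0..s} \<and>
    u (v * s) (t + s) - u 0 t = integral {0..s} (\<lambda>r. f (v * r) (t + r)))"
proof -
  have "- v \<noteq> 0" using v by simp
  from AE_affine[OF tr[unfolded transport_def] this, of 0] show ?thesis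
  proof eventually_elim
    case (elim t)
    show ?case
    proof (intro impI allI)
      fix s assume t: "0 \<le> t" and s: "0 \<le> s" "v * s \<le> l"
      have e: "0 + - v * t + v * t = 0" "0 + - v * t + v * (t + s) = v * s"
        "0 + - v * t + v * (t + r) = v * r" for r
        by (simp_all add: algebra_simps)
      have "0 \<le> v * s" "0 \<le> l" using v s by (auto intro: order_trans[of 0 "v * s"])
      with elim[rule_format, of t "t + s"] t s
      have *: "(\<lambda>r. f (0 + - v * t + v * r) r) absolutely_integrable_on {t..t + s}"
        "u (v * s) (t + s) - u 0 t = integral {t..t + s} (\<lambda>r. f (0 + - v * t + v * r) r)"
        unfolding e by auto
      from absolutely_integrable_shift_from_0[OF *(1)] *(2) integral_shift_from_0[of s "\<lambda>r. f (0 + - v * t + v * r) r" t]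
      show "(\<lambda>r. f (v * r) (t + r)) absolutely_integrable_on {0..s} \<and>
          u (v * s) (t + s) - u 0 t = integral {0..s} (\<lambda>r. f (v * r) (t + r))"
        unfolding e by simp
    qed
  qed
qed

text \<open>The characteristic arrives at \<open>x = 0\<close> at time \<open>t\<close> and
  \<open>s\<close> counts backwards from there, so position is again increasing in the
  parameter.\<close>

lemma transport_to_0:
  assumes tr: "transport l (- v) u f" and v: "0 < v"
  shows "AE t in lebesgue. \<forall>s\<ge>0. s \<le> t \<longrightarrow> v * s \<le> l \<longrightarrow>
    (\<lambda>r. f (v * r) (t - r)) absolutely_integrable_on {0..s} \<and>
    u 0 t - u (v * s) (t - s) = integral {0..s} (\<lambda>r. f (v * r) (t - r))"
proof -
  have "v \<noteq> 0" using v by simp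
  from AE_affine[OF tr[unfolded transport_def] this, of 0] show ?thesis
  proof eventually_elim
    case (elim t)
    show ?case
    proof (intro impI allI)
      fix s assume s: "0 \<le> s" "s \<le> t" "v * s \<le> l"
      have e: "0 + v * t + - v * t = 0" "0 + v * t + - v * (t - s) = v * s"
        "0 + v * t + - v * (t - r) = v * r" for r
        by (simp_all add: algebra_simps)
      have "0 \<le> v * s" "0 \<le> l" using v s by (auto intro: order_trans[of 0 "v * s"])
      with elim[rule_format, of "t - s" t] s
      have *: "(\<lambda>r. f (0 + v * t + - v * r) r) absolutely_integrable_on {t - s..t}"
        "u 0 t - u (v * s) (t - s) = integral {t - s..t} (\<lambda>r. f (0 + v * t + - v * r) r)"
        unfolding e by auto
      from integral_reversed[OF *(1)] *(2)
      show "(\<lambda>r. f (v * r) (t - r)) absolutely_integrable_on {0..s} \<and>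
          u 0 t - u (v * s) (t - s) = integral {0..s} (\<lambda>r. f (v * r) (t - r))"
        unfolding e by simp
    qed
  qed
qed

lemma AE_lebesgue_exists_small:
  assumes "AE x in lebesgue. P (x::real)" "0 < \<epsilon>"
  shows "\<exists>x. 0 < x \<and> x < \<epsilon> \<and> P x"
proof (rule ccontr)
  assume "\<not> ?thesis"
  then have "{0<..<\<epsilon>} \<subseteq> {x. \<not> P x}" by auto
  with assms(1) have "negligible {0<..<\<epsilon>}"
    unfolding AE_lebesgue_iff_negligible by (rule negligible_subset)
  moreover have "{0<..<\<epsilon>} \<noteq> {}" using assms(2) by simp
  ultimately show False using open_not_negligible[of "{0<..<\<epsilon>}"] by simp
qed

text \<open>An \<open>L\<^sup>\<infinity>\<close> function has no trace on a line, but it is continuous along almost every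
  characteristic: its values on a suitable sequence of lines converge to the trace.\<close>

lemma transport_trace_borel:
  assumes tr: "transport l (- v) u f" and v: "0 < v" and l: "0 < l" and T: "0 < T"
    and Linf: "Linf_on ({0..l} \<times> {0..T}) (\<lambda>(x, t). u x t)"
  shows "\<exists>b B. b \<in> borel_measurable borel \<and> (\<forall>t. \<bar>b t\<bar> \<le> B) \<and>
    (AE t in lebesgue. t \<in> {0..T} \<longrightarrow> u 0 t = b t)"
proof -
  have strip: "{0..l} \<times> {0..T} \<in> sets lebesgue"
    by (intro lmeasurable_compact[THEN fmeasurableD] compact_Times compact_Icc)
  obtain g C where gC: "g \<in> borel_measurable borel \<and> 0 \<le> C \<and> (\<forall>z. \<bar>g z\<bar> \<le> C) \<and>
    (AE z in lebesgue. z \<in> {0..l} \<times> {0..T} \<longrightarrow> (case z of (x, t) \<Rightarrow> u x t) = g z)"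
    using Linf_on_borel_version[OF Linf strip] by blast
  then have g: "g \<in> borel_measurable borel" "0 \<le> C" "\<And>z. \<bar>g z\<bar> \<le> C"
    and eq: "AE z in lebesgue. z \<in> {0..l} \<times> {0..T} \<longrightarrow> (case z of (x, t) \<Rightarrow> u x t) = g z"
    by auto
  let ?P = "\<lambda>h. AE t in lebesgue. (v * h, t - h) \<in> {0..l} \<times> {0..T} \<longrightarrow> u (v * h) (t - h) = g (v * h, t - h)"
  have "v * 1 - 0 * (- 1) \<noteq> 0" using v by simp
  from AE_lines[OF eq this] have P: "AE h in lebesgue. ?P h" by simp
  \<comment> \<open>On almost every parallel line \<open>x = v * h\<close> the function agrees
    almost everywhere with its Borel version; lines with this property are chosen arbitrarily close
    to \<open>x = 0\<close>.\<close>
  have "\<exists>h. 0 < h \<and> h < 1 / real (Suc n) \<and> ?P h" for n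
    by (rule AE_lebesgue_exists_small[OF P]) simp
  then obtain h where hP: "\<And>n. 0 < h n \<and> h n < 1 / real (Suc n) \<and> ?P (h n)"
    by (atomize_elim) (intro choice allI)
  have h: "0 < h n" "h n < 1 / real (Suc n)" "?P (h n)" for n
    using hP[of n] by blast+
  have h0: "h \<longlonglongrightarrow> 0"
    by (rule tendsto_sandwich[OF _ _ tendsto_const LIMSEQ_inverse_real_of_nat])
      (use h in \<open>auto simp: less_imp_le inverse_eq_divide intro!: always_eventually\<close>)
  \<comment> \<open>Where the sequence diverges \<open>lim\<close> is unspecified; the truncation
    keeps \<open>b\<close> bounded there too.\<close>
  define b where "b t = max (- C) (min C (lim (\<lambda>n. g (v * h n, t - h n))))" for t
  have "b \<in> borel_measurable borel"
  proof -
    have "(\<lambda>t. g (v * h n, t - h n)) \<in> borel_measurable borel" for n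
      by (rule measurable_compose[OF _ g(1)]) (intro borel_measurable_continuous_onI continuous_intros)
    then have [measurable]: "(\<lambda>t. lim (\<lambda>n. g (v * h n, t - h n))) \<in> borel_measurable borel"
      by (rule borel_measurable_lim_metric)
    show ?thesis unfolding b_def by measurable
  qed
  moreover have "\<bar>b t\<bar> \<le> C" for t using g(2) by (auto simp: b_def)
  moreover have "AE t in lebesgue. \<forall>n. (v * h n, t - h n) \<in> {0..l} \<times> {0..T} \<longrightarrow> u (v * h n) (t - h n) = g (v * h n, t - h n)"
    unfolding AE_all_countable using h(3) by blast
  then have "AE t in lebesgue. t \<in> {0..T} \<longrightarrow> u 0 t = b t"
    using transport_to_0[OF tr v] AE_lebesgue_neq[of 0]
  proof eventually_elim
    case (elim t)
    show ?case
    proof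
      assume t: "t \<in> {0..T}"
      define s where "s = min t (l / v)"
      have s: "0 < s" "s \<le> t" "v * s \<le> l"
      proof -
        show "0 < s" "s \<le> t" using t elim(3) l v by (auto simp: s_def)
        have "s \<le> l / v" by (simp add: s_def)
        then show "v * s \<le> l" using v by (simp add: pos_le_divide_eq mult.commute)
      qed
      define k where "k r = f (v * r) (t - r)" for r
      have k: "k absolutely_integrable_on {0..s}" using elim(2) s unfolding k_def by (simp add: less_imp_le)
      have val: "u (v * r) (t - r) = u 0 t - integral {0..r} k" if "r \<in> {0..s}" for r
      proof -
        have "v * r \<le> v * s" using that v by (intro mult_left_mono) auto
        then have "u 0 t - u (v * r) (t - r) = integral {0..r} k"
          using elim(2) that s unfolding k_def by auto
        then show ?thesis by simp
      qed
      have "continuous_on {0..s} (\<lambda>r. integral {0..r} k)"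
        using k by (intro indefinite_integral_continuous_1) (simp add: absolutely_integrable_on_def)
      then have "((\<lambda>r. integral {0..r} k) \<longlongrightarrow> integral {0..0} k) (at 0 within {0..s})"
        unfolding continuous_on_def by (rule bspec) (use s in simp)
      then have "((\<lambda>r. integral {0..r} k) \<longlongrightarrow> 0) (at 0 within {0..s})" by simp
      moreover have ev: "\<forall>\<^sub>F n in sequentially. h n \<in> {0..s}"
        using order_tendstoD(2)[OF h0 s(1)] by eventually_elim (use h(1) in \<open>auto simp: less_imp_le\<close>)
      then have "filterlim h (at 0 within {0..s}) sequentially"
        unfolding filterlim_at using h0 h(1) by (auto simp: less_imp_neq[symmetric] elim: eventually_mono)
      ultimately have "(\<lambda>n. integral {0..h n} k) \<longlonglongrightarrow> 0" by (rule filterlim_compose)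
      from tendsto_diff[OF tendsto_const this, of "u 0 t"]
      have "(\<lambda>n. u 0 t - integral {0..h n} k) \<longlonglongrightarrow> u 0 t" by simp
      moreover have "\<forall>\<^sub>F n in sequentially. u 0 t - integral {0..h n} k = g (v * h n, t - h n)"
        using ev
      proof eventually_elim
        case (elim n)
        have "v * h n \<le> v * s" using elim v by (intro mult_left_mono) auto
        from order_trans[OF this s(3)] have "(v * h n, t - h n) \<in> {0..l} \<times> {0..T}" using elim s t v by auto
        with \<open>\<forall>n. (v * h n, t - h n) \<in> _ \<longrightarrow> _\<close> val[OF elim] show ?case by auto
      qed
      ultimately have lim: "(\<lambda>n. g (v * h n, t - h n)) \<longlonglongrightarrow> u 0 t" by (rule Lim_transform_eventually)
      then have "\<bar>u 0 t\<bar> \<le> C"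
        using LIMSEQ_le_const2[OF tendsto_rabs[OF lim]] g(3) by blast
      then show "u 0 t = b t" using limI[OF lim] by (auto simp: b_def)
    qed
  qed
  ultimately show ?thesis by blast
qed


text \<open>\<open>v\<close> is a lower bound for the speeds \<open>a\<close>. The gains are tied to
  the continuous kernel only almost everywhere, which is the sense in which kernels are unique;
  \<open>F (x, x)\<close> is the kernel at \<xi> = 0, where the distance from the diagonal is
  \<open>x\<close>.\<close>

locale error_system = kernel_data L c a S sp sm R
  for L c :: real and a :: "'n::finite \<Rightarrow> real" and S :: "real \<Rightarrow> real^'n^'n"
    and sp sm :: "real \<Rightarrow> real^'n" and R :: "real^'n" +
  fixes F :: "real \<times> real \<Rightarrow> real^'n" and v :: real
    and u :: "real \<Rightarrow> real \<Rightarrow> real^'n" and z :: "real \<Rightarrow> real \<Rightarrow> real"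
    and Pp :: "real \<Rightarrow> real^'n" and Pm :: "real \<Rightarrow> real"
  assumes kernel: "kernel_fixed F" and v_pos: "0 < v" and v_le: "v \<le> a i"
    and tu: "transport L (a i) (\<lambda>x t. u x t $ i) (\<lambda>x t. (S x *v u x t + z x t *\<^sub>R sp x - z 0 t *\<^sub>R Pp x) $ i)"
    and tz: "transport L (- c) z (\<lambda>x t. sm x \<bullet> u x t - Pm x * z 0 t)"
    and Linf_u: "0 < T \<Longrightarrow> Linf_on ({0..L} \<times> {0..T}) (\<lambda>(x, t). u x t)"
    and Linf_z: "0 < T \<Longrightarrow> Linf_on ({0..L} \<times> {0..T}) (\<lambda>(x, t). z x t)"
    and u_0: "AE t in lebesgue. 0 \<le> t \<longrightarrow> u 0 t = 0"
    and z_L: "AE t in lebesgue. 0 \<le> t \<longrightarrow> z L t = R \<bullet> u L t"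
    and gains: "AE x in lebesgue. x \<in> {0..L} \<longrightarrow> Pp x = c *\<^sub>R F (x, x) \<and> Pm x = c * Nk F x x"

text \<open>The states are bounded only on bounded time intervals, so the trace is represented by a
  bounded Borel function up to a horizon \<open>T\<close>.\<close>

locale traced_error_system = error_system L c a S sp sm R F v u z Pp Pm + boundary_driven L c a S sp sm R F b B
  for L c :: real and a :: "'n::finite \<Rightarrow> real" and S :: "real \<Rightarrow> real^'n^'n"
    and sp sm :: "real \<Rightarrow> real^'n" and R :: "real^'n"
    and F :: "real \<times> real \<Rightarrow> real^'n" and v :: real
    and u :: "real \<Rightarrow> real \<Rightarrow> real^'n" and z :: "real \<Rightarrow> real \<Rightarrow> real"
    and Pp :: "real \<Rightarrow> real^'n" and Pm :: "real \<Rightarrow> real" and b :: "real \<Rightarrow> real" and B :: real +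
  fixes T :: real
  assumes T_pos: "0 < T" and trace: "AE t in lebesgue. t \<in> {0..T} \<longrightarrow> z 0 t = b t"
begin

text \<open>The points whose characteristics, followed to \<open>x = 0\<close>, stay in the domain and within the times
  on which the trace is known.\<close>
definition DT :: "(real \<times> real) set" where
  "DT = {w. 0 \<le> fst w \<and> fst w \<le> L \<and> fst w / v \<le> snd w \<and> snd w \<le> T - fst w / c}"

lemma DT_borel: "DT \<in> sets borel"
proof -
  have "closed DT" unfolding DT_def Collect_conj_eq
    by (intro closed_Int closed_Collect_le continuous_intros) (use c_pos v_pos in auto)
  then show ?thesis by (rule borel_closed)
qed

lemma DT_strip: "w \<in> DT \<Longrightarrow> w \<in> {0..L} \<times> {0..T}"
proof -
  assume w: "w \<in> DT"
  then have "0 \<le> fst w / v" "0 \<le> fst w / c" using c_pos v_pos by (auto simp: DT_def)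
  with w show ?thesis by (cases w) (auto simp: DT_def)
qed

text \<open>Towards \<open>x = 0\<close> the quantity \<open>t - x / v\<close> does not decrease,
  because \<open>v \<le> a i\<close>, and \<open>t + x / c\<close> does not increase; hence both
  time constraints persist.\<close>

lemma DT_segment_u:
  assumes "(a i * s, t + s) \<in> DT" "0 \<le> r" "r \<le> s"
  shows "(a i * r, t + r) \<in> DT" "0 \<le> t"
proof -
  have ar: "0 \<le> a i * r" "a i * r \<le> a i * s" using assms a_pos[of i] by (auto intro: mult_left_mono)
  have av: "0 \<le> a i / v - 1" using v_le[of i] v_pos by simp
  have sv: "(a i / v - 1) * s \<le> t" using assms(1) by (simp add: DT_def algebra_simps)
  moreover have "0 \<le> (a i / v - 1) * r" "(a i / v - 1) * r \<le> (a i / v - 1) * s"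
    using av assms(2,3) by (auto intro: mult_left_mono)
  ultimately have rv: "(a i / v - 1) * r \<le> t" and "0 \<le> t" by linarith+
  then show "0 \<le> t" by simp
  have "a i * r / c \<le> a i * s / c" using ar c_pos by (simp add: divide_right_mono)
  then show "(a i * r, t + r) \<in> DT" using assms ar rv by (simp add: DT_def algebra_simps)
qed

lemma DT_segment_z:
  assumes "(c * s, t - s) \<in> DT" "0 \<le> r" "r \<le> s"
  shows "(c * r, t - r) \<in> DT" "s \<le> t" "t \<le> T"
proof -
  have cr: "0 \<le> c * r" "c * r \<le> c * s" using assms c_pos by (auto intro: mult_left_mono)
  moreover have "c * s \<le> L" using assms(1) by (simp add: DT_def)
  moreover from cr(2) this have "c * r \<le> L" by (rule order_trans)
  ultimately have "c * r \<le> L" "c * r / v \<le> c * s / v" "0 \<le> c * s / v"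
    using v_pos by (simp_all add: divide_right_mono)
  then show "(c * r, t - r) \<in> DT" "s \<le> t" "t \<le> T" using assms cr c_pos by (auto simp: DT_def)
qed

text \<open>\<open>None\<close> labels the fourth state, so that all components share the one index
  type used in \<open>characteristic_uniqueness\<close>.\<close>

definition Ud :: "'n option \<Rightarrow> real \<times> real \<Rightarrow> real" where
  "Ud j w = (case j of None \<Rightarrow> z (fst w) (snd w) - zb (fst w) (snd w)
     | Some i \<Rightarrow> (u (fst w) (snd w) - eb (fst w) (snd w)) $ i)"

text \<open>The minus sign for \<open>None\<close> appears because the characteristics of the fourth
  state are followed from \<open>x = 0\<close> into the past.\<close>

definition fd :: "'n option \<Rightarrow> real \<times> real \<Rightarrow> real" where
  "fd j w = (case j of None \<Rightarrow> - (sm (fst w) \<bullet> (u (fst w) (snd w) - eb (fst w) (snd w)))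
     | Some i \<Rightarrow> (S (fst w) *v (u (fst w) (snd w) - eb (fst w) (snd w)) +
         (z (fst w) (snd w) - zb (fst w) (snd w)) *\<^sub>R sp (fst w)) $ i)"

lemma strip_lebesgue: "{0..L} \<times> {0..T} \<in> sets lebesgue"
  by (intro lmeasurable_compact[THEN fmeasurableD] compact_Times compact_Icc)

lemma Ud_version:
  "\<exists>g C. g \<in> borel_measurable borel \<and> (\<forall>w. \<bar>g w\<bar> \<le> C) \<and> (AE w in lebesgue. w \<in> DT \<longrightarrow> Ud j w = g w)"
proof -
  obtain K where K: "\<forall>x\<in>{0..L}. \<forall>t. (\<forall>i. \<bar>eb x t $ i\<bar> \<le> K) \<and> \<bar>zb x t\<bar> \<le> K"
    using explicit_bounded by blast
  have *: "\<exists>g C. g \<in> borel_measurable borel \<and> (\<forall>w. \<bar>g w\<bar> \<le> C) \<and> (AE w in lebesgue. w \<in> DT \<longrightarrow> y w - y' w = g w)"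
    if Linf: "Linf_on ({0..L} \<times> {0..T}) y" and y': "y' \<in> borel_measurable borel"
      and bd: "\<And>w. w \<in> DT \<Longrightarrow> \<bar>y' w\<bar> \<le> K" for y y' :: "real \<times> real \<Rightarrow> real"
  proof -
    obtain g C where g: "g \<in> borel_measurable borel \<and> 0 \<le> C \<and> (\<forall>w. \<bar>g w\<bar> \<le> C) \<and>
        (AE w in lebesgue. w \<in> {0..L} \<times> {0..T} \<longrightarrow> y w = g w)"
      using Linf_on_borel_version[OF Linf strip_lebesgue] by blast
    define h where "h w = indicator DT w * (g w - y' w)" for w
    have g': "g \<in> borel_measurable borel" using g by blast
    have "h \<in> borel_measurable borel"
      unfolding h_def by (intro borel_measurable_times borel_measurable_diff borel_measurable_indicator g' y' DT_borel)
    moreover have "\<bar>h w\<bar> \<le> C + \<bar>K\<bar>" for w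
    proof (cases "w \<in> DT")
      case True
      have "\<bar>g w\<bar> \<le> C" using g by blast
      with bd[OF True] True show ?thesis by (simp add: h_def)
    next
      case False
      have "0 \<le> C" using g by blast
      with False show ?thesis by (simp add: h_def)
    qed
    moreover have "AE w in lebesgue. w \<in> {0..L} \<times> {0..T} \<longrightarrow> y w = g w" using g by blast
    then have "AE w in lebesgue. w \<in> DT \<longrightarrow> y w - y' w = h w"
    proof eventually_elim
      case (elim w)
      then show ?case using DT_strip[of w] by (simp add: h_def)
    qed
    ultimately show ?thesis by blast
  qed
  show ?thesis
  proof (cases j)
    case None
    show ?thesis
      using *[OF Linf_z[OF T_pos], of "\<lambda>w. zb (fst w) (snd w)"] zb_measurable K DT_strip None
      by (simp add: Ud_def split_beta mem_Times_iff)
  next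
    case (Some i)
    show ?thesis
      using *[OF Linf_on_component[OF Linf_u[OF T_pos], of i], of "\<lambda>w. eb (fst w) (snd w) $ i"]
        eb_measurable K DT_strip Some
      by (simp add: Ud_def split_beta mem_Times_iff)
  qed
qed

lemma fd_bound:
  assumes w: "w \<in> DT" and C: "\<And>j. \<bar>Ud j w\<bar> \<le> C"
  shows "\<bar>fd j w\<bar> \<le> (Kc * (real CARD('n) + 1)) * C"
proof -
  let ?d = "u (fst w) (snd w) - eb (fst w) (snd w)"
  let ?q = "z (fst w) (snd w) - zb (fst w) (snd w)"
  have x: "fst w \<in> {0..L}" using w by (simp add: DT_def)
  have q: "\<bar>?q\<bar> \<le> C" using C[of None] by (simp add: Ud_def)
  have C0: "0 \<le> C" using q by linarith
  have d: "norm ?d \<le> real CARD('n) * C"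
    by (rule norm_le_card_bound) (use C[of "Some i" for i] in \<open>simp add: Ud_def\<close>)
  show ?thesis
  proof (cases j)
    case None
    have "\<bar>sm (fst w) \<bullet> ?d\<bar> \<le> norm (sm (fst w)) * norm ?d" by (rule Cauchy_Schwarz_ineq2)
    also have "\<dots> \<le> Kc * (real CARD('n) * C)" using d Kc(1) Kc(4)[OF x] by (intro mult_mono) auto
    also have "\<dots> \<le> (Kc * (real CARD('n) + 1)) * C" using Kc(1) C0 by (simp add: algebra_simps)
    finally show ?thesis by (simp add: None fd_def)
  next
    case (Some i)
    have "\<bar>fd j w\<bar> \<le> norm (S (fst w) *v ?d + ?q *\<^sub>R sp (fst w))"
      unfolding fd_def Some option.case by (rule component_le_norm_cart)
    also have "\<dots> \<le> Kc * (real CARD('n) * C) + C * Kc"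
    proof (rule norm_triangle_mono)
      show "norm (S (fst w) *v ?d) \<le> Kc * (real CARD('n) * C)"
        by (rule order_trans[OF Kc(2)[OF x] mult_left_mono[OF d Kc(1)]])
      show "norm (?q *\<^sub>R sp (fst w)) \<le> C * Kc"
        unfolding norm_scaleR using q Kc(3)[OF x] C0 by (intro mult_mono) auto
    qed
    finally show ?thesis by (simp add: algebra_simps)
  qed
qed

lemma lborel_integral_to_interval:
  fixes g :: "real \<Rightarrow> real"
  assumes "integrable lborel (\<lambda>r. indicator {p..q} r * g r)"
  shows "g absolutely_integrable_on {p..q}" "(LINT r|lborel. indicator {p..q} r * g r) = integral {p..q} g"
proof -
  have s: "set_integrable lborel {p..q} g" using assms by (simp add: set_integrable_def)
  then show "(LINT r|lborel. indicator {p..q} r * g r) = integral {p..q} g"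
    using set_borel_integral_eq_integral(2)[OF s] by (simp add: set_lebesgue_integral_def)
  show "g absolutely_integrable_on {p..q}"
    using assms by (simp add: set_integrable_def integrable_completion)
qed

text \<open>On \<open>DT\<close> the true and the explicit states have the same trace
  \<open>b\<close> and almost everywhere the same gain, so the injection terms cancel and the
  difference solves a homogeneous system with zero data at \<open>x = 0\<close>.\<close>

lemma Ud_char_u:
  "AE t in lebesgue. \<forall>s\<ge>0. (a i * s, t + s) \<in> DT \<longrightarrow>
    (\<lambda>r. fd (Some i) (a i * r, t + r)) absolutely_integrable_on {0..s} \<and>
    Ud (Some i) (a i * s, t + s) = integral {0..s} (\<lambda>r. fd (Some i) (a i * r, t + r))"
proof -
  have Pae: "AE r in lebesgue. 0 + a i * r \<in> {0..L} \<longrightarrow> Pp (0 + a i * r) = c *\<^sub>R F (0 + a i * r, 0 + a i * r)"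
    by (rule AE_affine[where P = "\<lambda>x. x \<in> {0..L} \<longrightarrow> Pp x = c *\<^sub>R F (x, x)"])
      (use gains a_pos[of i] in auto)
  show ?thesis
    using transport_from_0[OF tu[of i] a_pos[of i]] u_0
  proof eventually_elim
    case (elim t)
    show ?case
    proof (intro allI impI)
      fix s assume s: "0 \<le> s" "(a i * s, t + s) \<in> DT"
      let ?g = "\<lambda>r. (S (a i * r) *v u (a i * r) (t + r) + z (a i * r) (t + r) *\<^sub>R sp (a i * r) - z 0 (t + r) *\<^sub>R Pp (a i * r)) $ i"
      let ?h = "\<lambda>r. (S (a i * r) *v eb (a i * r) (t + r) + zb (a i * r) (t + r) *\<^sub>R sp (a i * r)
          - b (t + r) *\<^sub>R (c *\<^sub>R F (a i * r, a i * r))) $ i"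
      have t: "0 \<le> t" using DT_segment_u(2)[OF s(2)] s(1) by simp
      have sL: "a i * s \<le> L" using s by (simp add: DT_def)
      have g: "?g absolutely_integrable_on {0..s}" "u (a i * s) (t + s) $ i = integral {0..s} ?g"
        using elim t s(1) sL by auto
      note lb = lborel_integral_to_interval[OF eb_char(1)[OF s(1) sL]]
      have h: "?h absolutely_integrable_on {0..s}" "eb (a i * s) (t + s) $ i = integral {0..s} ?h"
        using lb eb_char(2)[OF s(1) sL] by simp_all
      have "AE r in lebesgue. t + 1 * r \<in> {0..T} \<longrightarrow> z 0 (t + 1 * r) = b (t + 1 * r)"
        by (rule AE_affine[OF trace]) simp
      with Pae have ae: "AE r in lebesgue. r \<in> {0..s} \<longrightarrow> fd (Some i) (a i * r, t + r) = ?g r - ?h r"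
      proof eventually_elim
        case (elim r)
        show ?case
        proof
          assume r: "r \<in> {0..s}"
          then have "(a i * r, t + r) \<in> DT" using DT_segment_u(1)[OF s(2)] by simp
          from DT_strip[OF this] have "Pp (a i * r) = c *\<^sub>R F (a i * r, a i * r)" "z 0 (t + r) = b (t + r)"
            using elim by auto
          then show "fd (Some i) (a i * r, t + r) = ?g r - ?h r"
            by (simp add: fd_def matrix_vector_mult_diff_distrib algebra_simps)
        qed
      qed
      have "(\<lambda>r. ?g r - ?h r) absolutely_integrable_on {0..s}" by (rule set_integral_diff(1)[OF g(1) h(1)])
      moreover have "integral {0..s} (\<lambda>r. ?g r - ?h r) = integral {0..s} ?g - integral {0..s} ?h"
        using g(1) h(1) by (intro integral_diff) (auto simp: absolutely_integrable_on_def)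
      ultimately show "(\<lambda>r. fd (Some i) (a i * r, t + r)) absolutely_integrable_on {0..s} \<and>
        Ud (Some i) (a i * s, t + s) = integral {0..s} (\<lambda>r. fd (Some i) (a i * r, t + r))"
        using AE_integral_cong[OF ae] g(2) h(2) by (simp add: Ud_def)
    qed
  qed
qed

lemma Ud_char_z:
  "AE t in lebesgue. \<forall>s\<ge>0. (c * s, t - s) \<in> DT \<longrightarrow>
    (\<lambda>r. fd None (c * r, t - r)) absolutely_integrable_on {0..s} \<and>
    Ud None (c * s, t - s) = integral {0..s} (\<lambda>r. fd None (c * r, t - r))"
proof -
  have Pae: "AE r in lebesgue. 0 + c * r \<in> {0..L} \<longrightarrow> Pm (0 + c * r) = c * Nk F (0 + c * r) (0 + c * r)"
    by (rule AE_affine[where P = "\<lambda>x. x \<in> {0..L} \<longrightarrow> Pm x = c * Nk F x x"])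
      (use gains c_pos in auto)
  show ?thesis
    using transport_to_0[OF tz c_pos] trace
  proof eventually_elim
    case (elim t)
    show ?case
    proof (intro allI impI)
      fix s assume s: "0 \<le> s" "(c * s, t - s) \<in> DT"
      let ?g = "\<lambda>r. sm (c * r) \<bullet> u (c * r) (t - r) - Pm (c * r) * z 0 (t - r)"
      let ?h = "\<lambda>r. sm (c * r) \<bullet> eb (c * r) (t - r) - c * Nk F (c * r) (c * r) * b (t - r)"
      have t: "s \<le> t" "t \<le> T" using DT_segment_z(2,3)[OF s(2) order_refl] s(1)
        DT_segment_z(2,3)[OF s(2) s(1) order_refl] by auto
      have sL: "c * s \<le> L" using s by (simp add: DT_def)
      have "z 0 t = b t" using elim(2) t s(1) by simp
      then have g: "?g absolutely_integrable_on {0..s}" "b t - z (c * s) (t - s) = integral {0..s} ?g"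
        using elim(1) t s(1) sL by auto
      note lb = lborel_integral_to_interval[OF zb_char(1)[OF s(1) sL]]
      have h: "?h absolutely_integrable_on {0..s}" "b t - zb (c * s) (t - s) = integral {0..s} ?h"
        using lb zb_char(2)[OF s(1) sL] by simp_all
      have "AE r in lebesgue. t + (- 1) * r \<in> {0..T} \<longrightarrow> z 0 (t + (- 1) * r) = b (t + (- 1) * r)"
        by (rule AE_affine[OF trace]) simp
      with Pae have ae: "AE r in lebesgue. r \<in> {0..s} \<longrightarrow> fd None (c * r, t - r) = ?h r - ?g r"
      proof eventually_elim
        case (elim r)
        show ?case
        proof
          assume r: "r \<in> {0..s}"
          then have "(c * r, t - r) \<in> DT" using DT_segment_z(1)[OF s(2)] by simp
          from DT_strip[OF this] have "Pm (c * r) = c * Nk F (c * r) (c * r)" "z 0 (t - r) = b (t - r)"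
            using elim by auto
          then show "fd None (c * r, t - r) = ?h r - ?g r"
            by (simp add: fd_def inner_diff_right)
        qed
      qed
      have "(\<lambda>r. ?h r - ?g r) absolutely_integrable_on {0..s}" by (rule set_integral_diff(1)[OF h(1) g(1)])
      moreover have "integral {0..s} (\<lambda>r. ?h r - ?g r) = integral {0..s} ?h - integral {0..s} ?g"
        using g(1) h(1) by (intro integral_diff) (auto simp: absolutely_integrable_on_def)
      ultimately show "(\<lambda>r. fd None (c * r, t - r)) absolutely_integrable_on {0..s} \<and>
        Ud None (c * s, t - s) = integral {0..s} (\<lambda>r. fd None (c * r, t - r))"
        using AE_integral_cong[OF ae] g(2) h(2) by (simp add: Ud_def)
    qed
  qed
qed

lemma error_eq_explicit:
  shows "AE t in lebesgue. \<forall>s\<ge>0. (a i * s, t + s) \<in> DT \<longrightarrow> u (a i * s) (t + s) $ i = eb (a i * s) (t + s) $ i"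
    and "AE t in lebesgue. \<forall>s\<ge>0. (c * s, t - s) \<in> DT \<longrightarrow> z (c * s) (t - s) = zb (c * s) (t - s)"
proof -
  \<comment> \<open>Speeds in \<open>x\<close>; the companion \<open>e\<close> is the direction of
    time, which is reversed for the fourth state.\<close>
  define m where "m = case_option c a"
  define e :: "'n option \<Rightarrow> real" where "e = case_option (- 1) (\<lambda>_. 1)"
  have "AE y in lebesgue. \<forall>s\<ge>0. (m j * s, y + e j * s) \<in> DT \<longrightarrow> Ud j (m j * s, y + e j * s) = 0" for j
  proof (rule characteristic_uniqueness[where K = "Kc * (real CARD('n) + 1)"])
    show "0 < m j" for j using c_pos a_pos by (simp add: m_def split: option.split)
    show "DT \<in> sets borel" by (rule DT_borel)
    show "w \<in> DT \<Longrightarrow> 0 \<le> fst w" for w by (simp add: DT_def)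
    show "(m j * r, y + e j * r) \<in> DT" if "(m j * s, y + e j * s) \<in> DT" "0 \<le> r" "r \<le> s" for j y s r
      using that DT_segment_u(1)[of _ s y r] DT_segment_z(1)[of s y r] by (cases j) (auto simp: m_def e_def)
    show "\<exists>g C. g \<in> borel_measurable borel \<and> (\<forall>w. \<bar>g w\<bar> \<le> C) \<and> (AE w in lebesgue. w \<in> DT \<longrightarrow> Ud j w = g w)" for j
      by (rule Ud_version)
    show "\<bar>fd j w\<bar> \<le> Kc * (real CARD('n) + 1) * C" if "w \<in> DT" "\<And>j'. \<bar>Ud j' w\<bar> \<le> C" for j w C
      by (rule fd_bound[OF that])
    show "AE y in lebesgue. \<forall>s\<ge>0. (m j * s, y + e j * s) \<in> DT \<longrightarrow>
      (\<lambda>r. fd j (m j * r, y + e j * r)) absolutely_integrable_on {0..s} \<and>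
      Ud j (m j * s, y + e j * s) = integral {0..s} (\<lambda>r. fd j (m j * r, y + e j * r))" for j
      using Ud_char_u Ud_char_z by (cases j) (simp_all add: m_def e_def)
  qed
  from this[of "Some i"] this[of None]
  show "AE t in lebesgue. \<forall>s\<ge>0. (a i * s, t + s) \<in> DT \<longrightarrow> u (a i * s) (t + s) $ i = eb (a i * s) (t + s) $ i"
    and "AE t in lebesgue. \<forall>s\<ge>0. (c * s, t - s) \<in> DT \<longrightarrow> z (c * s) (t - s) = zb (c * s) (t - s)"
    by (simp_all add: m_def e_def Ud_def)
qed

end


section \<open>Finite-time convergence\<close>

context traced_error_system
begin

lemma trace_vanishes: "AE t in lebesgue. t \<in> {L / v + L / c..T} \<longrightarrow> b t = 0"
proof -
  have DT_L: "(L, t) \<in> DT" if "L / v \<le> t" "t + L / c \<le> T" for t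
    using that L_pos by (simp add: DT_def)
  have "AE t in lebesgue. L / v \<le> t \<and> t + L / c \<le> T \<longrightarrow> u L t $ i = eb L t $ i" for i
  proof -
    have "AE t in lebesgue. \<forall>s\<ge>0. (a i * s, - (L / a i) + 1 * t + s) \<in> DT \<longrightarrow>
        u (a i * s) (- (L / a i) + 1 * t + s) $ i = eb (a i * s) (- (L / a i) + 1 * t + s) $ i"
      by (rule AE_affine[OF error_eq_explicit(1)]) simp
    then show ?thesis
    proof eventually_elim
      case (elim t)
      have "0 \<le> L / a i" "a i * (L / a i) = L" using L_pos a_pos[of i] by auto
      with elim[rule_format, of "L / a i"] DT_L[of t] show ?case by simp
    qed
  qed
  then have ueb: "AE t in lebesgue. \<forall>i. L / v \<le> t \<and> t + L / c \<le> T \<longrightarrow> u L t $ i = eb L t $ i"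
    by (rule AE_all_finite_index)
  have "AE t in lebesgue. \<forall>s\<ge>0. (c * s, L / c + 1 * t - s) \<in> DT \<longrightarrow>
      z (c * s) (L / c + 1 * t - s) = zb (c * s) (L / c + 1 * t - s)"
    by (rule AE_affine[OF error_eq_explicit(2)]) simp
  with ueb z_L have "AE t in lebesgue. L / v \<le> t \<and> t + L / c \<le> T \<longrightarrow> b (t + L / c) = 0"
  proof eventually_elim
    case (elim t)
    show ?case
    proof
      assume t: "L / v \<le> t \<and> t + L / c \<le> T"
      have Lc: "0 \<le> L / c" "c * (L / c) = L" using L_pos c_pos by auto
      have "0 \<le> L / v" using L_pos v_pos by simp
      then have "z L t = R \<bullet> u L t" using elim(2) t by simp
      also have "u L t = eb L t" using elim(1) t by (simp add: vec_eq_iff)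
      also have "z L t = zb L t"
        using elim(3)[rule_format, of "L / c"] Lc DT_L t by simp
      also have "zb L t = b (t + L / c) + R \<bullet> eb L t"
        unfolding zb_def eb_inner by (simp add: Nk_def)
      finally show "b (t + L / c) = 0" by simp
    qed
  qed
  from AE_affine[OF this one_neq_zero, of "- (L / c)"] show ?thesis by eventually_elim auto
qed

lemma error_vanishes:
  assumes t: "L / v + L / c \<le> t" "t + L / c \<le> T"
  shows "AE x in lebesgue. x \<in> {0..L} \<longrightarrow> u x t = 0 \<and> z x t = 0"
proof -
  have v0: "0 \<le> L / v" "0 \<le> L / c" using L_pos v_pos c_pos by auto
  have DT: "(x, t) \<in> DT" if "x \<in> {0..L}" for x
  proof -
    have "x / v \<le> L / v" "x / c \<le> L / c" using that v_pos c_pos by (auto intro: divide_right_mono)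
    then show ?thesis using that t v0 by (simp add: DT_def)
  qed
  have int0: "(LINT \<sigma>|lborel. indicator {t..t + x / c} \<sigma> * (h \<sigma> * b \<sigma>)) = 0" if "x \<in> {0..L}" for x h
  proof (rule integral_eq_zero_AE)
    have xc: "x / c \<le> L / c" using that c_pos by (auto intro: divide_right_mono)
    have "AE \<sigma> in lborel. \<sigma> \<in> {L / v + L / c..T} \<longrightarrow> b \<sigma> = 0"
      using trace_vanishes by (simp only: AE_completion_iff)
    then show "AE \<sigma> in lborel. indicator {t..t + x / c} \<sigma> * (h \<sigma> * b \<sigma>) = 0"
      by eventually_elim (use t xc in \<open>auto split: split_indicator\<close>)
  qed
  have "AE x in lebesgue. x \<in> {0..L} \<longrightarrow> u x t $ i = 0" for i
  proof -
    have "AE x in lebesgue. \<forall>s\<ge>0. (a i * s, t + (- 1 / a i) * x + s) \<in> DT \<longrightarrow>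
        u (a i * s) (t + (- 1 / a i) * x + s) $ i = eb (a i * s) (t + (- 1 / a i) * x + s) $ i"
      by (rule AE_affine[OF error_eq_explicit(1)]) (use a_pos[of i] in simp)
    then show ?thesis
    proof eventually_elim
      case (elim x)
      show ?case
      proof
        assume x: "x \<in> {0..L}"
        have "0 \<le> x / a i" "a i * (x / a i) = x" "t + (- 1 / a i) * x + x / a i = t" using x a_pos[of i] by auto
        with elim[rule_format, of "x / a i"] DT[OF x] have "u x t $ i = eb x t $ i" by simp
        then show "u x t $ i = 0" using int0[OF x] by (simp add: eb_def)
      qed
    qed
  qed
  then have "AE x in lebesgue. \<forall>i. x \<in> {0..L} \<longrightarrow> u x t $ i = 0" by (rule AE_all_finite_index)
  moreover have "AE x in lebesgue. \<forall>s\<ge>0. (c * s, t + (1 / c) * x - s) \<in> DT \<longrightarrow>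
      z (c * s) (t + (1 / c) * x - s) = zb (c * s) (t + (1 / c) * x - s)"
    by (rule AE_affine[OF error_eq_explicit(2)]) (use c_pos in simp)
  moreover have "AE x in lebesgue. t + (1 / c) * x \<in> {L / v + L / c..T} \<longrightarrow> b (t + (1 / c) * x) = 0"
    by (rule AE_affine[OF trace_vanishes]) (use c_pos in simp)
  ultimately show ?thesis
  proof eventually_elim
    case (elim x)
    show ?case
    proof (intro impI conjI)
      assume x: "x \<in> {0..L}"
      then show "u x t = 0" using elim(1) by (simp add: vec_eq_iff)
      have xc: "0 \<le> x / c" "x / c \<le> L / c" "c * (x / c) = x" "t + (1 / c) * x - x / c = t"
        using x c_pos by (auto intro: divide_right_mono)
      with elim(2)[rule_format, of "x / c"] DT[OF x] have "z x t = zb x t" by simp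
      moreover have "b (t + x / c) = 0" using elim(3) xc t by simp
      ultimately show "z x t = 0" using int0[OF x] by (simp add: zb_def)
    qed
  qed
qed

end

lemma (in error_system) finite_time:
  assumes "L / v + L / c \<le> t"
  shows "AE x in lebesgue. x \<in> {0..L} \<longrightarrow> u x t = 0 \<and> z x t = 0"
proof -
  \<comment> \<open>The latest time at which a characteristic of the fourth state that meets time
    \<open>t\<close> in \<open>[0, L]\<close> arrives at \<open>x = 0\<close>.\<close>
  define T where "T = t + L / c"
  have "0 < L / v" "0 < L / c" using L_pos v_pos c_pos by auto
  then have T: "0 < T" using assms by (simp add: T_def)
  obtain b B where b: "b \<in> borel_measurable borel" "\<forall>t. \<bar>b t\<bar> \<le> B"
      "AE t in lebesgue. t \<in> {0..T} \<longrightarrow> z 0 t = b t"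
    using transport_trace_borel[OF tz c_pos L_pos T Linf_z[OF T]] by blast
  interpret traced_error_system L c a S sp sm R F v u z Pp Pm b B T
    by unfold_locales (use b T kernel in auto)
  show ?thesis by (rule error_vanishes) (use assms in \<open>auto simp: T_def\<close>)
qed

section \<open>The error equations by linearity, and the order of the speeds\<close>

lemma AE_lebesgue_on_iff:
  "S \<in> sets lebesgue \<Longrightarrow> (AE x in lebesgue_on S. P x) \<longleftrightarrow> (AE x in lebesgue. x \<in> S \<longrightarrow> P x)"
  by (simp add: AE_restrict_space_iff)

lemma Linf_on_diff:
  assumes "Linf_on X f" "Linf_on X g"
  shows "Linf_on X (\<lambda>z. f z - g z)"
proof -
  obtain C C' where "AE x in lebesgue_on X. norm (f x) \<le> C" "AE x in lebesgue_on X. norm (g x) \<le> C'"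
    using assms unfolding Linf_on_def by blast
  then have "AE x in lebesgue_on X. norm (f x - g x) \<le> C + C'"
    by eventually_elim (rule order_trans[OF norm_triangle_ineq4 add_mono])
  with assms show ?thesis unfolding Linf_on_def by (auto intro: borel_measurable_diff)
qed

lemma transport_diff:
  assumes "transport l c u f" "transport l c u' f'"
  shows "transport l c (\<lambda>x t. u x t - u' x t) (\<lambda>x t. f x t - f' x t)"
  using assms unfolding transport_def
proof eventually_elim
  case (elim y)
  show ?case
  proof (intro allI impI)
    fix s t assume st: "0 \<le> s \<and> s \<le> t \<and> y + c * s \<in> {0..l} \<and> y + c * t \<in> {0..l}"
    let ?g = "\<lambda>r. f (y + c * r) r" and ?g' = "\<lambda>r. f' (y + c * r) r"
    have i: "?g absolutely_integrable_on {s..t}" "?g' absolutely_integrable_on {s..t}"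
      and e: "u (y + c * t) t - u (y + c * s) s = integral {s..t} ?g"
        "u' (y + c * t) t - u' (y + c * s) s = integral {s..t} ?g'"
      using elim st by blast+
    have "integral {s..t} (\<lambda>r. ?g r - ?g' r) = integral {s..t} ?g - integral {s..t} ?g'"
      using i by (intro integral_diff) (auto simp: absolutely_integrable_on_def)
    with e set_integral_diff(1)[OF i]
    show "(\<lambda>r. ?g r - ?g' r) absolutely_integrable_on {s..t} \<and>
        u (y + c * t) t - u' (y + c * t) t - (u (y + c * s) s - u' (y + c * s) s) =
        integral {s..t} (\<lambda>r. ?g r - ?g' r)" by simp
  qed
qed

lemma weak_solution_diff:
  assumes "weak_solution p F G w z" "weak_solution p F' G' w' z'"
  shows "weak_solution p (\<lambda>x t. F x t - F' x t) (\<lambda>x t. G x t - G' x t)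
    (\<lambda>x t. w x t - w' x t) (\<lambda>x t. z x t - z' x t)"
proof -
  have L: "Linf_on X (\<lambda>(x, t). f x t - g x t)"
    if "Linf_on X (\<lambda>(x, t). f x t)" "Linf_on X (\<lambda>(x, t). g x t)"
    for X and f g :: "real \<Rightarrow> real \<Rightarrow> 'b::euclidean_space"
    using Linf_on_diff[OF that] by (simp add: split_beta')
  show ?thesis
    using assms unfolding weak_solution_def by (auto intro!: L transport_diff)
qed

text \<open>The same \<open>U\<close> enters both systems, and the inflow of the observer uses the
  measured \<open>w4 0 t\<close> rather than \<open>wh4 0 t\<close>, so the error has zero inflow;
  the rest is linearity.\<close>

lemma error_dynamics:
  assumes "plant_solution p V U w w4" "observer_solution p V Pp Pm U (\<lambda>t. w4 0 t) wh wh4"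
  shows "error_solution p V Pp Pm (\<lambda>x t. wh x t - w x t) (\<lambda>x t. wh4 x t - w4 x t)"
proof -
  note P = assms(1)[unfolded plant_solution_def] and O = assms(2)[unfolded observer_solution_def]
  from weak_solution_diff[OF O[THEN conjunct1] P[THEN conjunct1]]
  have "weak_solution p
       (\<lambda>x t. Sigpp p V x *v (wh x t - w x t) + (wh4 x t - w4 x t) *\<^sub>R Sigpm p V x - (wh4 0 t - w4 0 t) *\<^sub>R Pp x)
       (\<lambda>x t. Sigmp p V x \<bullet> (wh x t - w x t) - Pm x * (wh4 0 t - w4 0 t))
       (\<lambda>x t. wh x t - w x t) (\<lambda>x t. wh4 x t - w4 x t)"
    by (simp add: matrix_vector_mult_diff_distrib inner_diff_right algebra_simps)
  moreover have "AE t in lebesgue_on {0..}. wh 0 t - w 0 t = 0"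
    using P[THEN conjunct2, THEN conjunct1] O[THEN conjunct2, THEN conjunct1] by eventually_elim simp
  moreover have "AE t in lebesgue_on {0..}. wh4 (len p) t - w4 (len p) t = R1 p V \<bullet> (wh (len p) t - w (len p) t)"
    using P[THEN conjunct2, THEN conjunct2] O[THEN conjunct2, THEN conjunct2]
    by eventually_elim (simp add: inner_diff_right)
  ultimately show ?thesis unfolding error_solution_def by blast
qed

text \<open>The pressure is a positive multiple of a positive power of \<phi>, which is affine in
  the density with positive slope \<open>d\<close> and positive at equilibrium.\<close>

lemma alpha_nonneg:
  assumes "admissible p"
  shows "0 \<le> alpha p i"
proof -
  have pos: "0 < width p" "\<And>k. 0 < area p $ k" "\<And>k. 0 < vmax p $ k" "\<And>k. 1 < gam p $ k"
    "\<And>k. 0 < aomax p $ k" "\<And>k. 0 < rho p $ k"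
    using assms by (auto simp: admissible_def)
  define \<phi> where "\<phi> s = AO p (\<chi> k. if k = i then s else rho p $ k) / aomax p $ i" for s
  define d where "d = area p $ i / width p / aomax p $ i"
  have \<phi>: "(\<phi> has_real_derivative d) (at s)" for s
  proof -
    have "i = 1 \<or> i = 2" by (rule exhaust_2)
    then show ?thesis unfolding \<phi>_def AO_def d_def
      by (auto intro!: derivative_eq_intros simp: pos less_imp_neq[symmetric])
  qed
  have "(\<chi> k. if k = i then rho p $ i else rho p $ k) = rho p" by (simp add: vec_eq_iff)
  then have \<phi>_pos: "0 < \<phi> (rho p $ i)" using pos by (simp add: \<phi>_def AO_def add_pos_pos)
  have "((\<lambda>s. vmax p $ i * \<phi> s powr gam p $ i) has_real_derivative
      vmax p $ i * (gam p $ i * \<phi> (rho p $ i) powr (gam p $ i - 1) * d)) (at (rho p $ i))"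
    by (rule DERIV_cmult, rule has_real_derivative_powr'[OF \<phi> DERIV_const, THEN DERIV_cong])
      (use \<phi>_pos in \<open>auto simp: powr_diff\<close>)
  then have "beta p i i = vmax p $ i * (gam p $ i * \<phi> (rho p $ i) powr (gam p $ i - 1) * d)"
    unfolding beta_def pressure_def \<phi>_def by (rule DERIV_imp_deriv)
  also have "\<dots> \<ge> 0" using pos less_trans[OF zero_less_one pos(4)] by (simp add: d_def less_imp_le)
  finally show ?thesis by (simp add: alpha_def)
qed

text \<open>In the notation of the proof the claim is \<open>A + B - \<delta> \<le> Delta p\<close>,
  and the squares of the two sides differ by \<open>4 * \<delta> * B\<close>. It makes
  \<open>vstar p 2\<close> the slowest of the three positive speeds, hence the one in
  \<open>tF\<close>.\<close>

lemma lam_3_ge: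
  assumes "admissible p" "vstar p 2 < vstar p 1"
  shows "vstar p 2 \<le> lam p $ 3"
proof -
  define A where "A = alpha p 1 * rho p $ 1"
  define B where "B = alpha p 2 * rho p $ 2"
  define \<delta> where "\<delta> = vstar p 1 - vstar p 2"
  have "0 < rho p $ 2" using assms(1) by (simp add: admissible_def)
  then have B: "0 \<le> B" using alpha_nonneg[OF assms(1), of 2] by (simp add: B_def)
  have D: "Delta p = sqrt ((B - A + \<delta>)\<^sup>2 + 4 * A * B)"
    by (simp add: Delta_def A_def B_def \<delta>_def algebra_simps)
  have "(A + B - \<delta>)\<^sup>2 \<le> (B - A + \<delta>)\<^sup>2 + 4 * A * B"
    using mult_nonneg_nonneg[of \<delta> B] B assms(2) by (simp add: \<delta>_def power2_eq_square algebra_simps)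
  then have "A + B - \<delta> \<le> Delta p" unfolding D by (rule real_le_rsqrt)
  then show ?thesis by (simp add: lam_def A_def B_def \<delta>_def vector_def)
qed


section \<open>Specialization of the abstract systems to the traffic model\<close>

lemma continuous_on_vec3:
  fixes f :: "'a::topological_space \<Rightarrow> 'b::real_normed_vector^3"
  assumes "continuous_on X (\<lambda>x. f x $ 1)" "continuous_on X (\<lambda>x. f x $ 2)" "continuous_on X (\<lambda>x. f x $ 3)"
  shows "continuous_on X f"
proof -
  have "continuous_on X (\<lambda>x. f x $ i)" for i
    using exhaust_3[of i] assms by auto
  then have "continuous_on X (\<lambda>x. \<chi> i. f x $ i)" by (rule continuous_on_vec_lambda)
  then show ?thesis by simp
qed

lemma Jsc_continuous: "continuous_on X (Jsc p V i j)"
  unfolding Jsc_def by (intro continuous_intros)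

lemma coefficients_continuous:
  "continuous_on X (Sigpp p V)" "continuous_on X (Sigpm p V)" "continuous_on X (Sigmp p V)"
  by (intro continuous_on_vec3; simp add: Sigpp_def Sigpm_def Sigmp_def Jsc_continuous)+

lemma diag_mult_component: "(diag d *v x) $ i = d $ i * (x $ i :: real)"
  by (simp add: diag_def matrix_vector_mult_def if_distrib[of "\<lambda>t. t * _"] cong: if_cong)

lemma kernel_data_traffic:
  assumes "admissible p" "congested p"
  shows "kernel_data (len p) (Lamm p) (\<lambda>i. Lamp p $ i $ i) (Sigpp p V) (Sigpm p V) (Sigmp p V)"
proof
  show "0 < len p" using assms(1) by (simp add: admissible_def)
  show "0 < Lamm p" using assms(2) by (simp add: congested_def Lamm_def)
  show "0 < Lamp p $ i $ i" for i
    using assms(2) exhaust_3[of i] by (auto simp: Lamp_def diag_def congested_def)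
qed (rule coefficients_continuous)+

lemma slowest_speed:
  assumes "admissible p" "congested p"
  shows "vstar p 2 \<le> Lamp p $ i $ i"
  using assms lam_3_ge[OF assms(1)] exhaust_3[of i] by (auto simp: Lamp_def diag_def congested_def)

context
  fixes p :: traffic and V :: "real^4^4"
  assumes adm: "admissible p" and cong: "congested p"
begin

interpretation kernel_data "len p" "Lamm p" "\<lambda>i. Lamp p $ i $ i" "Sigpp p V" "Sigpm p V" "Sigmp p V" "R1 p V"
  by (rule kernel_data_traffic[OF adm cong])

lemma N11_eq: "N11 p V M = NM M"
proof (intro ext)
  fix x \<xi>
  have lam: "lam p $ 4 = - Lamm p" by (simp add: Lamm_def)
  have "(x - len p) / - Lamm p = (len p - x) / Lamm p"
    by (metis minus_diff_eq minus_divide_divide)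
  then show "N11 p V M x \<xi> = NM M x \<xi>"
    unfolding N11_def kernel_refl_def kernel_int_def NM_def lam by simp
qed

lemma kernel_source_eq: "kernel_source p V M = ks M"
proof (intro ext)
  fix x \<xi>
  show "kernel_source p V M x \<xi> = ks M x \<xi>"
    unfolding ks_def N11_eq[symmetric] by (simp add: kernel_source_def N11_def scaleR_add_left)
qed

lemma Tri_eq: "Tri p = Tr"
  by (simp add: Tri_def Tr_def)

lemma kernel_solution_iff: "kernel_solution p V M \<longleftrightarrow> ksol M"
proof -
  have "0 = Lamm p *\<^sub>R M \<xi> \<xi> + Lamp p *v M \<xi> \<xi> - Sigpm p V \<xi> \<longleftrightarrow>
      (\<forall>i. (Lamp p $ i $ i + Lamm p) * M \<xi> \<xi> $ i = Sigpm p V \<xi> $ i)" for \<xi>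
  proof -
    have "(Lamp p *v x) $ i = Lamp p $ i $ i * x $ i" for x i
      unfolding Lamp_def diag_mult_component by (simp add: diag_def)
    then show ?thesis by (auto simp: vec_eq_iff algebra_simps)
  qed
  then show ?thesis
    unfolding kernel_solution_def ksol_def Tri_eq kernel_source_eq
    by (simp add: AE_lebesgue_on_iff)
qed

lemma well_posed: "kernel_well_posed p V"
proof -
  have "\<exists>M. ksol M" using kernel_fixed_exists ksol_of_kernel_fixed by blast
  moreover have "AE (x, \<xi>) in lebesgue_on (Tri p). M x \<xi> = M' x \<xi>" if "ksol M" "ksol M'" for M M'
    using ksol_unique(1)[OF that] by (simp add: Tri_eq AE_lebesgue_on_iff Tr_borel split_beta')
  ultimately show ?thesis unfolding kernel_well_posed_def kernel_solution_iff by blast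
qed

lemma error_finite_time:
  assumes err: "error_solution p V Pp Pm u z"
    and M: "kernel_solution p V M" "observer_gains p V M Pp Pm"
    and t: "tF p \<le> t"
  shows "AE x in lebesgue_on {0..len p}. u x t = 0 \<and> z x t = 0"
proof -
  obtain F where F: "kernel_fixed F" using kernel_fixed_exists by blast
  have M': "ksol M" using M(1) by (simp add: kernel_solution_iff)
  note E = err[unfolded error_solution_def weak_solution_def]
  have "error_system (len p) (Lamm p) (\<lambda>i. Lamp p $ i $ i) (Sigpp p V) (Sigpm p V) (Sigmp p V) (R1 p V)
      F (vstar p 2) u z Pp Pm"
  proof
    show "kernel_fixed F" by fact
    show "0 < vstar p 2" using cong by (simp add: congested_def)
    show "vstar p 2 \<le> Lamp p $ i $ i" for i by (rule slowest_speed[OF adm cong])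
    \<comment> \<open>The gains come from an arbitrary solution \<open>M\<close>; uniqueness on
      \<xi> = 0 replaces it by the continuous kernel outside a null set of \<open>x\<close>.\<close>
    show "AE x in lebesgue. x \<in> {0..len p} \<longrightarrow> Pp x = Lamm p *\<^sub>R F (x, x) \<and> Pm x = Lamm p * Nk F x x"
      using ksol_unique(2)[OF M' ksol_of_kernel_fixed[OF F]]
    proof eventually_elim
      case (elim x)
      show ?case
      proof
        assume x: "x \<in> {0..len p}"
        have "Pp x = Lamm p *\<^sub>R M x 0" "Pm x = Lamm p * NM M x 0"
          using M(2) x by (simp_all add: observer_gains_def Lamm_def N11_eq)
        with elim x NM_eq_Nk[of x F 0]
        show "Pp x = Lamm p *\<^sub>R F (x, x) \<and> Pm x = Lamm p * Nk F x x" by simp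
      qed
    qed
  qed (use E in \<open>simp_all add: AE_lebesgue_on_iff\<close>)
  then interpret error_system "len p" "Lamm p" "\<lambda>i. Lamp p $ i $ i" "Sigpp p V" "Sigpm p V" "Sigmp p V" "R1 p V"
      F "vstar p 2" u z Pp Pm .
  have "len p / vstar p 2 + len p / Lamm p \<le> t" using t by (simp add: tF_def Lamm_def)
  from finite_time[OF this] show ?thesis by (subst AE_lebesgue_on_iff) simp_all
qed

end

theorem theorem2:
  fixes p :: traffic and V :: "real^4^4"
    and w wh :: "real \<Rightarrow> real \<Rightarrow> real^3" and w4 wh4 :: "real \<Rightarrow> real \<Rightarrow> real"
    and U :: "real \<Rightarrow> real" and Pp :: "real \<Rightarrow> real^3" and Pm :: "real \<Rightarrow> real"
  assumes "admissible p" and "congested p"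
    and "diagonalizes p V"
    and "invertible (inflow_matrix p V)" and "kappa p V $ 4 \<noteq> 0"
    and "plant_solution p V U w w4"
    and "observer_solution p V Pp Pm U (\<lambda>t. w4 0 t) wh wh4"
  shows "error_solution p V Pp Pm (\<lambda>x t. wh x t - w x t) (\<lambda>x t. wh4 x t - w4 x t) \<and>
    kernel_well_posed p V \<and>
    (\<forall>M. kernel_solution p V M \<and> observer_gains p V M Pp Pm \<and>
         Linf_on {0..len p} (\<lambda>x. wh x 0 - w x 0) \<and>
         Linf_on {0..len p} (\<lambda>x. wh4 x 0 - w4 x 0) \<longrightarrow>
         (\<forall>t\<ge>tF p. AE x in lebesgue_on {0..len p}. wh x t - w x t = 0 \<and> wh4 x t - w4 x t = 0))"
proof (intro conjI allI impI)
  show err: "error_solution p V Pp Pm (\<lambda>x t. wh x t - w x t) (\<lambda>x t. wh4 x t - w4 x t)"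
    by (rule error_dynamics[OF assms(6,7)])
  show "kernel_well_posed p V" by (rule well_posed[OF assms(1,2)])
  fix M t
  assume "kernel_solution p V M \<and> observer_gains p V M Pp Pm \<and>
         Linf_on {0..len p} (\<lambda>x. wh x 0 - w x 0) \<and>
         Linf_on {0..len p} (\<lambda>x. wh4 x 0 - w4 x 0)" and "tF p \<le> t"
  then show "AE x in lebesgue_on {0..len p}. wh x t - w x t = 0 \<and> wh4 x t - w4 x t = 0"
    by (intro error_finite_time[OF assms(1,2) err]) auto
qed

end
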